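(* Fix $\varepsilon>0$ and let $c$ be a diffusion coefficient satisfying the minimal amplitude hypothesis with respect to $\mathscr{A}^c_\varepsilon$. For any $(\mu_k,\lambda)\in\mathscr{A}^c_\varepsilon$ let $v_\lambda(x',y)=\phi_k(x')u_{\lambda,k}(y)$ be the associated eigenfunction of $A=-\tilde c\,\Delta$. Let $\omega=\omega'\times(a,b)\subseteq\Omega$ be a nonempty open set. If $\omega'\neq\Omega'$, assume that the family $\{\phi_k\}_{k\ge1}$ does not concentrate in $\Omega'\setminus\omega'$. Then there exists a constant $C_\omega>0$ such that $$0<C_\omega\le\inf_{(\mu_k,\lambda)\in\mathscr{A}^c_\varepsilon}\frac{\|v_\lambda\|_{L^2(\omega)}}{\|v_\lambda\|_{L^2(\Omega)}}\le1 .$$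
   Context: Let $d\ge 1$, let $\Omega'\subset\mathbb{R}^d$ be an open bounded smooth domain, $H>0$, $\Omega=\Omega'\times(0,H)$ with points $x=(x',y)$. Let $(\mu_k^2,\phi_k)_{k\ge1}$, $\mu_k>0$, be the eigenvalues (nondecreasing, counted with multiplicity) and corresponding orthonormal eigenfunctions of $-\Delta_{x'}$ in $L^2(\Omega')$ with domain $H^2(\Omega')\cap H^1_0(\Omega')$. Let $c\in L^\infty(0,H)$ with $0<c_m=\operatorname{ess\,inf}c<c_M=\operatorname{ess\,sup}c$, and $\tilde c(x',y)=c(y)$. $A=-\tilde c\,\Delta$ acts in $L^2(\Omega;\tilde c^{-1}dx)$ with domain $H^2(\Omega)\cap H^1_0(\Omega)$; $A_k=c(y)\big(\mu_k^2-\frac{d^2}{dy^2}\big)$ acts in $L^2((0,H),c(y)^{-1}dy)$ with domain $H^2(0,H)\cap H^1_0(0,H)$. The eigenvalues of each $A_k$ are simple; for an eigenvalue $\lambda$ of $A_k$, $u_{\lambda,k}$ is the real eigenfunction of $A_k$ with $\int_0^Hu_{\lambda,k}^2c^{-1}dy=1$. Define $\mathscr{A}^c_\varepsilon=\{(\mu_k,\lambda): k\ge1,\ \lambda\text{ an eigenvalue of }A_k,\ \lambda\ge(c_M+\varepsilon)\mu_k^2\}$ and $\mathfrak{r}_c^2=\inf\{u_{\lambda,k}(y)^2+u_{\lambda,k}'(y)^2:\ y\in[0,H],\ (\mu_k,\lambda)\in\mathscr{A}^c_\varepsilon\}$. The coefficient $c$ satisfies the minimal amplitude hypothesis with respect to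 $\mathscr{A}^c_\varepsilon$ if $\mathfrak{r}_c>0$. The family $\{\phi_k\}$ "does not concentrate in $\Omega'\setminus\omega'$" means that no subsequence satisfies $\|\phi_{k_j}\|^2_{L^2(\omega')}/\|\phi_{k_j}\|^2_{L^2(\Omega')}\to0$, i.e. $\liminf_{k\to\infty}\|\phi_k\|^2_{L^2(\omega')}/\|\phi_k\|^2_{L^2(\Omega')}>0$. *)

theory Defs
  imports "HOL-Analysis.Analysis" "HOL-Probability.Essential_Supremum"
begin

section \<open>Smooth functions, test functions and smooth domains\<close>

definition partial :: "'a::euclidean_space \<Rightarrow> ('a \<Rightarrow> real) \<Rightarrow> 'a \<Rightarrow> real" where
  "partial b f x = frechet_derivative f (at x) b"

text \<open>Only meant for open \<open>U\<close>.\<close>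

primrec Ck_on :: "nat \<Rightarrow> 'a::euclidean_space set \<Rightarrow> ('a \<Rightarrow> real) \<Rightarrow> bool" where
  "Ck_on 0 U f \<longleftrightarrow> continuous_on U f"
| "Ck_on (Suc n) U f \<longleftrightarrow> f differentiable_on U \<and> (\<forall>b\<in>Basis. Ck_on n U (partial b f))"

definition smooth_on :: "'a::euclidean_space set \<Rightarrow> ('a \<Rightarrow> real) \<Rightarrow> bool" where
  "smooth_on U f \<longleftrightarrow> (\<forall>n. Ck_on n U f)"

definition test_fun :: "'a::euclidean_space set \<Rightarrow> ('a \<Rightarrow> real) \<Rightarrow> bool" where
  "test_fun U \<psi> \<longleftrightarrow>
     smooth_on UNIV \<psi> \<and> compact (closure {x. \<psi> x \<noteq> 0}) \<and> closure {x. \<psi> x \<noteq> 0} \<subseteq> U"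

text \<open>Smoothness of the boundary is expressed by local defining functions \<open>\<rho>\<close>; since the
gradient of \<open>\<rho>\<close> has no zero, \<open>U\<close> lies locally on one side of the hypersurface \<open>\<rho> = 0\<close>.\<close>

definition smooth_bounded_domain :: "'a::euclidean_space set \<Rightarrow> bool" where
  "smooth_bounded_domain U \<longleftrightarrow>
     open U \<and> connected U \<and> bounded U \<and> U \<noteq> {} \<and>
     (\<forall>p\<in>frontier U. \<exists>V \<rho>. open V \<and> p \<in> V \<and> smooth_on V \<rho> \<and>
        (\<forall>x\<in>V. \<exists>b\<in>Basis. partial b \<rho> x \<noteq> 0) \<and> U \<inter> V = {x \<in> V. \<rho> x < 0})"


section \<open>Lebesgue and Sobolev spaces\<close>

text \<open>Elements of the function spaces on \<open>U\<close> are represented by functions on the whole type;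
their values outside \<open>U\<close> are irrelevant.\<close>

definition L2_on :: "'a::euclidean_space set \<Rightarrow> ('a \<Rightarrow> real) set" where
  "L2_on U = {f. set_borel_measurable lborel U f \<and> set_integrable lborel U (\<lambda>x. (f x)\<^sup>2)}"

definition L2_norm_on :: "'a::euclidean_space set \<Rightarrow> ('a \<Rightarrow> real) \<Rightarrow> real" where
  "L2_norm_on U f = sqrt (LINT x:U|lborel. (f x)\<^sup>2)"

definition weak_deriv ::
  "'a::euclidean_space set \<Rightarrow> 'a \<Rightarrow> ('a \<Rightarrow> real) \<Rightarrow> ('a \<Rightarrow> real) \<Rightarrow> bool" where
  "weak_deriv U b f g \<longleftrightarrow>
     (\<forall>\<psi>. test_fun U \<psi> \<longrightarrow>
        (LINT x:U|lborel. f x * partial b \<psi> x) = - (LINT x:U|lborel. g x * \<psi> x))"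

text \<open>\<open>sobolev k U\<close> is \<open>H\<^sup>k(U)\<close>: all weak derivatives up to order \<open>k\<close> are square integrable.\<close>

primrec sobolev :: "nat \<Rightarrow> 'a::euclidean_space set \<Rightarrow> ('a \<Rightarrow> real) set" where
  "sobolev 0 U = L2_on U"
| "sobolev (Suc k) U = {f \<in> L2_on U. \<forall>b\<in>Basis. \<exists>g\<in>sobolev k U. weak_deriv U b f g}"

text \<open>\<open>H\<^sup>1\<^sub>0(U)\<close>, the closure of the test functions in \<open>H\<^sup>1(U)\<close>. The inner quantifier over \<open>g\<close> is
harmless because weak derivatives are unique almost everywhere.\<close>

definition sobolev_1_0 :: "'a::euclidean_space set \<Rightarrow> ('a \<Rightarrow> real) set" where
  "sobolev_1_0 U = {f \<in> sobolev 1 U. \<exists>\<psi>::nat \<Rightarrow> 'a \<Rightarrow> real.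
     (\<forall>n. test_fun U (\<psi> n)) \<and>
     (\<lambda>n. L2_norm_on U (\<lambda>x. \<psi> n x - f x)) \<longlonglongrightarrow> 0 \<and>
     (\<forall>b\<in>Basis. \<forall>g\<in>L2_on U. weak_deriv U b f g \<longrightarrow>
        (\<lambda>n. L2_norm_on U (\<lambda>x. partial b (\<psi> n) x - g x)) \<longlonglongrightarrow> 0)}"

definition weak_laplacian ::
  "'a::euclidean_space set \<Rightarrow> ('a \<Rightarrow> real) \<Rightarrow> ('a \<Rightarrow> real) \<Rightarrow> bool" where
  "weak_laplacian U f h \<longleftrightarrow>
     (\<exists>g g2. (\<forall>b\<in>Basis. g b \<in> L2_on U \<and> weak_deriv U b f (g b) \<and>
                 g2 b \<in> L2_on U \<and> weak_deriv U b (g b) (g2 b)) \<and>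
             h = (\<lambda>x. \<Sum>b\<in>Basis. g2 b x))"

definition Linf_on :: "'a::euclidean_space set \<Rightarrow> ('a \<Rightarrow> real) \<Rightarrow> bool" where
  "Linf_on U f \<longleftrightarrow> f \<in> borel_measurable (restrict_space lborel U) \<and>
     esssup (restrict_space lborel U) (\<lambda>x. ereal \<bar>f x\<bar>) < \<infinity>"

text \<open>Real-valued essential bounds, meaningful for functions satisfying \<^const>\<open>Linf_on\<close>.\<close>

definition ess_sup_on :: "'a::euclidean_space set \<Rightarrow> ('a \<Rightarrow> real) \<Rightarrow> real" where
  "ess_sup_on U f = real_of_ereal (esssup (restrict_space lborel U) (\<lambda>x. ereal (f x)))"

definition ess_inf_on :: "'a::euclidean_space set \<Rightarrow> ('a \<Rightarrow> real) \<Rightarrow> real" where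
  "ess_inf_on U f = - ess_sup_on U (\<lambda>x. - f x)"


section \<open>Dirichlet eigenfunctions\<close>

text \<open>Eigenfunctions of \<open>f \<mapsto> a (q f - \<Delta>f)\<close> with domain \<open>H\<^sup>2(U) \<inter> H\<^sup>1\<^sub>0(U)\<close>.
The instances of interest are: \<open>-\<Delta>\<close> on \<open>\<Omega>'\<close> (\<open>a = 1\<close>, \<open>q = 0\<close>); \<open>A\<^sub>k\<close> on \<open>(0,H)\<close>
(\<open>a = c\<close>, \<open>q = \<mu>\<^sub>k\<^sup>2\<close>); and \<open>A\<close> on \<open>\<Omega>' \<times> (0,H)\<close> (\<open>a(x',y) = c(y)\<close>, \<open>q = 0\<close>).
As \<open>a\<close> is bounded above and below by positive constants, the weight \<open>a\<^sup>-\<^sup>1\<close> does not change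
the underlying \<open>L\<^sup>2\<close> space as a set.\<close>

definition eigenfunction ::
  "('a::euclidean_space \<Rightarrow> real) \<Rightarrow> real \<Rightarrow> 'a set \<Rightarrow> real \<Rightarrow> ('a \<Rightarrow> real) \<Rightarrow> bool" where
  "eigenfunction a q U l f \<longleftrightarrow>
     f \<in> sobolev 2 U \<inter> sobolev_1_0 U \<and>
     \<not> (AE x\<in>U in lborel. f x = 0) \<and>
     (\<exists>h. weak_laplacian U f h \<and> (AE x\<in>U in lborel. a x * (q * f x - h x) = l * f x))"

definition eigenvalue ::
  "('a::euclidean_space \<Rightarrow> real) \<Rightarrow> real \<Rightarrow> 'a set \<Rightarrow> real \<Rightarrow> bool" where
  "eigenvalue a q U l \<longleftrightarrow> (\<exists>f. eigenfunction a q U l f)"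

text \<open>The sequence \<open>(\<mu>\<^sub>k\<^sup>2, \<phi>\<^sub>k)\<close>, \<open>k \<ge> 1\<close>, of eigenvalues and orthonormal eigenfunctions of the
Dirichlet Laplacian. The last conjunct says that every eigenvalue is listed with its full
multiplicity: the orthonormal \<open>\<phi>\<^sub>k\<close> belonging to it span the whole eigenspace.\<close>

definition dirichlet_eigenpairs ::
  "'a::euclidean_space set \<Rightarrow> (nat \<Rightarrow> real) \<Rightarrow> (nat \<Rightarrow> 'a \<Rightarrow> real) \<Rightarrow> bool" where
  "dirichlet_eigenpairs U \<mu> \<phi> \<longleftrightarrow>
     (\<forall>k\<ge>1. \<mu> k > 0 \<and> eigenfunction (\<lambda>_. 1) 0 U ((\<mu> k)\<^sup>2) (\<phi> k)) \<and>
     (\<forall>j\<ge>1. \<forall>k\<ge>j. \<mu> j \<le> \<mu> k) \<and>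
     (\<forall>j\<ge>1. \<forall>k\<ge>1. (LINT x:U|lborel. \<phi> j x * \<phi> k x) = (if j = k then 1 else 0)) \<and>
     (\<forall>l f. eigenfunction (\<lambda>_. 1) 0 U l f \<longrightarrow>
        finite {k. k \<ge> 1 \<and> (\<mu> k)\<^sup>2 = l} \<and>
        (\<exists>\<alpha>::nat \<Rightarrow> real. AE x\<in>U in lborel. f x = (\<Sum>k | k \<ge> 1 \<and> (\<mu> k)\<^sup>2 = l. \<alpha> k * \<phi> k x)))"

text \<open>Eigenfunctions of \<open>A\<^sub>k\<close> (with \<open>q = \<mu>\<^sub>k\<^sup>2\<close>) are evaluated pointwise on \<open>[0,H]\<close>, together with
their derivatives, so the representative in \<open>C\<^sup>1([0,H])\<close>, which exists by
\<open>H\<^sup>2(0,H) \<subseteq> C\<^sup>1([0,H])\<close>, has to be chosen.\<close>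

definition normalized_eigenfunction ::
  "real \<Rightarrow> (real \<Rightarrow> real) \<Rightarrow> real \<Rightarrow> real \<Rightarrow> (real \<Rightarrow> real) \<Rightarrow> bool" where
  "normalized_eigenfunction H c q l u \<longleftrightarrow>
     eigenfunction c q {0<..<H} l u \<and>
     (LINT y:{0<..<H}|lborel. (u y)\<^sup>2 / c y) = 1 \<and>
     (\<exists>u'. continuous_on {0..H} u' \<and>
        (\<forall>y\<in>{0..H}. (u has_vector_derivative u' y) (at y within {0..H})))"


section \<open>The minimal amplitude hypothesis and non-concentration\<close>

text \<open>The pair \<open>(\<mu>\<^sub>k, \<lambda>)\<close> is represented by \<open>(k, \<lambda>)\<close>, because the eigenfunction
\<open>\<phi>\<^sub>k u\<^bsub>\<lambda>,k\<^esub>\<close> attached to it depends on the index \<open>k\<close> when \<open>\<mu>\<^sub>k\<^sup>2\<close> is a multiple eigenvalue.\<close>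

definition spectral_set ::
  "real \<Rightarrow> (real \<Rightarrow> real) \<Rightarrow> (nat \<Rightarrow> real) \<Rightarrow> real \<Rightarrow> (nat \<times> real) set" where
  "spectral_set H c \<mu> \<epsilon> =
     {(k, l). k \<ge> 1 \<and> eigenvalue c ((\<mu> k)\<^sup>2) {0<..<H} l \<and>
              l \<ge> (ess_sup_on {0<..<H} c + \<epsilon>) * (\<mu> k)\<^sup>2}"

text \<open>At the end points of \<open>[0,H]\<close> the derivative is one-sided.\<close>

definition amplitude_sq :: "real \<Rightarrow> (real \<Rightarrow> real) \<Rightarrow> real \<Rightarrow> real" where
  "amplitude_sq H u y = (u y)\<^sup>2 + (vector_derivative u (at y within {0..H}))\<^sup>2"

definition min_amplitude ::
  "real \<Rightarrow> (real \<Rightarrow> real) \<Rightarrow> (nat \<Rightarrow> real) \<Rightarrow> (real \<Rightarrow> nat \<Rightarrow> real \<Rightarrow> real) \<Rightarrow> real \<Rightarrow> real" where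
  "min_amplitude H c \<mu> u \<epsilon> =
     sqrt (Inf {amplitude_sq H (u l k) y | y k l. y \<in> {0..H} \<and> (k, l) \<in> spectral_set H c \<mu> \<epsilon>})"

definition minimal_amplitude_hypothesis ::
  "real \<Rightarrow> (real \<Rightarrow> real) \<Rightarrow> (nat \<Rightarrow> real) \<Rightarrow> (real \<Rightarrow> nat \<Rightarrow> real \<Rightarrow> real) \<Rightarrow> real \<Rightarrow> bool" where
  "minimal_amplitude_hypothesis H c \<mu> u \<epsilon> \<longleftrightarrow> min_amplitude H c \<mu> u \<epsilon> > 0"

text \<open>The family \<open>\<phi>\<^sub>k\<close>, \<open>k \<ge> 1\<close>, does not concentrate in \<open>U - W\<close>.\<close>

definition non_concentrating ::
  "'a::euclidean_space set \<Rightarrow> 'a set \<Rightarrow> (nat \<Rightarrow> 'a \<Rightarrow> real) \<Rightarrow> bool" where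
  "non_concentrating U W \<phi> \<longleftrightarrow>
     \<not> (\<exists>r::nat \<Rightarrow> nat. strict_mono r \<and> (\<forall>j. r j \<ge> 1) \<and>
          (\<lambda>j. (L2_norm_on W (\<phi> (r j)))\<^sup>2 / (L2_norm_on U (\<phi> (r j)))\<^sup>2) \<longlonglongrightarrow> 0)"

definition separated_mode ::
  "(nat \<Rightarrow> 'a \<Rightarrow> real) \<Rightarrow> (real \<Rightarrow> nat \<Rightarrow> real \<Rightarrow> real) \<Rightarrow> nat \<Rightarrow> real \<Rightarrow> 'a \<times> real \<Rightarrow> real" where
  "separated_mode \<phi> u k l = (\<lambda>(x, y). \<phi> k x * u l k y)"

end

theory Submission
  imports Defs
begin

text \<open>
A mode is a product \<open>\<phi>\<^sub>k(x') u(y)\<close>, so the quotient of norms splits into a factor for \<open>\<phi>\<^sub>k\<close> and one for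
\<open>u\<close>, and each factor is bounded from below uniformly on the spectral set.

The factor of \<open>\<phi>\<^sub>k\<close> is the norm on \<open>\<omega>'\<close>. Non-concentration bounds it from below except for finitely many
\<open>k\<close>, and for those it suffices that it is not zero: a Dirichlet eigenfunction vanishing on an open set
vanishes identically (\<open>weak_helmholtz_unique_continuation\<close>). The proof of unique continuation works
with weak solutions. If \<open>f\<close> vanishes near \<open>q\<close>, its spherical means about \<open>q\<close> solve a second order ordinary
differential equation with zero initial data, hence vanish; by duality this is the solvability of
that equation for an arbitrary right-hand side (\<open>radial_equation_solvable\<close>). Since \<open>q\<close> may be moved a
little, derivatives with respect to \<open>q\<close> show that \<open>f\<close> times a radial weight is orthogonal to all
polynomials, and therefore \<open>f\<close> is zero (\<open>AE_zero_if_moments_zero\<close>).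

The factor of \<open>u\<close> is governed by \<open>u'' = - Q u\<close> with \<open>Q = \<lambda> / c - \<mu>\<^sub>k\<^sup>2\<close>. On the spectral set \<open>Q\<close> lies between
two fixed positive multiples of \<open>\<lambda>\<close>. For large \<open>\<lambda>\<close> every interval of length of order \<open>1 / sqrt \<lambda>\<close> contains
a zero of \<open>u'\<close> (\<open>sturm_critical_point\<close>), where the minimal amplitude hypothesis bounds \<open>u\<^sup>2\<close> from below, and
\<open>u\<close> stays of that size on a fixed proportion of the interval. For bounded \<open>\<lambda>\<close> the coefficient is
bounded and the amplitude at one point controls the mass on \<open>(a, b)\<close> directly. Both cases are joined
in \<open>sturm_mass_uniform\<close>.

The upper bound \<open>1\<close> holds for every single mode, so it remains to see that there are modes at all:
arbitrarily large eigenvalues of \<open>A\<^sub>k\<close> are found by shooting with the Pruefer angle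
(\<open>dirichlet_sturm_solution_exists\<close>). As \<open>c\<close> is merely bounded and measurable, solutions are Lipschitz
functions given by their densities; the chain rule for them, \<open>lip_primitive_chain\<close>, replaces
differentiation.
\<close>


section \<open>Functions with vanishing moments\<close>

lemma integrable_mult_continuous:
  fixes w f :: "'a::euclidean_space \<Rightarrow> real"
  assumes w: "integrable lborel w" and K: "compact K" "\<And>x. x \<notin> K \<Longrightarrow> w x = 0"
    and f: "continuous_on UNIV f"
  shows "integrable lborel (\<lambda>x. w x * f x)"
proof -
  have "compact (f ` K)"
    using compact_continuous_image continuous_on_subset[OF f] K by blast
  then obtain B where B: "\<forall>y\<in>f ` K. \<bar>y\<bar> \<le> B"
    using compact_imp_bounded bounded_real by metis
  show ?thesis
  proof (rule Bochner_Integration.integrable_bound)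
    show "integrable lborel (\<lambda>x. B * \<bar>w x\<bar>)" using w by auto
    show "(\<lambda>x. w x * f x) \<in> borel_measurable lborel"
      using w borel_measurable_continuous_onI[OF f] by measurable
    have "\<bar>w x * f x\<bar> \<le> \<bar>B * \<bar>w x\<bar>\<bar>" for x
    proof (cases "x \<in> K")
      case True
      then have "\<bar>f x\<bar> \<le> B" using B by auto
      then show ?thesis
        by (simp add: abs_mult) (metis abs_ge_zero abs_ge_self mult.commute mult_right_mono order_trans)
    qed (simp add: K)
    then show "AE x in lborel. norm (w x * f x) \<le> norm (B * \<bar>w x\<bar>)" by auto
  qed
qed

text \<open>The Weierstrass theorem passes from polynomials to continuous functions, dominated
convergence to indicators of closed sets, and the \<open>\<pi>\<close>-\<open>\<lambda>\<close> theorem to all Borel sets.\<close>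

lemma AE_zero_if_moments_zero:
  fixes w :: "'a::euclidean_space \<Rightarrow> real"
  assumes w: "integrable lborel w" and K: "compact K" "\<And>x. x \<notin> K \<Longrightarrow> w x = 0"
    and moments: "\<And>p. real_polynomial_function p \<Longrightarrow> (LINT x|lborel. w x * p x) = 0"
  shows "AE x in lborel. w x = 0"
proof -
  have cont: "(LINT x|lborel. w x * f x) = 0" if f: "continuous_on UNIV f" for f
  proof -
    define I where "I = (LINT x|lborel. \<bar>w x\<bar>)"
    have I0: "I \<ge> 0" unfolding I_def by simp
    have "\<bar>LINT x|lborel. w x * f x\<bar> \<le> e" if e: "e > 0" for e
    proof -
      have e': "e / (I + 1) > 0" using e I0 by simp
      obtain p where p: "real_polynomial_function p" "\<And>x. x \<in> K \<Longrightarrow> \<bar>f x - p x\<bar> < e / (I + 1)"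
        using Stone_Weierstrass_real_polynomial_function[OF K(1) continuous_on_subset[OF f] e'] by auto
      have cp: "continuous_on UNIV p"
        using p(1) continuous_real_polymonial_function continuous_at_imp_continuous_on by blast
      have ifp: "integrable lborel (\<lambda>x. w x * (f x - p x))"
        by (rule integrable_mult_continuous[OF w K]) (auto intro!: continuous_intros f cp)
      have "(LINT x|lborel. w x * f x) = (LINT x|lborel. w x * (f x - p x) + w x * p x)"
        by (simp add: algebra_simps)
      also have "\<dots> = (LINT x|lborel. w x * (f x - p x))"
        using moments[OF p(1)] ifp integrable_mult_continuous[OF w K cp] by simp
      also have "\<bar>\<dots>\<bar> \<le> (LINT x|lborel. \<bar>w x\<bar> * (e / (I + 1)))"
      proof (rule order_trans[OF integral_abs_bound], rule integral_mono)
        show "integrable lborel (\<lambda>x. \<bar>w x * (f x - p x)\<bar>)" using ifp by simp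
        show "integrable lborel (\<lambda>x. \<bar>w x\<bar> * (e / (I + 1)))" using w by simp
        fix x show "\<bar>w x * (f x - p x)\<bar> \<le> \<bar>w x\<bar> * (e / (I + 1))"
          using p(2)[of x] K(2)[of x] by (cases "x \<in> K") (auto simp: abs_mult simp del: times_divide_eq_right intro!: mult_left_mono)
      qed
      also have "\<dots> = I * (e / (I + 1))" unfolding I_def by simp
      also have "\<dots> \<le> e" using I0 e by (simp add: field_simps)
      finally show ?thesis .
    qed
    then show ?thesis by (meson abs_le_zero_iff dense_ge)
  qed
  have closed: "set_lebesgue_integral lborel A w = 0" if A: "closed A" for A
  proof (cases "A = {}")
    case False
    define f where "f n x = max 0 (1 - real n * infdist x A)" for n x
    have "(\<lambda>n. LINT x|lborel. w x * f n x) \<longlonglongrightarrow> (LINT x|lborel. w x * indicat_real A x)"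
    proof (rule integral_dominated_convergence)
      show "(\<lambda>x. w x * indicator A x) \<in> borel_measurable lborel" using w borel_closed[OF A] by measurable
      show "(\<lambda>x. w x * f i x) \<in> borel_measurable lborel" for i
      proof -
        have "continuous_on UNIV (f i)" unfolding f_def by (intro continuous_intros)
        then have [measurable]: "f i \<in> borel_measurable borel"
          by (rule borel_measurable_continuous_onI)
        show ?thesis using w by measurable
      qed
      show "integrable lborel (\<lambda>x. \<bar>w x\<bar>)" using w by simp
      have "(\<lambda>n. f n x) \<longlonglongrightarrow> indicat_real A x" for x
      proof (cases "x \<in> A")
        case True then show ?thesis by (simp add: f_def)
      next
        case False
        then have d: "infdist x A > 0" using A \<open>A \<noteq> {}\<close>
          by (metis in_closed_iff_infdist_zero infdist_nonneg less_eq_real_def)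
        obtain N where N: "1 / infdist x A < real N" using reals_Archimedean2 by blast
        have "f n x = 0" if "n \<ge> N" for n
        proof -
          have "1 / infdist x A < real n" using N that by linarith
          then show ?thesis using d by (simp add: f_def field_simps)
        qed
        then have "\<forall>\<^sub>F n in sequentially. f n x = 0" using eventually_sequentially by blast
        then show ?thesis using False by (simp add: tendsto_eventually)
      qed
      then show "AE x in lborel. (\<lambda>i. w x * f i x) \<longlonglongrightarrow> w x * indicat_real A x"
        by (intro AE_I2 tendsto_mult_left)
      show "AE x in lborel. norm (w x * f i x) \<le> \<bar>w x\<bar>" for i
        by (intro AE_I2) (auto simp: f_def abs_mult infdist_nonneg intro!: mult_left_le)
    qed
    moreover have "(LINT x|lborel. w x * f n x) = 0" for n
      by (rule cont) (auto simp: f_def intro!: continuous_intros)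
    ultimately show ?thesis
      by (simp add: set_lebesgue_integral_def LIMSEQ_const_iff mult.commute)
  qed (simp add: set_lebesgue_integral_def)
  have "set_lebesgue_integral lborel A w = 0" if "A \<in> sets lborel" for A
  proof -
    have iw: "set_integrable lborel B w" if "B \<in> sets borel" for B
      using w that integrable_mult_indicator[of B lborel w] by (simp add: set_integrable_def)
    have sb: "sets borel = sigma_sets UNIV (Collect (closed :: 'a set \<Rightarrow> bool))"
      by (simp add: borel_eq_closed)
    have "Int_stable (Collect (closed :: 'a set \<Rightarrow> bool))" by (auto simp: Int_stable_def)
    moreover have "Collect closed \<subseteq> Pow (UNIV :: 'a set)" by simp
    moreover have "A \<in> sigma_sets UNIV (Collect closed)" using that sb by simp
    ultimately show ?thesis
    proof (induction rule: sigma_sets_induct_disjoint)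
      case (basic A) then show ?case using closed by simp
    next
      case (compl A)
      have A: "A \<in> sets borel" using compl(1) sb by simp
      have "set_lebesgue_integral lborel (A \<union> (UNIV - A)) w
          = set_lebesgue_integral lborel A w + set_lebesgue_integral lborel (UNIV - A) w"
        by (rule set_integral_Un) (use A iw in auto)
      then show ?case using compl closed[of UNIV] by simp
    next
      case (union A)
      have A: "A i \<in> sets borel" for i using union(2) sb by auto
      have "set_lebesgue_integral lborel (\<Union>i. A i) w = (\<Sum>i. set_lebesgue_integral lborel (A i) w)"
        by (rule lebesgue_integral_countable_add)
          (use A union(1) iw in \<open>auto simp: disjoint_family_on_def\<close>)
      then show ?case using union by simp
    qed (auto simp: set_lebesgue_integral_def)
  qed
  then show ?thesis by (rule sigma_finite_measure.density_zero[OF sigma_finite_lborel w])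
qed


section \<open>A calculus of smooth functions\<close>

lemma has_derivative_cong_open:
  assumes "open U" "x \<in> U" "\<And>y. y \<in> U \<Longrightarrow> f y = g y"
  shows "(f has_derivative D) (at x) \<longleftrightarrow> (g has_derivative D) (at x)"
  using has_derivative_transform_within_open[of f D x UNIV U g]
    has_derivative_transform_within_open[of g D x UNIV U f] assms by auto

lemma frechet_derivative_cong_open:
  assumes "open U" "x \<in> U" "\<And>y. y \<in> U \<Longrightarrow> f y = g y"
  shows "frechet_derivative f (at x) = frechet_derivative g (at x)"
  by (simp add: frechet_derivative_def has_derivative_cong_open[OF assms])

lemma partial_eqI: "(f has_derivative D) (at x) \<Longrightarrow> partial b f x = D b"
  unfolding partial_def by (metis frechet_derivative_at)

lemma partial_real_eqI: "(f has_real_derivative d) (at x) \<Longrightarrow> partial 1 f x = d"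
  by (subst partial_eqI[of f "(*) d"]) (auto simp: has_field_derivative_def)

lemma Ck_on_cong:
  assumes "open U" "\<And>x. x \<in> U \<Longrightarrow> f x = g x"
  shows "Ck_on n U f \<longleftrightarrow> Ck_on n U g"
  using assms(2)
proof (induction n arbitrary: f g)
  case 0 then show ?case by (auto cong: continuous_on_cong)
next
  case (Suc n)
  have "Ck_on n U (partial b f) \<longleftrightarrow> Ck_on n U (partial b g)" for b
    by (rule Suc.IH) (simp add: partial_def frechet_derivative_cong_open[OF assms(1) _ Suc.prems])
  moreover have "f differentiable_on U \<longleftrightarrow> g differentiable_on U"
    using has_derivative_cong_open[OF assms(1) _ Suc.prems] assms(1)
    by (simp add: differentiable_on_eq_differentiable_at differentiable_def)
  ultimately show ?case by simp
qed

lemma Ck_onI: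
  assumes "open U" "\<And>x. x \<in> U \<Longrightarrow> (f has_derivative D x) (at x)"
    "\<And>b. b \<in> Basis \<Longrightarrow> Ck_on n U (\<lambda>x. D x b)"
  shows "Ck_on (Suc n) U f"
proof -
  have "f differentiable_on U"
    using assms(2) by (meson differentiableI differentiable_at_imp_differentiable_on)
  moreover have "Ck_on n U (partial b f)" if "b \<in> Basis" for b
    using assms(3)[OF that] Ck_on_cong[OF assms(1), of "partial b f" "\<lambda>x. D x b"] partial_eqI[OF assms(2)]
    by auto
  ultimately show ?thesis by simp
qed

lemma Ck_on_Suc_has_derivative:
  assumes "open U" "Ck_on (Suc n) U f" "x \<in> U"
  shows "(f has_derivative (\<lambda>h. frechet_derivative f (at x) h)) (at x)"
  using assms by (simp add: differentiable_on_eq_differentiable_at frechet_derivative_works[symmetric])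

lemma Ck_on_subset: "Ck_on n U f \<Longrightarrow> V \<subseteq> U \<Longrightarrow> Ck_on n V f"
  by (induction n arbitrary: f) (auto intro: continuous_on_subset differentiable_on_subset)

lemma Ck_on_Un:
  "open U \<Longrightarrow> open V \<Longrightarrow> Ck_on n U f \<Longrightarrow> Ck_on n V f \<Longrightarrow> Ck_on n (U \<union> V) f"
proof (induction n arbitrary: f)
  case (Suc n)
  have "f differentiable_on (U \<union> V)"
    using Suc.prems by (auto simp: differentiable_on_eq_differentiable_at open_Un)
  then show ?case using Suc by simp
qed (simp add: continuous_on_open_Un)

lemma Ck_on_SucD: "open U \<Longrightarrow> Ck_on (Suc n) U f \<Longrightarrow> Ck_on n U f"
  by (induction n arbitrary: f) (auto simp: differentiable_imp_continuous_on)

lemma Ck_on_const: "open U \<Longrightarrow> Ck_on n U (\<lambda>x. c)"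
proof (induction n arbitrary: c)
  case (Suc n)
  show ?case by (rule Ck_onI[where D = "\<lambda>_ _. 0"]) (use Suc in auto)
qed simp

lemma Ck_on_linear: "open U \<Longrightarrow> bounded_linear l \<Longrightarrow> Ck_on n U l"
proof (cases n)
  case (Suc n)
  assume "open U" "bounded_linear l"
  then show ?thesis unfolding Suc
    by (intro Ck_onI[where D = "\<lambda>_. l"] Ck_on_const bounded_linear_imp_has_derivative)
qed (simp add: linear_continuous_on)

lemma Ck_on_add:
  "open U \<Longrightarrow> Ck_on n U f \<Longrightarrow> Ck_on n U g \<Longrightarrow> Ck_on n U (\<lambda>x. f x + g x)"
proof (induction n arbitrary: f g)
  case (Suc n)
  show ?case
  proof (rule Ck_onI[OF Suc.prems(1)])
    fix x assume "x \<in> U"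
    then show "((\<lambda>x. f x + g x) has_derivative
        (\<lambda>h. frechet_derivative f (at x) h + frechet_derivative g (at x) h)) (at x)"
      using Suc.prems by (intro has_derivative_add Ck_on_Suc_has_derivative)
  qed (use Suc in \<open>auto simp: partial_def[symmetric]\<close>)
qed (auto intro: continuous_intros)

lemma Ck_on_mult:
  "open U \<Longrightarrow> Ck_on n U f \<Longrightarrow> Ck_on n U g \<Longrightarrow> Ck_on n U (\<lambda>x. f x * g x)"
proof (induction n arbitrary: f g)
  case (Suc n)
  show ?case
  proof (rule Ck_onI[OF Suc.prems(1)])
    fix x assume "x \<in> U"
    then show "((\<lambda>x. f x * g x) has_derivative
        (\<lambda>h. f x * frechet_derivative g (at x) h + frechet_derivative f (at x) h * g x)) (at x)"
      using Suc.prems by (intro has_derivative_mult Ck_on_Suc_has_derivative)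
  next
    fix b :: 'a assume "b \<in> Basis"
    moreover have "Ck_on n U f" "Ck_on n U g" using Suc.prems Ck_on_SucD by blast+
    ultimately show "Ck_on n U (\<lambda>x. f x * frechet_derivative g (at x) b + frechet_derivative f (at x) b * g x)"
      using Suc by (auto intro!: Ck_on_add simp: partial_def[symmetric])
  qed
qed (auto intro: continuous_intros)

lemma Ck_on_compose:
  fixes g :: "real \<Rightarrow> real"
  assumes "open U" "open V"
  shows "Ck_on n V g \<Longrightarrow> Ck_on n U s \<Longrightarrow> s ` U \<subseteq> V \<Longrightarrow> Ck_on n U (\<lambda>x. g (s x))"
proof (induction n arbitrary: g)
  case 0
  then show ?case by (auto intro: continuous_on_compose2)
next
  case (Suc n)
  show ?case
  proof (rule Ck_onI[OF assms(1)])
    fix x assume x: "x \<in> U"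
    have "(s has_derivative frechet_derivative s (at x)) (at x)"
      using Ck_on_Suc_has_derivative[OF assms(1) Suc.prems(2) x] .
    moreover have "(g has_derivative frechet_derivative g (at (s x))) (at (s x))"
      using Ck_on_Suc_has_derivative[OF assms(2) Suc.prems(1), of "s x"] Suc.prems(3) x by blast
    ultimately show "((\<lambda>x. g (s x)) has_derivative
        (\<lambda>h. frechet_derivative g (at (s x)) (frechet_derivative s (at x) h))) (at x)"
      by (rule has_derivative_compose)
  next
    fix b :: 'a assume b: "b \<in> Basis"
    have *: "Ck_on n U (\<lambda>x. partial 1 g (s x) * partial b s x)"
      using Suc.prems Suc.IH[of "partial 1 g"] b Ck_on_SucD[OF assms(1) Suc.prems(2)] assms(1)
      by (auto intro!: Ck_on_mult)
    have "partial 1 g (s x) * partial b s x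
        = frechet_derivative g (at (s x)) (frechet_derivative s (at x) b)" if "x \<in> U" for x
    proof -
      have "linear (frechet_derivative g (at (s x)))"
        using Ck_on_Suc_has_derivative[OF assms(2) Suc.prems(1)] Suc.prems(3) that
        by (meson has_derivative_linear image_subset_iff)
      then show ?thesis
        unfolding partial_def
        by (metis linear_scale mult.commute mult.right_neutral real_scaleR_def)
    qed
    then show "Ck_on n U (\<lambda>x. frechet_derivative g (at (s x)) (frechet_derivative s (at x) b))"
      using * by (simp add: Ck_on_cong[OF assms(1), of "\<lambda>x. partial 1 g (s x) * partial b s x"
          "\<lambda>x. frechet_derivative g (at (s x)) (frechet_derivative s (at x) b)"])
  qed
qed

lemma smooth_on_cong: "open U \<Longrightarrow> (\<And>x. x \<in> U \<Longrightarrow> f x = g x) \<Longrightarrow> smooth_on U f \<longleftrightarrow> smooth_on U g"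
  using Ck_on_cong[of U f g] unfolding smooth_on_def by blast

lemma smooth_on_Un: "open U \<Longrightarrow> open V \<Longrightarrow> smooth_on U f \<Longrightarrow> smooth_on V f \<Longrightarrow> smooth_on (U \<union> V) f"
  unfolding smooth_on_def using Ck_on_Un by blast

lemma smooth_on_subset: "smooth_on U f \<Longrightarrow> V \<subseteq> U \<Longrightarrow> smooth_on V f"
  unfolding smooth_on_def using Ck_on_subset by blast

lemma smooth_on_compose:
  fixes g :: "real \<Rightarrow> real"
  shows "open U \<Longrightarrow> open V \<Longrightarrow> smooth_on V g \<Longrightarrow> smooth_on U s \<Longrightarrow> s ` U \<subseteq> V \<Longrightarrow> smooth_on U (\<lambda>x. g (s x))"
  unfolding smooth_on_def using Ck_on_compose by blast

lemma smooth_on_simps: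
  "open U \<Longrightarrow> smooth_on U (\<lambda>x. c)"
  "open U \<Longrightarrow> bounded_linear l \<Longrightarrow> smooth_on U l"
  "open U \<Longrightarrow> smooth_on U f \<Longrightarrow> smooth_on U g \<Longrightarrow> smooth_on U (\<lambda>x. f x + g x)"
  "open U \<Longrightarrow> smooth_on U f \<Longrightarrow> smooth_on U g \<Longrightarrow> smooth_on U (\<lambda>x. f x * g x)"
  by (auto simp: smooth_on_def Ck_on_const Ck_on_linear Ck_on_add Ck_on_mult)

lemma smooth_on_diff:
  assumes "open U" "smooth_on U f" "smooth_on U g" shows "smooth_on U (\<lambda>x. f x - g x)"
  using smooth_on_simps(3)[OF assms(1,2) smooth_on_simps(4)[OF assms(1) smooth_on_simps(1)[OF assms(1), of "-1"] assms(3)]]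
  by simp

lemma smooth_on_sum:
  "open U \<Longrightarrow> finite A \<Longrightarrow> (\<And>i. i \<in> A \<Longrightarrow> smooth_on U (f i)) \<Longrightarrow> smooth_on U (\<lambda>x. \<Sum>i\<in>A. f i x)"
  by (rotate_tac, induction A rule: finite_induct) (auto intro: smooth_on_simps)

lemma smooth_on_polynomial: "open U \<Longrightarrow> real_polynomial_function p \<Longrightarrow> smooth_on U p"
  by (rotate_tac, induction rule: real_polynomial_function.induct) (auto intro: smooth_on_simps)

lemma smooth_on_partial: "smooth_on U f \<Longrightarrow> b \<in> Basis \<Longrightarrow> smooth_on U (partial b f)"
  unfolding smooth_on_def by (metis Ck_on.simps(2))

lemma smooth_on_has_derivative:
  "open U \<Longrightarrow> smooth_on U f \<Longrightarrow> x \<in> U \<Longrightarrow> (f has_derivative (\<lambda>h. frechet_derivative f (at x) h)) (at x)"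
  unfolding smooth_on_def using Ck_on_Suc_has_derivative by blast

lemma smooth_on_has_real_derivative:
  fixes f :: "real \<Rightarrow> real"
  assumes "open U" "smooth_on U f" "x \<in> U"
  shows "(f has_real_derivative partial 1 f x) (at x)"
proof -
  have "f differentiable (at x)" using smooth_on_has_derivative[OF assms] by (auto simp: differentiable_def)
  then obtain d where d: "(f has_real_derivative d) (at x)" using real_differentiable_def by blast
  with partial_real_eqI[OF this] show ?thesis by simp
qed

lemma smooth_on_continuous: "smooth_on U f \<Longrightarrow> continuous_on U f"
  unfolding smooth_on_def by (metis Ck_on.simps(1))

lemma smooth_on_UNIV_continuous: "smooth_on UNIV f \<Longrightarrow> continuous_on A f"
  using smooth_on_continuous continuous_on_subset by blast

lemma smooth_on_real_derivatives:
  fixes G :: "nat \<Rightarrow> real \<Rightarrow> real"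
  assumes "open U" "\<And>n x. x \<in> U \<Longrightarrow> (G n has_real_derivative G (Suc n) x) (at x)"
  shows "smooth_on U (G n)"
proof -
  have "Ck_on k U (G n)" for k
  proof (induction k arbitrary: n)
    case 0
    then show ?case using assms(2)
      by (auto intro!: continuous_at_imp_continuous_on DERIV_isCont)
  next
    case (Suc k)
    then show ?case using assms
      by (intro Ck_onI[where D = "\<lambda>x. (*) (G (Suc n) x)"]) (auto simp: has_field_derivative_def)
  qed
  then show ?thesis by (simp add: smooth_on_def)
qed

lemma smooth_on_antiderivative:
  fixes F f :: "real \<Rightarrow> real"
  assumes "open U" "\<And>x. x \<in> U \<Longrightarrow> (F has_real_derivative f x) (at x)" "smooth_on U f"
  shows "smooth_on U F"
  unfolding smooth_on_def
proof
  fix n show "Ck_on n U F"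
  proof (rule Ck_on_SucD[OF assms(1)], rule Ck_onI[OF assms(1), where D = "\<lambda>x. (*) (f x)"])
    show "(F has_derivative (*) (f x)) (at x)" if "x \<in> U" for x
      using assms(2)[OF that] by (simp add: has_field_derivative_def)
    show "Ck_on n U (\<lambda>x. f x * b)" if "b \<in> Basis" for b
      using that assms(3) by (simp add: smooth_on_def)
  qed
qed

lemma smooth_on_inverse: "smooth_on {0<..} (inverse :: real \<Rightarrow> real)"
proof -
  define G :: "nat \<Rightarrow> real \<Rightarrow> real" where "G n x = (-1)^n * fact n * inverse x ^ Suc n" for n x
  have "smooth_on {0<..} (G 0)"
  proof (rule smooth_on_real_derivatives)
    fix n and x :: real assume "x \<in> {0<..}"
    then have x: "x \<noteq> 0" by simp
    have "((\<lambda>x. inverse x ^ Suc n) has_real_derivative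
        real (Suc n) * (- (inverse x ^ Suc (Suc 0)) * inverse x ^ (Suc n - Suc 0))) (at x)"
      by (rule DERIV_power) (rule DERIV_inverse[OF x])
    from DERIV_cmult[OF this, of "(-1)^n * fact n"] show "(G n has_real_derivative G (Suc n) x) (at x)"
      by (simp add: G_def[abs_def] algebra_simps)
  qed simp
  moreover have "G 0 = inverse" by (auto simp: G_def)
  ultimately show ?thesis by simp
qed

text \<open>On the positive axis every derivative of \<open>exp (-1/x)\<close> is a polynomial in \<open>1/x\<close> times the
function itself; hence all of them extend by zero.\<close>

definition flat_exp :: "real poly \<Rightarrow> real \<Rightarrow> real" where
  "flat_exp p x = (if x > 0 then poly p (1 / x) * exp (- (1 / x)) else 0)"

lemma flat_exp_tendsto_0: "((\<lambda>x::real. poly p (1 / x) * exp (- (1 / x))) \<longlongrightarrow> 0) (at_right 0)"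
proof -
  have "((\<lambda>y::real. poly p y / exp y) \<longlongrightarrow> 0) at_top"
  proof (induction p)
    case (pCons a p)
    have "((\<lambda>y::real. \<Sum>i\<le>degree (pCons a p). coeff (pCons a p) i * (y ^ i / exp y))
        \<longlongrightarrow> (\<Sum>i\<le>degree (pCons a p). coeff (pCons a p) i * 0)) at_top"
      by (intro tendsto_sum tendsto_mult_left tendsto_power_div_exp_0)
    then show ?case by (simp add: poly_altdef sum_divide_distrib del: coeff_pCons degree_pCons_eq_if)
  qed simp
  then have "((\<lambda>x::real. poly p (inverse x) / exp (inverse x)) \<longlongrightarrow> 0) (at_right 0)"
    by (rule filterlim_compose[OF _ filterlim_inverse_at_top_right])
  then show ?thesis by (simp add: exp_minus field_simps)
qed

lemma flat_exp_deriv: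
  "(flat_exp p has_real_derivative flat_exp ([:0,0,1:] * (p - pderiv p)) x) (at x)"
proof (cases "x = 0")
  case True
  have "((\<lambda>x. flat_exp p x / x) \<longlongrightarrow> 0) (at_right 0)"
  proof (rule Lim_transform_eventually[OF flat_exp_tendsto_0[of "[:0,1:] * p"]])
    show "\<forall>\<^sub>F x in at_right 0. poly ([:0, 1:] * p) (1 / x) * exp (- (1 / x)) = flat_exp p x / x"
      by (auto simp: eventually_at_right_field flat_exp_def intro: exI[of _ 1])
  qed
  moreover have "((\<lambda>x. flat_exp p x / x) \<longlongrightarrow> 0) (at_left 0)"
    by (rule tendsto_eventually) (auto simp: eventually_at_left_field flat_exp_def intro: exI[of _ "-1"])
  ultimately have "((\<lambda>x. flat_exp p x / x) \<longlongrightarrow> 0) (at 0)" by (simp add: filterlim_at_split)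
  then show ?thesis using True
    by (simp add: has_field_derivative_iff flat_exp_def)
next
  case False
  show ?thesis
  proof (cases "x > 0")
    case True
    have "((\<lambda>x. poly p (1 / x) * exp (- (1 / x))) has_real_derivative
        flat_exp ([:0,0,1:] * (p - pderiv p)) x) (at x)"
      using True
      by (auto intro!: derivative_eq_intros simp: flat_exp_def field_simps power2_eq_square)
    then show ?thesis
      by (rule has_field_derivative_transform_within_open[where S = "{0<..}"])
        (use True in \<open>auto simp: flat_exp_def\<close>)
  next
    case F: False
    have "((\<lambda>x. 0) has_real_derivative flat_exp ([:0,0,1:] * (p - pderiv p)) x) (at x)"
      using F by (auto simp: flat_exp_def)
    then show ?thesis
      by (rule has_field_derivative_transform_within_open[where S = "{..<0}"])
        (use F False in \<open>auto simp: flat_exp_def\<close>)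
  qed
qed

lemma smooth_flat_exp: "smooth_on UNIV (flat_exp p)"
proof -
  have "smooth_on UNIV (flat_exp (((\<lambda>p. [:0,0,1:] * (p - pderiv p)) ^^ 0) p))"
    by (rule smooth_on_real_derivatives) (auto simp: flat_exp_deriv simp del: mult_pCons_left)
  then show ?thesis by simp
qed

definition half_bump :: "real \<Rightarrow> real" where
  "half_bump x = flat_exp 1 x"

lemma half_bump: "smooth_on UNIV half_bump" "x > 0 \<Longrightarrow> half_bump x > 0" "x \<le> 0 \<Longrightarrow> half_bump x = 0"
  using smooth_flat_exp[of 1] by (simp_all add: half_bump_def[abs_def]) (simp_all add: flat_exp_def)

lemma smooth_on_affine: "smooth_on UNIV (\<lambda>x::real. \<alpha> * x + \<beta>)"
  by (intro smooth_on_simps) (auto intro: bounded_linear_mult_right)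

lemma smooth_half_bump_affine: "smooth_on UNIV (\<lambda>x. half_bump (\<alpha> * x + \<beta>))"
  by (rule smooth_on_compose[OF _ _ half_bump(1) smooth_on_affine]) auto

lemma obtain_bump:
  obtains \<rho> :: "real \<Rightarrow> real" where "smooth_on UNIV \<rho>" "\<And>x. \<alpha> < x \<Longrightarrow> x < \<beta> \<Longrightarrow> \<rho> x > 0"
    "\<And>x. x \<le> \<alpha> \<or> \<beta> \<le> x \<Longrightarrow> \<rho> x = 0" "\<And>x. \<rho> x \<ge> 0"
proof
  define \<rho> where "\<rho> x = half_bump (1 * x + (- \<alpha>)) * half_bump ((-1) * x + \<beta>)" for x
  show "smooth_on UNIV \<rho>"
    unfolding \<rho>_def by (intro smooth_on_simps smooth_half_bump_affine) auto
  show 1: "\<rho> x > 0" if "\<alpha> < x" "x < \<beta>" for x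
    using that unfolding \<rho>_def by (auto intro!: mult_pos_pos half_bump)
  show 2: "\<rho> x = 0" if "x \<le> \<alpha> \<or> \<beta> \<le> x" for x
    using that unfolding \<rho>_def by (auto simp: half_bump)
  show "\<rho> x \<ge> 0" for x using 1[of x] 2[of x] by linarith
qed

lemma obtain_cutoff:
  fixes \<alpha> \<beta> :: real assumes "\<alpha> < \<beta>"
  obtains \<kappa> :: "real \<Rightarrow> real" where "smooth_on UNIV \<kappa>" "\<And>x. x \<le> \<alpha> \<Longrightarrow> \<kappa> x = 0" "\<And>x. x \<ge> \<beta> \<Longrightarrow> \<kappa> x = 1"
    "\<And>x. 0 \<le> \<kappa> x" "\<And>x. \<kappa> x \<le> 1"
proof
  define A where "A x = half_bump (1 * x + (- \<alpha>))" for x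
  define B where "B x = half_bump ((-1) * x + \<beta>)" for x
  define \<kappa> where "\<kappa> x = A x * inverse (A x + B x)" for x
  have nn: "half_bump x \<ge> 0" for x using half_bump(2,3)[of x] by linarith
  have nnAB: "A x \<ge> 0" "B x \<ge> 0" for x unfolding A_def B_def using nn by auto
  have pos: "A x + B x > 0" for x
  proof (cases "x > \<alpha>")
    case True
    then have "A x > 0" unfolding A_def by (intro half_bump) auto
    then show ?thesis using nnAB(2)[of x] by simp
  next
    case False
    then have "B x > 0" unfolding B_def using assms by (intro half_bump) auto
    then show ?thesis using nnAB(1)[of x] by simp
  qed
  have sA: "smooth_on UNIV A" unfolding A_def[abs_def] by (rule smooth_half_bump_affine)
  have sB: "smooth_on UNIV B" unfolding B_def[abs_def] by (rule smooth_half_bump_affine)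
  show "smooth_on UNIV \<kappa>"
    unfolding \<kappa>_def
    by (intro smooth_on_simps sA smooth_on_compose[OF _ _ smooth_on_inverse] sB) (use pos in auto)
  show "\<kappa> x = 0" if "x \<le> \<alpha>" for x
    using that by (simp add: \<kappa>_def A_def half_bump)
  show "\<kappa> x = 1" if "x \<ge> \<beta>" for x
  proof -
    have "B x = 0" unfolding B_def using that by (intro half_bump) auto
    then show ?thesis using pos[of x] by (simp add: \<kappa>_def)
  qed
  show "0 \<le> \<kappa> x" "\<kappa> x \<le> 1" for x
    using pos[of x] nnAB[of x] by (auto simp: \<kappa>_def field_simps)
qed

lemma test_funI:
  assumes "smooth_on UNIV \<psi>" "compact K" "\<And>x. x \<notin> K \<Longrightarrow> \<psi> x = 0" "K \<subseteq> U"
  shows "test_fun U \<psi>"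
proof -
  have "closure {x. \<psi> x \<noteq> 0} \<subseteq> K"
    using assms(2,3) by (intro closure_minimal) (auto simp: compact_imp_closed)
  then show ?thesis
    using assms compact_Int_closed[OF assms(2) closed_closure, of "{x. \<psi> x \<noteq> 0}"]
    unfolding test_fun_def by (auto simp: inf.absorb2)
qed

lemma test_fun_partial:
  assumes "test_fun U \<psi>" "b \<in> Basis" shows "test_fun U (partial b \<psi>)"
proof (rule test_funI[where K = "closure {x. \<psi> x \<noteq> 0}"])
  show "partial b \<psi> x = 0" if "x \<notin> closure {x. \<psi> x \<noteq> 0}" for x
  proof -
    have "frechet_derivative \<psi> (at x) = frechet_derivative (\<lambda>_. 0) (at x)"
      by (rule frechet_derivative_cong_open[where U = "- closure {x. \<psi> x \<noteq> 0}"])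
        (use that closure_subset[of "{x. \<psi> x \<noteq> 0}"] in \<open>auto simp: open_Compl\<close>)
    then show ?thesis by (simp add: partial_def)
  qed
qed (use assms in \<open>auto simp: test_fun_def intro: smooth_on_partial\<close>)

section \<open>Primitives of bounded measurable functions\<close>

lemma continuous_on_Icc_bounded:
  fixes f :: "real \<Rightarrow> real"
  assumes "continuous_on {\<alpha>..\<beta>} f"
  obtains B where "\<And>t. t \<in> {\<alpha>..\<beta>} \<Longrightarrow> \<bar>f t\<bar> \<le> B"
  using compact_imp_bounded[OF compact_continuous_image[OF assms compact_Icc]] unfolding bounded_iff
  by (metis imageI real_norm_def)

lemma second_order_bound:
  fixes G G' G'' :: "real \<Rightarrow> real"
  assumes G: "\<And>x. (G has_real_derivative G' x) (at x)" and G': "\<And>x. (G' has_real_derivative G'' x) (at x)"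
    and K: "\<And>x. x \<in> S \<Longrightarrow> \<bar>G'' x\<bar> \<le> K" and S: "convex S" "x \<in> S" "y \<in> S"
  shows "\<bar>G x - G y - G' y * (x - y)\<bar> \<le> K * (x - y)\<^sup>2"
proof -
  have K0: "K \<ge> 0" using K[OF S(2)] by linarith
  have seg: "closed_segment x y \<subseteq> S" using S by (simp add: closed_segment_subset)
  have 1: "\<bar>G' z - G' y\<bar> \<le> K * \<bar>x - y\<bar>" if z: "z \<in> closed_segment x y" for z
  proof -
    have "norm (G' z - G' y) \<le> K * norm (z - y)"
      by (rule field_differentiable_bound[OF S(1), of G' G''])
        (use K S seg z in \<open>auto intro: DERIV_subset[OF G']\<close>)
    also have "\<dots> \<le> K * \<bar>x - y\<bar>"
      using z K0 by (auto simp: closed_segment_eq_real_ivl split: if_splits intro!: mult_left_mono)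
    finally show ?thesis by simp
  qed
  have "norm ((G x - G' y * x) - (G y - G' y * y)) \<le> (K * \<bar>x - y\<bar>) * norm (x - y)"
    by (rule field_differentiable_bound[where S = "closed_segment x y" and f' = "\<lambda>z. G' z - G' y"])
      (use 1 in \<open>auto intro!: derivative_eq_intros DERIV_subset[OF G]\<close>)
  then show ?thesis by (simp add: algebra_simps power2_eq_square abs_mult_self_eq)
qed

lemma constant_if_quadratic_increments:
  fixes D :: "real \<Rightarrow> real"
  assumes D: "\<And>s t. \<alpha> \<le> s \<Longrightarrow> s \<le> t \<Longrightarrow> t \<le> \<beta> \<Longrightarrow> \<bar>D t - D s\<bar> \<le> C * (t - s)\<^sup>2"
    and st: "\<alpha> \<le> s" "s \<le> \<beta>" "\<alpha> \<le> t" "t \<le> \<beta>"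
  shows "D s = D t"
proof -
  have bd: "\<bar>D y - D x\<bar> \<le> C * (y - x)\<^sup>2" if "x \<in> {\<alpha>..\<beta>}" "y \<in> {\<alpha>..\<beta>}" for x y
    using D[of x y] D[of y x] that by (cases "x \<le> y") (auto simp: power2_commute abs_minus_commute)
  have "(D has_field_derivative 0) (at x within {\<alpha>..\<beta>})" if x: "x \<in> {\<alpha>..\<beta>}" for x
    unfolding has_field_derivative_iff
  proof (rule Lim_null_comparison)
    show "\<forall>\<^sub>F y in at x within {\<alpha>..\<beta>}. norm ((D y - D x) / (y - x)) \<le> C * \<bar>y - x\<bar>"
      unfolding eventually_at_filter
    proof (rule always_eventually, intro allI impI)
      fix y assume "y \<noteq> x" "y \<in> {\<alpha>..\<beta>}"
      then show "norm ((D y - D x) / (y - x)) \<le> C * \<bar>y - x\<bar>"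
        using bd[OF x, of y] by (simp add: divide_le_eq power2_eq_square abs_mult_self_eq mult.assoc)
    qed
    have "((\<lambda>y. C * \<bar>y - x\<bar>) \<longlongrightarrow> C * \<bar>x - x\<bar>) (at x within {\<alpha>..\<beta>})"
      by (intro tendsto_intros)
    then show "((\<lambda>y. C * \<bar>y - x\<bar>) \<longlongrightarrow> 0) (at x within {\<alpha>..\<beta>})" by simp
  qed
  then obtain c where "\<forall>x\<in>{\<alpha>..\<beta>}. D x = c"
    using has_field_derivative_zero_constant[of "{\<alpha>..\<beta>}" D] by auto
  then show ?thesis using st by auto
qed

text \<open>These functions play the role of classical \<open>C\<^sup>1\<close> functions for equations whose coefficient is
only bounded and measurable. The density is tied to \<open>F\<close> through increments because \<open>F\<close> need not be
differentiable at a given point.\<close>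

definition lip_primitive :: "real \<Rightarrow> real \<Rightarrow> (real \<Rightarrow> real) \<Rightarrow> (real \<Rightarrow> real) \<Rightarrow> bool" where
  "lip_primitive \<alpha> \<beta> F p \<longleftrightarrow> p absolutely_integrable_on {\<alpha>..\<beta>} \<and> bounded (p ` {\<alpha>..\<beta>}) \<and>
     (\<forall>s t. \<alpha> \<le> s \<longrightarrow> s \<le> t \<longrightarrow> t \<le> \<beta> \<longrightarrow> (p has_integral F t - F s) {s..t})"

lemma lip_primitiveD:
  "lip_primitive \<alpha> \<beta> F p \<Longrightarrow> \<alpha> \<le> s \<Longrightarrow> s \<le> t \<Longrightarrow> t \<le> \<beta> \<Longrightarrow> (p has_integral F t - F s) {s..t}"
  by (simp add: lip_primitive_def)

lemma lip_primitive_lipschitz: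
  assumes "lip_primitive \<alpha> \<beta> F p"
  obtains M where "M \<ge> 0" "\<And>t. t \<in> {\<alpha>..\<beta>} \<Longrightarrow> \<bar>p t\<bar> \<le> M"
    "\<And>s t. s \<in> {\<alpha>..\<beta>} \<Longrightarrow> t \<in> {\<alpha>..\<beta>} \<Longrightarrow> \<bar>F t - F s\<bar> \<le> M * \<bar>t - s\<bar>"
proof -
  obtain M where M: "M > 0" "\<And>t. t \<in> {\<alpha>..\<beta>} \<Longrightarrow> \<bar>p t\<bar> \<le> M"
    using assms unfolding lip_primitive_def bounded_pos by auto
  have *: "\<bar>F t - F s\<bar> \<le> M * \<bar>t - s\<bar>" if "\<alpha> \<le> s" "s \<le> t" "t \<le> \<beta>" for s t
    using has_integral_bound_real[of M "{}" p "F t - F s" s t] lip_primitiveD[OF assms that] M that by auto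
  show ?thesis
  proof (rule that)
    fix s t assume "s \<in> {\<alpha>..\<beta>}" "t \<in> {\<alpha>..\<beta>}"
    then show "\<bar>F t - F s\<bar> \<le> M * \<bar>t - s\<bar>"
      using *[of s t] *[of t s] by (cases "s \<le> t") (auto simp: abs_minus_commute)
  qed (use M in auto)
qed

lemma lip_primitive_continuous:
  assumes "lip_primitive \<alpha> \<beta> F p" shows "continuous_on {\<alpha>..\<beta>} F"
proof -
  obtain M where M: "M \<ge> 0" "\<And>s t. s \<in> {\<alpha>..\<beta>} \<Longrightarrow> t \<in> {\<alpha>..\<beta>} \<Longrightarrow> \<bar>F t - F s\<bar> \<le> M * \<bar>t - s\<bar>"
    using lip_primitive_lipschitz[OF assms] by metis
  have "M-lipschitz_on {\<alpha>..\<beta>} F"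
    by (rule lipschitz_onI) (use M in \<open>auto simp: dist_real_def\<close>)
  then show ?thesis by (rule lipschitz_on_continuous_on)
qed

lemma absolutely_integrable_continuous_mult:
  fixes g p :: "real \<Rightarrow> real"
  assumes "continuous_on {\<alpha>..\<beta>} g" "p absolutely_integrable_on {\<alpha>..\<beta>}"
  shows "(\<lambda>t. g t * p t) absolutely_integrable_on {\<alpha>..\<beta>}"
  by (rule absolutely_integrable_bounded_measurable_product_real)
    (use assms in \<open>auto intro: continuous_imp_measurable_on_sets_lebesgue compact_imp_bounded
       compact_continuous_image\<close>)

lemma lip_primitive_integral:
  assumes "p absolutely_integrable_on {\<alpha>..\<beta>}" "bounded (p ` {\<alpha>..\<beta>})"
    and F: "\<And>t. t \<in> {\<alpha>..\<beta>} \<Longrightarrow> F t = c + integral {\<alpha>..t} p"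
  shows "lip_primitive \<alpha> \<beta> F p"
  unfolding lip_primitive_def
proof (intro conjI allI impI assms)
  fix s t assume st: "\<alpha> \<le> s" "s \<le> t" "t \<le> \<beta>"
  have p: "p integrable_on {\<alpha>..\<beta>}" using assms(1) set_lebesgue_integral_eq_integral by blast
  have "integral {\<alpha>..s} p + integral {s..t} p = integral {\<alpha>..t} p"
    by (rule Henstock_Kurzweil_Integration.integral_combine)
      (use st in \<open>auto intro: integrable_subinterval_real[OF p]\<close>)
  moreover have "(p has_integral integral {s..t} p) {s..t}"
    by (rule integrable_integral) (use st in \<open>auto intro: integrable_subinterval_real[OF p]\<close>)
  ultimately show "(p has_integral F t - F s) {s..t}"
    using st F[of s] F[of t] by (simp add: add_diff_eq[symmetric] eq_diff_eq[symmetric] add.commute)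
qed

text \<open>Both sides change by \<open>G' (F s) * (F t - F s)\<close> on \<open>[s, t]\<close> up to an error of order
\<open>(t - s)\<^sup>2\<close>; this needs no differentiability of \<open>F\<close> at individual points.\<close>

lemma lip_primitive_chain:
  assumes F: "lip_primitive \<alpha> \<beta> F p"
    and G: "\<And>x. (G has_real_derivative G' x) (at x)" and G': "\<And>x. (G' has_real_derivative G'' x) (at x)"
    and G'': "continuous_on UNIV G''"
  shows "lip_primitive \<alpha> \<beta> (\<lambda>t. G (F t)) (\<lambda>t. G' (F t) * p t)"
proof (cases "\<alpha> \<le> \<beta>")
  case ab: True
  obtain M where M: "M \<ge> 0" "\<And>t. t \<in> {\<alpha>..\<beta>} \<Longrightarrow> \<bar>p t\<bar> \<le> M"
    "\<And>s t. s \<in> {\<alpha>..\<beta>} \<Longrightarrow> t \<in> {\<alpha>..\<beta>} \<Longrightarrow> \<bar>F t - F s\<bar> \<le> M * \<bar>t - s\<bar>"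
    using lip_primitive_lipschitz[OF F] by metis
  have cF: "continuous_on {\<alpha>..\<beta>} F" using F by (rule lip_primitive_continuous)
  have cG': "continuous_on UNIV G'" by (meson G' DERIV_isCont continuous_at_imp_continuous_on)
  have cGF: "continuous_on {\<alpha>..\<beta>} (\<lambda>t. G' (F t))"
    by (rule continuous_on_compose2[OF cG' cF]) auto
  have pint: "p absolutely_integrable_on {\<alpha>..\<beta>}" using F by (simp add: lip_primitive_def)
  define q where "q t = G' (F t) * p t" for t
  have q: "q absolutely_integrable_on {\<alpha>..\<beta>}"
    unfolding q_def[abs_def] using absolutely_integrable_continuous_mult[OF cGF pint] .
  obtain B where B: "\<And>t. t \<in> {\<alpha>..\<beta>} \<Longrightarrow> \<bar>F t\<bar> \<le> B"
    by (rule continuous_on_Icc_bounded[OF cF]) blast+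
  obtain K where K: "\<And>x. x \<in> {-B..B} \<Longrightarrow> \<bar>G'' x\<bar> \<le> K"
    by (rule continuous_on_Icc_bounded[OF continuous_on_subset[OF G'' subset_UNIV]]) blast+
  have FB: "F t \<in> {-B..B}" if "t \<in> {\<alpha>..\<beta>}" for t using B[OF that] by auto
  have K0: "K \<ge> 0" using K[OF FB[of \<alpha>]] ab by auto
  have bq: "bounded (q ` {\<alpha>..\<beta>})"
  proof -
    obtain B' where B': "\<And>t. t \<in> {\<alpha>..\<beta>} \<Longrightarrow> \<bar>G' (F t)\<bar> \<le> B'"
      by (rule continuous_on_Icc_bounded[OF cGF]) blast+
    have "\<bar>q t\<bar> \<le> \<bar>B'\<bar> * M" if "t \<in> {\<alpha>..\<beta>}" for t
      unfolding q_def abs_mult using B'[OF that] M(2)[OF that] by (intro mult_mono) auto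
    then show ?thesis unfolding bounded_iff by (auto intro!: exI[of _ "\<bar>B'\<bar> * M"])
  qed
  define D where "D t = G (F t) - integral {\<alpha>..t} q" for t
  have lq: "lip_primitive \<alpha> \<beta> (\<lambda>t. integral {\<alpha>..t} q) q"
    by (rule lip_primitive_integral[where c = 0]) (use q bq in auto)
  have lip': "\<bar>G' (F y) - G' (F x)\<bar> \<le> K * M * \<bar>y - x\<bar>" if "x \<in> {\<alpha>..\<beta>}" "y \<in> {\<alpha>..\<beta>}" for x y
  proof -
    have "norm (G' (F y) - G' (F x)) \<le> K * norm (F y - F x)"
      by (rule field_differentiable_bound[where S = "{-B..B}" and f' = G''])
        (use K FB that in \<open>auto intro: DERIV_subset[OF G']\<close>)
    also have "\<dots> \<le> K * (M * \<bar>y - x\<bar>)" using M(3)[OF that] K0 by (auto intro!: mult_left_mono)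
    finally show ?thesis by (simp add: mult.assoc)
  qed
  have D_const: "D s = D t" if "s \<in> {\<alpha>..\<beta>}" "t \<in> {\<alpha>..\<beta>}" for s t
  proof (rule constant_if_quadratic_increments[where D = D and \<alpha> = \<alpha> and \<beta> = \<beta> and C = "2 * (K * M\<^sup>2)"])
    fix s t assume st: "\<alpha> \<le> s" "s \<le> t" "t \<le> \<beta>"
    then have st': "s \<in> {\<alpha>..\<beta>}" "t \<in> {\<alpha>..\<beta>}" by auto
    have "\<bar>G (F t) - G (F s) - G' (F s) * (F t - F s)\<bar> \<le> K * (F t - F s)\<^sup>2"
      by (rule second_order_bound[where S = "{-B..B}", OF G G']) (use K FB st' in auto)
    also have "\<dots> \<le> K * (M * (t - s))\<^sup>2"
      using M(1) M(3)[OF st'] K0 st by (intro mult_left_mono) (auto simp: abs_le_square_iff[symmetric] abs_mult)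
    finally have 1: "\<bar>G (F t) - G (F s) - G' (F s) * (F t - F s)\<bar> \<le> K * M\<^sup>2 * (t - s)\<^sup>2"
      by (simp add: power_mult_distrib mult.assoc)
    have "((\<lambda>x. q x - G' (F s) * p x) has_integral
        (integral {\<alpha>..t} q - integral {\<alpha>..s} q) - G' (F s) * (F t - F s)) {s..t}"
      by (intro has_integral_diff has_integral_mult_right lip_primitiveD[OF F] lip_primitiveD[OF lq] st)
    moreover have "\<bar>q x - G' (F s) * p x\<bar> \<le> K * M\<^sup>2 * (t - s)" if x: "x \<in> {s..t}" for x
    proof -
      have "\<bar>q x - G' (F s) * p x\<bar> = \<bar>G' (F x) - G' (F s)\<bar> * \<bar>p x\<bar>"
        by (simp add: q_def abs_mult[symmetric] algebra_simps)
      also have "\<dots> \<le> (K * M * (t - s)) * M"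
      proof (rule mult_mono)
        have "\<bar>G' (F x) - G' (F s)\<bar> \<le> K * M * \<bar>x - s\<bar>" using lip'[of s x] x st by auto
        also have "\<dots> \<le> K * M * (t - s)" using x K0 M(1) by (intro mult_left_mono) auto
        finally show "\<bar>G' (F x) - G' (F s)\<bar> \<le> K * M * (t - s)" .
      qed (use M x st K0 in auto)
      finally show ?thesis by (simp add: power2_eq_square mult_ac)
    qed
    ultimately have "\<bar>(integral {\<alpha>..t} q - integral {\<alpha>..s} q) - G' (F s) * (F t - F s)\<bar>
        \<le> K * M\<^sup>2 * (t - s) * (t - s)"
      using has_integral_bound_real[of "K * M\<^sup>2 * (t - s)" "{}" "\<lambda>x. q x - G' (F s) * p x" _ s t] K0 st by auto
    with 1 show "\<bar>D t - D s\<bar> \<le> 2 * (K * M\<^sup>2) * (t - s)\<^sup>2"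
      unfolding D_def by (simp add: power2_eq_square[of "t - s"] mult.assoc)
  qed (use that in auto)
  have "G (F t) = D \<alpha> + integral {\<alpha>..t} q" if "t \<in> {\<alpha>..\<beta>}" for t
    using D_const[of \<alpha> t] that ab by (auto simp: D_def)
  then show ?thesis
    unfolding q_def[symmetric] by (rule lip_primitive_integral[OF q bq])
qed (auto simp: lip_primitive_def)

lemma lip_primitive_add:
  assumes "lip_primitive \<alpha> \<beta> F p" "lip_primitive \<alpha> \<beta> G q"
  shows "lip_primitive \<alpha> \<beta> (\<lambda>t. F t + G t) (\<lambda>t. p t + q t)"
proof -
  have "((\<lambda>t. p t + q t) has_integral (F t + G t) - (F s + G s)) {s..t}"
    if "\<alpha> \<le> s" "s \<le> t" "t \<le> \<beta>" for s t
    using has_integral_add[OF lip_primitiveD[OF assms(1) that] lip_primitiveD[OF assms(2) that]]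
    by (simp add: algebra_simps)
  then show ?thesis using assms unfolding lip_primitive_def
    by (auto intro: set_integral_add bounded_plus_comp)
qed

lemma lip_primitive_cmult:
  assumes "lip_primitive \<alpha> \<beta> F p"
  shows "lip_primitive \<alpha> \<beta> (\<lambda>t. c * F t) (\<lambda>t. c * p t)"
proof -
  have "((\<lambda>t. c * p t) has_integral c * F t - c * F s) {s..t}"
    if "\<alpha> \<le> s" "s \<le> t" "t \<le> \<beta>" for s t
    using has_integral_mult_right[OF lip_primitiveD[OF assms(1) that], of c]
    by (simp add: algebra_simps)
  moreover have "bounded ((\<lambda>t. c * p t) ` {\<alpha>..\<beta>})"
    using assms bounded_scaling[of "p ` {\<alpha>..\<beta>}" c] unfolding lip_primitive_def by (simp add: image_comp o_def)
  ultimately show ?thesis using assms unfolding lip_primitive_def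
    by (auto intro: absolutely_integrable_continuous_mult)
qed

text \<open>Polarization of the chain rule for the square.\<close>

lemma lip_primitive_mult:
  assumes F: "lip_primitive \<alpha> \<beta> F p" and G: "lip_primitive \<alpha> \<beta> G q"
  shows "lip_primitive \<alpha> \<beta> (\<lambda>t. F t * G t) (\<lambda>t. p t * G t + F t * q t)"
proof -
  have sq: "lip_primitive \<alpha> \<beta> (\<lambda>t. (F t)\<^sup>2) (\<lambda>t. 2 * F t * p t)" if "lip_primitive \<alpha> \<beta> F p" for F p
    by (rule lip_primitive_chain[OF that, of "\<lambda>x. x\<^sup>2" "\<lambda>x. 2 * x" "\<lambda>x. 2"]) (auto intro!: derivative_eq_intros)
  have "lip_primitive \<alpha> \<beta> (\<lambda>t. 1/4 * (F t + G t)\<^sup>2 + (-1/4) * (F t + (-1) * G t)\<^sup>2)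
     (\<lambda>t. 1/4 * (2 * (F t + G t) * (p t + q t)) + (-1/4) * (2 * (F t + (-1) * G t) * (p t + (-1) * q t)))"
    by (intro lip_primitive_add lip_primitive_cmult sq F G)
  then show ?thesis by (simp add: power2_eq_square algebra_simps)
qed

lemma lip_primitive_C1:
  assumes "\<And>t. t \<in> {\<alpha>..\<beta>} \<Longrightarrow> (F has_real_derivative f t) (at t within {\<alpha>..\<beta>})"
    "continuous_on {\<alpha>..\<beta>} f"
  shows "lip_primitive \<alpha> \<beta> F f"
  unfolding lip_primitive_def
proof (intro conjI allI impI)
  show "f absolutely_integrable_on {\<alpha>..\<beta>}" using assms(2) absolutely_integrable_continuous_real by blast
  show "bounded (f ` {\<alpha>..\<beta>})" using assms(2) compact_continuous_image compact_imp_bounded by blast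
  fix s t assume "\<alpha> \<le> s" "s \<le> t" "t \<le> \<beta>"
  then show "(f has_integral F t - F s) {s..t}"
    by (intro fundamental_theorem_of_calculus)
      (auto simp: has_real_derivative_iff_has_vector_derivative[symmetric] intro!: DERIV_subset[OF assms(1)])
qed


section \<open>Ordinary differential equations with a measurable right-hand side\<close>

lemma gronwall:
  fixes v :: "real \<Rightarrow> real"
  assumes v: "continuous_on {0..T} v" and L: "L > 0"
    and le: "\<And>t. t \<in> {0..T} \<Longrightarrow> v t \<le> A + L * integral {0..t} v" and t: "t \<in> {0..T}"
  shows "v t \<le> A * exp (L * t)"
proof -
  define V where "V t = exp (- L * t) * (A + L * integral {0..t} v)" for t
  have d: "(V has_real_derivative exp (- L * x) * L * (v x - (A + L * integral {0..x} v))) (at x within {0..T})"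
    if x: "x \<in> {0..T}" for x
  proof -
    have "((\<lambda>x. integral {0..x} v) has_real_derivative v x) (at x within {0..T})"
      using integral_has_vector_derivative[OF v x] by (simp add: has_real_derivative_iff_has_vector_derivative)
    then show ?thesis unfolding V_def
      by (auto intro!: derivative_eq_intros simp: algebra_simps)
  qed
  have "V t - V 0 \<le> 0"
  proof (rule has_integral_le[of _ "V t - V 0" "{0..t}" "\<lambda>_. 0" 0])
    show "((\<lambda>x. exp (- L * x) * L * (v x - (A + L * integral {0..x} v))) has_integral V t - V 0) {0..t}"
      by (rule fundamental_theorem_of_calculus, use t in simp,
          unfold has_real_derivative_iff_has_vector_derivative[symmetric], rule DERIV_subset[OF d])
        (use t in auto)
    show "((\<lambda>_. 0) has_integral (0::real)) {0..t}" by simp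
    show "exp (- L * x) * L * (v x - (A + L * integral {0..x} v)) \<le> 0" if "x \<in> {0..t}" for x
      using le[of x] that t L by (auto intro!: mult_nonneg_nonpos)
  qed
  then have "exp (- L * t) * (A + L * integral {0..t} v) \<le> A" by (simp add: V_def)
  then have "A + L * integral {0..t} v \<le> A * exp (L * t)" by (simp add: exp_minus field_simps)
  with le[OF t] show ?thesis by simp
qed

text \<open>Banach's fixed point theorem for the integral operator; in the unknown \<open>exp (-2 L t) y t\<close> it is
a contraction for the supremum norm, whatever the length of the interval.\<close>

lemma picard_lindelof_integral:
  fixes F :: "real \<Rightarrow> 'e::euclidean_space \<Rightarrow> 'e"
  assumes T: "T \<ge> 0" and L: "L > 0"
    and int: "\<And>y. continuous_on {0..T} y \<Longrightarrow> (\<lambda>\<tau>. F \<tau> (y \<tau>)) integrable_on {0..T}"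
    and lip: "\<And>\<tau> x y. \<tau> \<in> {0..T} \<Longrightarrow> norm (F \<tau> x - F \<tau> y) \<le> L * norm (x - y)"
  obtains y where "continuous_on {0..T} y" "\<And>t. t \<in> {0..T} \<Longrightarrow> y t = y0 + integral {0..t} (\<lambda>\<tau>. F \<tau> (y \<tau>))"
proof -
  define N where "N z \<tau> = F \<tau> (exp (2 * L * \<tau>) *\<^sub>R z \<tau>)" for z :: "real \<Rightarrow> 'e" and \<tau>
  define P where "P z t = exp (- 2 * L * t) *\<^sub>R (y0 + integral {0..t} (N z))" for z :: "real \<Rightarrow> 'e" and t
  define cl where "cl t = max 0 (min T t)" for t :: real
  have cl: "cl t \<in> {0..T}" for t using T by (auto simp: cl_def)
  have cont_z: "continuous_on S (apply_bcontfun z)" for S and z :: "real \<Rightarrow>\<^sub>C 'e"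
    by (rule continuous_on_subset[OF continuous_on_apply_bcontfun subset_UNIV])
  have N_int: "N z integrable_on {0..t}" if "t \<in> {0..T}" for z :: "real \<Rightarrow>\<^sub>C 'e" and t
  proof -
    have "N z integrable_on {0..T}"
      unfolding N_def[abs_def] by (rule int) (intro continuous_intros cont_z)
    then show ?thesis by (rule integrable_subinterval_real) (use that in auto)
  qed
  have P_cont: "continuous_on {0..T} (P z)" for z :: "real \<Rightarrow>\<^sub>C 'e"
    unfolding P_def[abs_def]
    by (intro continuous_intros indefinite_integral_continuous_1 N_int) (use T in auto)
  define S :: "(real \<Rightarrow>\<^sub>C 'e) \<Rightarrow> (real \<Rightarrow>\<^sub>C 'e)" where "S z = Bcontfun (\<lambda>t. P z (cl t))" for z
  have S: "apply_bcontfun (S z) t = P z (cl t)" for z t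
  proof -
    have "continuous_on UNIV (\<lambda>t. P z (cl t))"
      by (rule continuous_on_compose2[OF P_cont]) (use cl in \<open>auto simp: cl_def intro!: continuous_intros\<close>)
    moreover have "bounded (range (\<lambda>t. P z (cl t)))"
      by (rule bounded_subset[OF compact_imp_bounded[OF compact_continuous_image[OF P_cont[of z]]]])
        (use cl in auto)
    ultimately have "(\<lambda>t. P z (cl t)) \<in> bcontfun" by (simp add: bcontfun_def)
    then show ?thesis by (simp add: S_def Bcontfun_inverse)
  qed
  have "\<exists>!z. S z = z"
  proof (rule banach_fix_type[of "1/2"])
    show "\<forall>z w. dist (S z) (S w) \<le> 1/2 * dist z w"
    proof (intro allI dist_bound)
      fix z w :: "real \<Rightarrow>\<^sub>C 'e" and t
      define s where "s = cl t"
      have s: "s \<in> {0..T}" using cl s_def by simp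
      have "integral {0..s} (N z) - integral {0..s} (N w) = integral {0..s} (\<lambda>\<tau>. N z \<tau> - N w \<tau>)"
        by (rule Henstock_Kurzweil_Integration.integral_diff[OF N_int[OF s, of z] N_int[OF s, of w], symmetric])
      moreover have E: "((\<lambda>\<tau>. L * exp (2 * L * \<tau>) * dist z w) has_integral
          dist z w / 2 * exp (2 * L * s) - dist z w / 2 * exp (2 * L * 0)) {0..s}"
        by (rule fundamental_theorem_of_calculus)
          (use s in \<open>auto intro!: derivative_eq_intros simp: has_real_derivative_iff_has_vector_derivative[symmetric]\<close>)
      moreover have "norm (integral {0..s} (\<lambda>\<tau>. N z \<tau> - N w \<tau>))
          \<le> integral {0..s} (\<lambda>\<tau>. L * exp (2 * L * \<tau>) * dist z w)"
      proof (rule Henstock_Kurzweil_Integration.integral_norm_bound_integral)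
        show "(\<lambda>\<tau>. N z \<tau> - N w \<tau>) integrable_on {0..s}"
          using N_int[OF s] by (intro integrable_diff)
        show "(\<lambda>\<tau>. L * exp (2 * L * \<tau>) * dist z w) integrable_on {0..s}" using E by blast
        fix \<tau> assume "\<tau> \<in> {0..s}"
        then have "norm (N z \<tau> - N w \<tau>)
            \<le> L * norm (exp (2 * L * \<tau>) *\<^sub>R z \<tau> - exp (2 * L * \<tau>) *\<^sub>R w \<tau>)"
          unfolding N_def using s by (intro lip) auto
        also have "\<dots> = L * exp (2 * L * \<tau>) * dist (z \<tau>) (w \<tau>)"
          by (simp add: dist_norm scaleR_diff_right[symmetric])
        also have "\<dots> \<le> L * exp (2 * L * \<tau>) * dist z w"
          using L dist_bounded[of z \<tau> w] by (intro mult_left_mono) auto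
        finally show "norm (N z \<tau> - N w \<tau>) \<le> L * exp (2 * L * \<tau>) * dist z w" .
      qed
      ultimately have "norm (integral {0..s} (N z) - integral {0..s} (N w)) \<le> dist z w / 2 * exp (2 * L * s)"
        using integral_unique[OF E] zero_le_dist[of z w] by (simp del: zero_le_dist)
      then have "exp (- 2 * L * s) * norm (integral {0..s} (N z) - integral {0..s} (N w))
          \<le> exp (- 2 * L * s) * (dist z w / 2 * exp (2 * L * s))"
        by (intro mult_left_mono) auto
      also have "\<dots> = 1/2 * dist z w" by (simp add: exp_minus field_simps)
      finally have "dist (P z s) (P w s) \<le> 1/2 * dist z w"
        by (simp add: P_def dist_norm scaleR_diff_right[symmetric])
      then show "dist (S z t) (S w t) \<le> 1/2 * dist z w" by (simp add: S s_def)
    qed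
  qed auto
  then obtain z where z: "S z = z" by blast
  define y where "y t = exp (2 * L * t) *\<^sub>R z t" for t
  show ?thesis
  proof (rule that[of y])
    show "continuous_on {0..T} y" unfolding y_def[abs_def] by (intro continuous_intros cont_z)
    fix t assume t: "t \<in> {0..T}"
    then have "cl t = t" by (auto simp: cl_def)
    then have "z t = P z t" using S[of z t] z by simp
    then have "y t = y0 + integral {0..t} (N z)"
      by (simp add: y_def P_def exp_add[symmetric])
    then show "y t = y0 + integral {0..t} (\<lambda>\<tau>. F \<tau> (y \<tau>))" by (simp add: N_def[abs_def] y_def)
  qed
qed

section \<open>Unique continuation for the Helmholtz equation\<close>

lemma obtain_antiderivative:
  fixes f :: "real \<Rightarrow> real" and c :: real
  assumes "continuous_on UNIV f"
  obtains F where "\<And>x. (F has_real_derivative f x) (at x)" "F c = 0"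
proof
  define F where "F x = (LBINT y=c..x. f y)" for x :: real
  show "(F has_real_derivative f x) (at x)" for x
  proof -
    define a b where "a = min c x - 1" and "b = max c x + 1"
    have ab: "a \<le> c" "c \<le> b" "a < x" "x < b" by (auto simp: a_def b_def)
    have "((\<lambda>u. LBINT y=c..u. f y) has_vector_derivative f x) (at x within {a..b})"
      by (rule interval_integral_FTC2) (use ab assms continuous_on_subset in auto)
    moreover have "at x within {a..b} = at x" using ab by (simp add: at_within_Icc_at)
    ultimately show ?thesis
      by (simp add: F_def[abs_def] has_real_derivative_iff_has_vector_derivative)
  qed
  show "F c = 0" by (simp add: F_def)
qed

text \<open>The equation is \<open>(\<Delta> + m) \<Psi> = \<eta>(|x|\<^sup>2)\<close> for \<open>\<Psi>(x) = g(|x|\<^sup>2)\<close> in dimension \<open>n\<close>. It is solved from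
\<open>s = S\<close> towards the origin, and the solution extended by zero is smooth because \<open>\<eta>\<close> vanishes
beyond \<open>S\<close>.\<close>

lemma radial_equation_solvable:
  fixes \<eta> :: "real \<Rightarrow> real" and n m \<sigma> S :: real
  assumes \<sigma>: "0 < \<sigma>" "\<sigma> < S" and \<eta>: "smooth_on UNIV \<eta>" "\<And>s. s \<ge> S \<Longrightarrow> \<eta> s = 0"
  obtains g g1 g2 where "smooth_on {\<sigma><..} g" "\<And>s. s \<ge> S \<Longrightarrow> g s = 0"
    "\<And>s. s > \<sigma> \<Longrightarrow> (g has_real_derivative g1 s) (at s)"
    "\<And>s. s > \<sigma> \<Longrightarrow> (g1 has_real_derivative g2 s) (at s)"
    "\<And>s. s > \<sigma> \<Longrightarrow> 4 * s * g2 s + 2 * n * g1 s + m * g s = \<eta> s"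
proof -
  define T where "T = S - \<sigma>"
  \<comment> \<open>The time of \<open>F\<close> runs backwards: \<open>t = S - s\<close>, and the state is \<open>(g, g')\<close>.\<close>
  define F :: "real \<Rightarrow> real \<times> real \<Rightarrow> real \<times> real" where
    "F t z = (- snd z, - ((\<eta> (S - t) - 2 * n * snd z - m * fst z) / (4 * (S - t))))" for t z
  have cont_eta: "continuous_on A \<eta>" for A
    by (rule smooth_on_UNIV_continuous[OF \<eta>(1)])
  have F_cont: "continuous_on A (\<lambda>t. F t (y t))" if "continuous_on A y" "A \<subseteq> {..T}" for A y
    unfolding F_def
    by (intro continuous_intros that continuous_on_compose2[OF cont_eta[of UNIV]])
      (use that \<sigma> in \<open>auto simp: T_def\<close>)
  define L where "L = 1 + (2 * \<bar>n\<bar> + \<bar>m\<bar>) / (4 * \<sigma>)"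
  have L: "L > 0" using \<sigma> by (auto simp: L_def add_pos_nonneg)
  obtain y where y: "continuous_on {0..T} y"
    "\<And>t. t \<in> {0..T} \<Longrightarrow> y t = 0 + integral {0..t} (\<lambda>\<tau>. F \<tau> (y \<tau>))"
  proof (rule picard_lindelof_integral[of T L F 0])
    show "T \<ge> 0" using \<sigma> by (simp add: T_def)
    show "(\<lambda>\<tau>. F \<tau> (y \<tau>)) integrable_on {0..T}" if "continuous_on {0..T} y" for y
      by (intro integrable_continuous_real F_cont that) auto
    fix \<tau> and x z :: "real \<times> real" assume \<tau>: "\<tau> \<in> {0..T}"
    have s: "S - \<tau> \<ge> \<sigma>" using \<tau> by (simp add: T_def)
    define d where "d = x - z"
    have "F \<tau> x - F \<tau> z = (- snd d, (2 * n * snd d + m * fst d) / (4 * (S - \<tau>)))"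
      by (simp add: F_def d_def add_divide_distrib diff_divide_distrib algebra_simps)
    also have "norm \<dots> \<le> norm (- snd d) + norm ((2 * n * snd d + m * fst d) / (4 * (S - \<tau>)))"
      by (rule norm_Pair_le)
    also have "\<dots> \<le> norm d + ((2 * \<bar>n\<bar> + \<bar>m\<bar>) * norm d) / (4 * \<sigma>)"
    proof (rule add_mono)
      have fs: "\<bar>fst d\<bar> \<le> norm d" "\<bar>snd d\<bar> \<le> norm d"
        using norm_fst_le[of "fst d" "snd d"] norm_snd_le[of "snd d" "fst d"] by auto
      then show "norm (- snd d) \<le> norm d" by simp
      have "\<bar>2 * n * snd d + m * fst d\<bar> \<le> 2 * \<bar>n\<bar> * \<bar>snd d\<bar> + \<bar>m\<bar> * \<bar>fst d\<bar>"
        by (rule order_trans[OF abs_triangle_ineq]) (simp add: abs_mult)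
      also have "\<dots> \<le> 2 * \<bar>n\<bar> * norm d + \<bar>m\<bar> * norm d"
        using fs by (intro add_mono mult_left_mono) auto
      finally show "norm ((2 * n * snd d + m * fst d) / (4 * (S - \<tau>))) \<le> ((2 * \<bar>n\<bar> + \<bar>m\<bar>) * norm d) / (4 * \<sigma>)"
        using s \<sigma> by (auto simp: abs_divide algebra_simps intro!: frac_le)
    qed
    also have "\<dots> = L * norm (x - z)" by (simp add: L_def d_def algebra_simps add_divide_distrib)
    finally show "norm (F \<tau> x - F \<tau> z) \<le> L * norm (x - z)" .
  qed (use L in auto)
  define Y where "Y t = y (max 0 t)" for t
  have y0: "y 0 = 0" using y(2)[of 0] \<sigma> by (simp add: T_def)
  have Y_neg: "Y t = 0" if "t \<le> 0" for t using that y0 by (simp add: Y_def max_def)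
  have Y_cont: "continuous_on {..T} Y"
    unfolding Y_def[abs_def]
    by (rule continuous_on_compose2[OF y(1)]) (use \<sigma> in \<open>auto simp: T_def intro!: continuous_intros\<close>)
  have F_neg: "F t (Y t) = 0" if "t \<le> 0" for t
    using that \<eta>(2)[of "S - t"] by (simp add: F_def Y_neg zero_prod_def)
  \<comment> \<open>The field vanishes along the zero state for \<open>t \<le> 0\<close>, so the extension by zero still solves the
     equation at \<open>t = 0\<close>, with a two-sided derivative.\<close>
  have Y_deriv: "(Y has_vector_derivative F t (Y t)) (at t)" if t: "t < T" for t
  proof -
    define A where "A = min (-1) (t - 1)"
    define e where "e \<tau> = F \<tau> (Y \<tau>)" for \<tau>
    have e: "continuous_on {A..T} e"
      unfolding e_def by (intro F_cont continuous_on_subset[OF Y_cont]) auto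
    have Y_int: "Y r = integral {A..r} e" if r: "r \<in> {A..T}" for r
    proof (cases "r \<le> 0")
      case True
      then have "integral {A..r} e = integral {A..r} (\<lambda>_. 0)"
        by (intro Henstock_Kurzweil_Integration.integral_cong) (auto simp: e_def F_neg)
      then show ?thesis using True by (simp add: Y_neg)
    next
      case False
      have "integral {A..0} e + integral {0..r} e = integral {A..r} e"
        by (rule Henstock_Kurzweil_Integration.integral_combine)
          (use False r in \<open>auto simp: A_def intro!: integrable_continuous_real continuous_on_subset[OF e]\<close>)
      moreover have "integral {A..0} e = integral {A..0} (\<lambda>_. 0)"
        by (intro Henstock_Kurzweil_Integration.integral_cong) (auto simp: e_def F_neg)
      moreover have "integral {0..r} e = integral {0..r} (\<lambda>\<tau>. F \<tau> (y \<tau>))"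
        by (intro Henstock_Kurzweil_Integration.integral_cong) (auto simp: e_def Y_def)
      moreover have "Y r = y r" using False by (simp add: Y_def)
      ultimately show ?thesis using y(2)[of r] r False by simp
    qed
    have tA: "t \<in> {A..T}" "A < t" using t by (auto simp: A_def)
    have "((\<lambda>r. integral {A..r} e) has_vector_derivative e t) (at t within {A..T})"
      by (rule integral_has_vector_derivative[OF e tA(1)])
    then have "(Y has_vector_derivative e t) (at t within {A..T})"
      by (rule has_vector_derivative_transform[rotated 2]) (use tA Y_int in auto)
    moreover have "at t within {A..T} = at t" using tA t by (simp add: at_within_Icc_at)
    ultimately show ?thesis by (simp add: e_def)
  qed
  define G0 where "G0 s = fst (Y (S - s))" for s
  define G1 where "G1 s = snd (Y (S - s))" for s
  define \<eta>' where "\<eta>' k = (partial 1 ^^ k) \<eta>" for k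
  have \<eta>'_smooth: "smooth_on UNIV (\<eta>' k)" for k
    unfolding \<eta>'_def by (induction k) (auto simp: \<eta> intro: smooth_on_partial)
  have \<eta>'_deriv: "(\<eta>' k has_real_derivative \<eta>' (Suc k) s) (at s)" for k s
    using smooth_on_has_real_derivative[OF _ \<eta>'_smooth[of k]] by (simp add: \<eta>'_def)
  \<comment> \<open>Differentiating \<open>4 s g'' + 2 n g' + m g = \<eta>\<close> \<open>k\<close> times expresses the derivative of order \<open>k + 2\<close>
     by the two preceding ones; \<open>G k\<close> is the \<open>k\<close>-th derivative.\<close>
  define R where "R k A B s = (\<eta>' k s - (4 * real k + 2 * n) * B s - m * A s) / (4 * s)" for k and A B :: "real \<Rightarrow> real" and s
  define P where "P = rec_nat (G0, G1) (\<lambda>k AB. (snd AB, R k (fst AB) (snd AB)))"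
  define G where "G k = fst (P k)" for k
  have snd_P: "snd (P k) = G (Suc k)" for k by (simp add: G_def P_def)
  have G_0: "G 0 = G0" "G (Suc 0) = G1" by (simp_all add: G_def P_def)
  have G_Suc: "G (Suc (Suc k)) = R k (G k) (G (Suc k))" for k
    by (simp add: G_def P_def)
  have Y_deriv': "((\<lambda>s. Y (S - s)) has_vector_derivative - F (S - s) (Y (S - s))) (at s)" if "s > \<sigma>" for s
  proof -
    have 1: "((\<lambda>s. S - s) has_vector_derivative (-1)) (at s)"
      by (auto intro!: derivative_eq_intros)
    have "(Y has_vector_derivative F (S - s) (Y (S - s))) (at (S - s))"
      using that by (intro Y_deriv) (simp add: T_def)
    from vector_diff_chain_at[OF 1 this] show ?thesis by (simp add: o_def)
  qed
  have G0_deriv: "(G0 has_real_derivative G1 s) (at s)" if "s > \<sigma>" for s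
  proof -
    have "((\<lambda>s. fst (Y (S - s))) has_vector_derivative fst (- F (S - s) (Y (S - s)))) (at s)"
      using bounded_linear.has_vector_derivative[OF bounded_linear_fst Y_deriv'[OF that]] .
    then show ?thesis
      by (simp add: G0_def[abs_def] G1_def F_def has_real_derivative_iff_has_vector_derivative)
  qed
  have G1_deriv: "(G1 has_real_derivative R 0 G0 G1 s) (at s)" if "s > \<sigma>" for s
  proof -
    have "((\<lambda>s. snd (Y (S - s))) has_vector_derivative snd (- F (S - s) (Y (S - s)))) (at s)"
      using bounded_linear.has_vector_derivative[OF bounded_linear_snd Y_deriv'[OF that]] .
    then show ?thesis
      by (simp add: G0_def G1_def[abs_def] F_def R_def \<eta>'_def has_real_derivative_iff_has_vector_derivative)
  qed
  have G_deriv: "(G k has_real_derivative G (Suc k) s) (at s) \<and> (G (Suc k) has_real_derivative G (Suc (Suc k)) s) (at s)"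
    if s: "s > \<sigma>" for k s
    using s
  proof (induction k arbitrary: s)
    case 0
    then show ?case using G0_deriv G1_deriv by (simp add: G_0 G_Suc)
  next
    case (Suc k)
    have s0: "s \<noteq> 0" using Suc.prems \<sigma> by simp
    define N where "N s = \<eta>' k s - (4 * real k + 2 * n) * G (Suc k) s - m * G k s" for s
    have GN: "G (Suc (Suc k)) = (\<lambda>s. N s / (4 * s))"
      by (auto simp: G_Suc R_def N_def)
    define N' where "N' = \<eta>' (Suc k) s - (4 * real k + 2 * n) * G (Suc (Suc k)) s - m * G (Suc k) s"
    have "(N has_real_derivative N') (at s)"
      unfolding N_def[abs_def] N'_def using Suc.IH[OF Suc.prems]
      by (auto intro!: derivative_eq_intros \<eta>'_deriv)
    then have "((\<lambda>s. N s / (4 * s)) has_real_derivative (N' * (4 * s) - N s * 4) / ((4 * s) * (4 * s))) (at s)"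
      using s0 by (intro DERIV_divide) (auto intro!: derivative_eq_intros)
    moreover have "(N' * (4 * s) - N s * 4) / ((4 * s) * (4 * s)) = (N' - 4 * (N s / (4 * s))) / (4 * s)"
      using s0 by (simp add: field_simps)
    moreover have "(N' - 4 * (N s / (4 * s))) / (4 * s) = G (Suc (Suc (Suc k))) s"
    proof -
      have "G (Suc (Suc (Suc k))) s = (\<eta>' (Suc k) s - (4 * real (Suc k) + 2 * n) * G (Suc (Suc k)) s - m * G (Suc k) s) / (4 * s)"
        by (simp only: G_Suc[of "Suc k"] R_def)
      also have "\<dots> = (N' - 4 * G (Suc (Suc k)) s) / (4 * s)"
        by (simp add: N'_def algebra_simps)
      finally show ?thesis by (simp add: GN)
    qed
    ultimately show ?case using Suc.IH[OF Suc.prems] GN by simp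
  qed
  show ?thesis
  proof (rule that[of G0 G1 "R 0 G0 G1"])
    have "smooth_on {\<sigma><..} (G 0)"
      by (rule smooth_on_real_derivatives) (use G_deriv in auto)
    then show "smooth_on {\<sigma><..} G0" by (simp add: G_0)
    show "G0 s = 0" if "s \<ge> S" for s using that by (simp add: G0_def Y_neg)
    show "4 * s * R 0 G0 G1 s + 2 * n * G1 s + m * G0 s = \<eta> s" if "s > \<sigma>" for s
      using that \<sigma> by (simp add: R_def \<eta>'_def)
  qed (use G0_deriv G1_deriv in auto)
qed

definition sq_dist :: "'a::euclidean_space \<Rightarrow> 'a \<Rightarrow> real" where
  "sq_dist q x = (x - q) \<bullet> (x - q)"

lemma sq_dist_has_derivative: "(sq_dist q has_derivative (\<lambda>h. 2 * ((x - q) \<bullet> h))) (at x)"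
  unfolding sq_dist_def[abs_def]
  by (auto intro!: derivative_eq_intros simp: inner_commute)

lemma smooth_on_inner_left: "smooth_on UNIV (\<lambda>x. (x - q) \<bullet> b)"
proof -
  have "smooth_on UNIV (\<lambda>x. x \<bullet> b - q \<bullet> b)"
    by (intro smooth_on_diff smooth_on_simps) (auto intro: bounded_linear_inner_left)
  then show ?thesis by (simp add: inner_diff_left)
qed

lemma smooth_sq_dist: "smooth_on UNIV (sq_dist q)"
proof -
  have "smooth_on UNIV (\<lambda>x. \<Sum>b\<in>Basis. ((x - q) \<bullet> b) * ((x - q) \<bullet> b))"
    by (intro smooth_on_sum smooth_on_simps smooth_on_inner_left) auto
  then show ?thesis by (simp add: sq_dist_def[abs_def] euclidean_inner[symmetric])
qed

lemma continuous_sq_dist: "continuous_on A (sq_dist q)"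
  unfolding sq_dist_def[abs_def] by (intro continuous_intros)

lemma sq_dist_less_iff: "r \<ge> 0 \<Longrightarrow> sq_dist q x < r\<^sup>2 \<longleftrightarrow> x \<in> ball q r"
  using power_strict_mono[of "norm (x - q)" r 2] power_less_imp_less_base[of "norm (x - q)" 2 r]
  by (auto simp: sq_dist_def dot_square_norm dist_norm norm_minus_commute)

lemma radial_partial:
  fixes f :: "real \<Rightarrow> real"
  assumes f: "smooth_on UNIV f"
  shows "partial b (\<lambda>x. f (sq_dist q x)) x = partial 1 f (sq_dist q x) * (2 * ((x - q) \<bullet> b))"
proof -
  have "(f has_derivative (*) (partial 1 f (sq_dist q x))) (at (sq_dist q x))"
    using smooth_on_has_real_derivative[OF open_UNIV f] by (simp add: has_field_derivative_def)
  from has_derivative_compose[OF sq_dist_has_derivative this] show ?thesis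
    by (rule partial_eqI)
qed

lemma radial_laplacian:
  fixes f :: "real \<Rightarrow> real"
  assumes f: "smooth_on UNIV f"
  shows "(\<Sum>b\<in>Basis. partial b (partial b (\<lambda>x. f (sq_dist q x))) (x::'a::euclidean_space))
    = 4 * sq_dist q x * partial 1 (partial 1 f) (sq_dist q x) + 2 * DIM('a) * partial 1 f (sq_dist q x)"
proof -
  define f1 where "f1 = partial 1 f"
  have f1: "smooth_on UNIV f1" unfolding f1_def by (rule smooth_on_partial[OF f]) simp
  have "partial b (partial b (\<lambda>x. f (sq_dist q x))) x
      = 4 * partial 1 f1 (sq_dist q x) * (((x - q) \<bullet> b) * ((x - q) \<bullet> b)) + 2 * f1 (sq_dist q x)"
    if b: "b \<in> Basis" for b
  proof -
    have "(f1 has_derivative (*) (partial 1 f1 (sq_dist q x))) (at (sq_dist q x))"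
      using smooth_on_has_real_derivative[OF open_UNIV f1] by (simp add: has_field_derivative_def)
    from has_derivative_compose[OF sq_dist_has_derivative this]
    have 1: "((\<lambda>x. f1 (sq_dist q x)) has_derivative (\<lambda>h. partial 1 f1 (sq_dist q x) * (2 * ((x - q) \<bullet> h)))) (at x)" .
    have 2: "((\<lambda>x. 2 * ((x - q) \<bullet> b)) has_derivative (\<lambda>h. 2 * (h \<bullet> b))) (at x)"
      by (auto intro!: derivative_eq_intros)
    have "partial b (\<lambda>x. f1 (sq_dist q x) * (2 * ((x - q) \<bullet> b))) x
       = f1 (sq_dist q x) * (2 * (b \<bullet> b)) + partial 1 f1 (sq_dist q x) * (2 * ((x - q) \<bullet> b)) * (2 * ((x - q) \<bullet> b))"
      by (rule partial_eqI[OF has_derivative_mult[OF 1 2]])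
    moreover have "partial b (\<lambda>x. f (sq_dist q x)) = (\<lambda>x. f1 (sq_dist q x) * (2 * ((x - q) \<bullet> b)))"
      using radial_partial[OF f] by (auto simp: f1_def)
    ultimately show ?thesis using b by (simp add: inner_Basis algebra_simps)
  qed
  then have "(\<Sum>b\<in>Basis. partial b (partial b (\<lambda>x. f (sq_dist q x))) x)
     = (\<Sum>b\<in>Basis. 4 * partial 1 f1 (sq_dist q x) * (((x - q) \<bullet> b) * ((x - q) \<bullet> b)) + 2 * f1 (sq_dist q x))"
    by simp
  also have "\<dots> = 4 * partial 1 f1 (sq_dist q x) * sq_dist q x + 2 * DIM('a) * f1 (sq_dist q x)"
    by (simp add: sum.distrib sum_distrib_left[symmetric] sq_dist_def euclidean_inner[of "x - q" "x - q", symmetric])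
  finally show ?thesis by (simp add: f1_def)
qed

text \<open>The equation \<open>\<Delta> f + m f = 0\<close> with all derivatives moved to the test function, so that no regularity
of \<open>f\<close> enters the argument for unique continuation.\<close>

definition weak_helmholtz :: "'a::euclidean_space set \<Rightarrow> real \<Rightarrow> ('a \<Rightarrow> real) \<Rightarrow> bool" where
  "weak_helmholtz U m f \<longleftrightarrow> set_integrable lborel U f \<and>
     (\<forall>\<psi>. test_fun U \<psi> \<longrightarrow>
       (LINT x:U|lborel. f x * ((\<Sum>b\<in>Basis. partial b (partial b \<psi>) x) + m * \<psi> x)) = 0)"

text \<open>The radial solution is cut off near its singular centre, where \<open>f\<close> vanishes anyway.\<close>

lemma weak_helmholtz_radial_zero:
  fixes f :: "'a::euclidean_space \<Rightarrow> real"
  assumes weak: "weak_helmholtz U m f" and U: "open U" and ball: "cball q \<rho> \<subseteq> U"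
    and \<sigma>: "0 < \<sigma>" "\<sigma> < \<rho>" and zero: "AE x in lborel. x \<in> ball q \<sigma> \<longrightarrow> f x = 0"
    and \<eta>: "smooth_on UNIV \<eta>" "\<And>s. s \<ge> \<rho>\<^sup>2 \<Longrightarrow> \<eta> s = 0"
  shows "(LINT x:U|lborel. f x * \<eta> (sq_dist q x)) = 0"
proof -
  have lt: "\<sigma>\<^sup>2 / 4 < \<rho>\<^sup>2" "0 < \<sigma>\<^sup>2 / 4"
  proof -
    have "\<sigma>\<^sup>2 < \<rho>\<^sup>2" "0 < \<sigma>\<^sup>2" using \<sigma> by (auto intro: power_strict_mono)
    then show "\<sigma>\<^sup>2 / 4 < \<rho>\<^sup>2" "0 < \<sigma>\<^sup>2 / 4" by linarith+
  qed
  obtain g g1 g2 where g: "smooth_on {\<sigma>\<^sup>2/4<..} g" "\<And>s. s \<ge> \<rho>\<^sup>2 \<Longrightarrow> g s = 0"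
    "\<And>s. s > \<sigma>\<^sup>2/4 \<Longrightarrow> (g has_real_derivative g1 s) (at s)"
    "\<And>s. s > \<sigma>\<^sup>2/4 \<Longrightarrow> (g1 has_real_derivative g2 s) (at s)"
    "\<And>s. s > \<sigma>\<^sup>2/4 \<Longrightarrow> 4 * s * g2 s + 2 * real DIM('a) * g1 s + m * g s = \<eta> s"
    using radial_equation_solvable[OF lt(2,1) \<eta>] by metis
  have lt': "\<sigma>\<^sup>2/2 < 3/4 * \<sigma>\<^sup>2" using lt by simp
  obtain \<kappa> :: "real \<Rightarrow> real" where \<kappa>: "smooth_on UNIV \<kappa>" "\<And>x. x \<le> \<sigma>\<^sup>2/2 \<Longrightarrow> \<kappa> x = 0"
    "\<And>x. x \<ge> 3/4 * \<sigma>\<^sup>2 \<Longrightarrow> \<kappa> x = 1"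
    using obtain_cutoff[OF lt'] by metis
  define h where "h s = \<kappa> s * g s" for s
  have h: "smooth_on UNIV h"
  proof -
    have "smooth_on {\<sigma>\<^sup>2/4<..} h"
      unfolding h_def by (intro smooth_on_simps(4) g smooth_on_subset[OF \<kappa>(1)]) auto
    moreover have "smooth_on {..<\<sigma>\<^sup>2/2} h"
      using smooth_on_simps(1)[of "{..<\<sigma>\<^sup>2/2}" 0] by (rule smooth_on_cong[THEN iffD1, rotated 2]) (auto simp: h_def \<kappa>)
    ultimately have "smooth_on ({\<sigma>\<^sup>2/4<..} \<union> {..<\<sigma>\<^sup>2/2}) h" by (intro smooth_on_Un) auto
    moreover have "{\<sigma>\<^sup>2/4<..} \<union> {..<\<sigma>\<^sup>2/2} = (UNIV :: real set)"
    proof -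
      have "s > \<sigma>\<^sup>2/4 \<or> s < \<sigma>\<^sup>2/2" for s using lt(2) by linarith
      then show ?thesis by blast
    qed
    ultimately show ?thesis by simp
  qed
  define \<psi> where "\<psi> x = h (sq_dist q x)" for x
  have \<psi>: "smooth_on UNIV \<psi>"
    unfolding \<psi>_def[abs_def] by (rule smooth_on_compose[OF _ _ h smooth_sq_dist]) auto
  have "test_fun U \<psi>"
  proof (rule test_funI[OF \<psi> compact_cball])
    show "\<psi> x = 0" if "x \<notin> cball q \<rho>" for x
    proof -
      have "\<not> sq_dist q x < \<rho>\<^sup>2" using that sq_dist_less_iff[of \<rho> q x] \<sigma> by auto
      then show ?thesis by (simp add: \<psi>_def h_def g)
    qed
  qed (rule ball)
  then have "(LINT x:U|lborel. f x * ((\<Sum>b\<in>Basis. partial b (partial b \<psi>) x) + m * \<psi> x)) = 0"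
    using weak by (simp add: weak_helmholtz_def)
  moreover have "(LINT x:U|lborel. f x * ((\<Sum>b\<in>Basis. partial b (partial b \<psi>) x) + m * \<psi> x))
      = (LINT x:U|lborel. f x * \<eta> (sq_dist q x))"
    unfolding set_lebesgue_integral_def
  proof (rule integral_cong_AE)
    have [measurable]: "U \<in> sets borel" using U by simp
    have fm: "(\<lambda>x. indicator U x *\<^sub>R f x) \<in> borel_measurable lborel"
      using weak borel_measurable_integrable unfolding weak_helmholtz_def set_integrable_def by blast
    have meas: "(\<lambda>x. indicator U x *\<^sub>R (f x * c x)) \<in> borel_measurable lborel"
      if c: "continuous_on UNIV c" for c
    proof -
      have [measurable]: "c \<in> borel_measurable borel" using c by (rule borel_measurable_continuous_onI)
      have "(\<lambda>x. (indicator U x *\<^sub>R f x) * c x) \<in> borel_measurable lborel"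
        using fm by measurable
      then show ?thesis by (simp add: mult.assoc)
    qed
    show "(\<lambda>x. indicator U x *\<^sub>R (f x * ((\<Sum>b\<in>Basis. partial b (partial b \<psi>) x) + m * \<psi> x))) \<in> borel_measurable lborel"
      by (rule meas) (intro continuous_intros smooth_on_continuous smooth_on_partial \<psi>)
    show "(\<lambda>x. indicator U x *\<^sub>R (f x * \<eta> (sq_dist q x))) \<in> borel_measurable lborel"
      by (rule meas) (intro continuous_on_compose2[OF smooth_on_continuous[OF \<eta>(1)]] continuous_sq_dist, auto)
    have eq: "(\<Sum>b\<in>Basis. partial b (partial b \<psi>) x) + m * \<psi> x = \<eta> (sq_dist q x)" if x: "x \<notin> ball q \<sigma>" for x
    proof -
      have s: "sq_dist q x \<ge> \<sigma>\<^sup>2" using sq_dist_less_iff[of \<sigma> q x] x \<sigma> by auto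
      have hg: "h s = g s" if "s > 3/4 * \<sigma>\<^sup>2" for s using that by (simp add: h_def \<kappa>)
      have h1: "partial 1 h s = g1 s" if s: "s > 3/4 * \<sigma>\<^sup>2" for s
      proof -
        have "s > \<sigma>\<^sup>2/4" using s lt(2) by linarith
        then have "(g has_real_derivative g1 s) (at s)" by (rule g(3))
        then have "(h has_real_derivative g1 s) (at s)"
          by (rule has_field_derivative_transform_within_open[where S = "{3/4 * \<sigma>\<^sup>2<..}"]) (use s hg in auto)
        then show ?thesis by (rule partial_real_eqI)
      qed
      have h2: "partial 1 (partial 1 h) s = g2 s" if s: "s > 3/4 * \<sigma>\<^sup>2" for s
      proof -
        have "s > \<sigma>\<^sup>2/4" using s lt(2) by linarith
        then have "(g1 has_real_derivative g2 s) (at s)" by (rule g(4))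
        then have "(partial 1 h has_real_derivative g2 s) (at s)"
          by (rule has_field_derivative_transform_within_open[where S = "{3/4 * \<sigma>\<^sup>2<..}"]) (use s h1 in auto)
        then show ?thesis by (rule partial_real_eqI)
      qed
      have s': "sq_dist q x > 3/4 * \<sigma>\<^sup>2" "sq_dist q x > \<sigma>\<^sup>2/4" using s lt(2) by linarith+
      show ?thesis
        unfolding \<psi>_def radial_laplacian[OF h] h1[OF s'(1)] h2[OF s'(1)] hg[OF s'(1)]
        using g(5)[OF s'(2)] by simp
    qed
    show "AE x in lborel. indicator U x *\<^sub>R (f x * ((\<Sum>b\<in>Basis. partial b (partial b \<psi>) x) + m * \<psi> x))
       = indicator U x *\<^sub>R (f x * \<eta> (sq_dist q x))"
      using zero by eventually_elim (use eq in auto)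
  qed
  ultimately show ?thesis by simp
qed

text \<open>If \<open>\<eta>1\<close> is a primitive of \<open>\<eta>\<close>, the derivative of \<open>\<eta>1(|x - q|\<^sup>2)\<close> with respect to \<open>q\<close> in direction
\<open>e\<close> is \<open>- 2 ((x - q) \<bullet> e) \<eta>(|x - q|\<^sup>2)\<close>; and the profile \<open>\<eta>1\<close> is admissible together with \<open>\<eta>\<close>.\<close>

lemma radial_moments_times_coordinate:
  fixes w :: "'a::euclidean_space \<Rightarrow> real"
  assumes w: "integrable lborel w" and K: "compact K" "\<And>x. x \<notin> K \<Longrightarrow> w x = 0"
    and V: "open V" and e: "e \<in> Basis"
    and zero: "\<And>\<eta> q. smooth_on UNIV \<eta> \<Longrightarrow> (\<And>s. s \<ge> S \<Longrightarrow> \<eta> s = 0) \<Longrightarrow> q \<in> V \<Longrightarrow>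
      (LINT x|lborel. w x * \<eta> (sq_dist q x)) = 0"
    and \<eta>: "smooth_on UNIV \<eta>" "\<And>s. s \<ge> S \<Longrightarrow> \<eta> s = 0" and q: "q \<in> V"
  shows "(LINT x|lborel. (w x * (x \<bullet> e)) * \<eta> (sq_dist q x)) = 0"
proof -
  obtain \<eta>1 where \<eta>1: "\<And>x. (\<eta>1 has_real_derivative \<eta> x) (at x)" "\<eta>1 S = 0"
    using obtain_antiderivative[OF smooth_on_continuous[OF \<eta>(1)]] by metis
  have s1: "smooth_on UNIV \<eta>1" using smooth_on_antiderivative[OF open_UNIV _ \<eta>(1)] \<eta>1 by blast
  have z1: "\<eta>1 s = 0" if "s \<ge> S" for s
  proof -
    have "\<exists>c. \<forall>x\<in>{S..}. \<eta>1 x = c"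
    proof (rule has_field_derivative_zero_constant)
      fix x assume "x \<in> {S..}"
      then show "(\<eta>1 has_field_derivative 0) (at x within {S..})"
        using \<eta>1(1)[of x] \<eta>(2)[of x] by (auto intro: DERIV_subset)
    qed auto
    then show ?thesis using \<eta>1(2) that by force
  qed
  have c\<eta>: "continuous_on UNIV (\<lambda>x. f (sq_dist q x))" if "smooth_on UNIV f" for f :: "real \<Rightarrow> real" and q :: 'a
    by (rule continuous_on_compose2[OF smooth_on_continuous[OF that] continuous_sq_dist]) auto
  obtain R0 where R0: "R0 \<ge> 0" "\<And>x. x \<in> K \<Longrightarrow> norm (x - q) \<le> R0"
  proof -
    have "bounded ((\<lambda>x. x - q) ` K)" using compact_imp_bounded[OF K(1)] by (simp add: bounded_translation_minus)
    then show ?thesis using that unfolding bounded_pos by (metis imageI less_imp_le)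
  qed
  define I where "I = {0..(R0 + 1)\<^sup>2}"
  obtain M where M: "\<And>s. s \<in> I \<Longrightarrow> \<bar>partial 1 \<eta> s\<bar> \<le> M"
    unfolding I_def
    by (rule continuous_on_Icc_bounded[OF smooth_on_UNIV_continuous[OF smooth_on_partial[OF \<eta>(1)]]]) auto
  obtain B0 where B0: "\<And>s. s \<in> I \<Longrightarrow> \<bar>\<eta> s\<bar> \<le> B0"
    unfolding I_def by (rule continuous_on_Icc_bounded[OF smooth_on_UNIV_continuous[OF \<eta>(1)]]) blast+
  define C where "C = M * (2 * R0 + 1)\<^sup>2 + B0"
  define J where "J = (LINT x|lborel. w x * (- 2 * ((x - q) \<bullet> e) * \<eta> (sq_dist q x)))"
  have cJ: "continuous_on UNIV (\<lambda>x. - 2 * ((x - q) \<bullet> e) * \<eta> (sq_dist q x))"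
    by (intro continuous_intros c\<eta>[OF \<eta>(1)])
  have int_w: "integrable lborel (\<lambda>x. w x * f x)" if "continuous_on UNIV f" for f
    by (rule integrable_mult_continuous[OF w K that])
  define W where "W = (LINT x|lborel. \<bar>w x\<bar>)"
  obtain \<delta> where \<delta>: "\<delta> > 0" "ball q \<delta> \<subseteq> V" using V q open_contains_ball by blast
  have bound: "\<bar>J\<bar> \<le> W * C * h" if h: "0 < h" "h < min \<delta> 1" for h
  proof -
    have qh: "q + h *\<^sub>R e \<in> V" using h \<delta> e by (auto simp: subset_iff dist_norm)
    have pw: "\<bar>\<eta>1 (sq_dist (q + h *\<^sub>R e) x) - \<eta>1 (sq_dist q x) - h * (- 2 * ((x - q) \<bullet> e) * \<eta> (sq_dist q x))\<bar> \<le> C * h\<^sup>2"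
      if x: "x \<in> K" for x
    proof -
      define s where "s = sq_dist q x"
      define s' where "s' = sq_dist (q + h *\<^sub>R e) x"
      define i where "i = (x - q) \<bullet> e"
      have ee: "e \<bullet> e = 1" using e by (simp add: inner_Basis)
      have s': "s' = s - 2 * h * i + h\<^sup>2"
        unfolding s'_def s_def i_def sq_dist_def
        by (simp add: inner_diff_left inner_diff_right inner_add_left inner_add_right inner_commute ee power2_eq_square algebra_simps)
      have i: "\<bar>i\<bar> \<le> R0" unfolding i_def
        using Basis_le_norm[OF e, of "x - q"] R0(2)[OF x] by simp
      have sI: "s \<in> I"
      proof -
        have "norm (x - q) ^ 2 \<le> (R0 + 1)\<^sup>2" using R0(2)[OF x] by (intro power_mono) auto
        then show ?thesis by (simp add: I_def s_def sq_dist_def dot_square_norm)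
      qed
      have s'I: "s' \<in> I"
      proof -
        have "norm (x - (q + h *\<^sub>R e)) \<le> R0 + 1"
          using norm_triangle_ineq4[of "x - q" "h *\<^sub>R e"] R0(2)[OF x] h e by (simp add: algebra_simps)
        then have "norm (x - (q + h *\<^sub>R e)) ^ 2 \<le> (R0 + 1)\<^sup>2" by (intro power_mono) auto
        then show ?thesis by (simp add: I_def s'_def sq_dist_def dot_square_norm)
      qed
      have d: "\<bar>s' - s\<bar> \<le> (2 * R0 + 1) * h"
      proof -
        have "s' - s = h * (h - 2 * i)" by (simp add: s' power2_eq_square algebra_simps)
        then have "\<bar>s' - s\<bar> = h * \<bar>h - 2 * i\<bar>" using h by (simp add: abs_mult)
        also have "\<dots> \<le> h * (2 * R0 + 1)" using i h by (intro mult_left_mono) auto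
        finally show ?thesis by (simp add: mult.commute)
      qed
      have M0: "M \<ge> 0" using M[OF sI] by linarith
      have "\<bar>\<eta>1 s' - \<eta>1 s - \<eta> s * (s' - s)\<bar> \<le> M * (s' - s)\<^sup>2"
        by (rule second_order_bound[where S = I, OF \<eta>1(1) smooth_on_has_real_derivative[OF open_UNIV \<eta>(1) UNIV_I] M _ s'I sI])
          (use sI s'I in \<open>auto simp: I_def\<close>)
      also have "\<dots> \<le> M * ((2 * R0 + 1) * h)\<^sup>2"
        using d M0 h R0(1) by (intro mult_left_mono) (auto simp: abs_le_square_iff[symmetric] abs_mult)
      finally have 1: "\<bar>\<eta>1 s' - \<eta>1 s - \<eta> s * (s' - s)\<bar> \<le> M * (2 * R0 + 1)\<^sup>2 * h\<^sup>2"
        by (simp add: power_mult_distrib)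
      have 2: "\<bar>\<eta> s * h\<^sup>2\<bar> \<le> B0 * h\<^sup>2"
        using B0[OF sI] by (simp add: abs_mult mult_right_mono)
      have "\<eta>1 s' - \<eta>1 s - h * (- 2 * i * \<eta> s) = (\<eta>1 s' - \<eta>1 s - \<eta> s * (s' - s)) + \<eta> s * h\<^sup>2"
        by (simp add: s' algebra_simps)
      then have "\<bar>\<eta>1 s' - \<eta>1 s - h * (- 2 * i * \<eta> s)\<bar> \<le> M * (2 * R0 + 1)\<^sup>2 * h\<^sup>2 + B0 * h\<^sup>2"
        using 1 2 by linarith
      then show ?thesis by (simp add: C_def s_def s'_def i_def algebra_simps)
    qed
    have i1: "integrable lborel (\<lambda>x. w x * \<eta>1 (sq_dist (q + h *\<^sub>R e) x))"
      "integrable lborel (\<lambda>x. w x * \<eta>1 (sq_dist q x))"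
      "integrable lborel (\<lambda>x. w x * (- 2 * ((x - q) \<bullet> e) * \<eta> (sq_dist q x)))"
      by (simp_all only: int_w[OF c\<eta>[OF s1]] int_w[OF cJ])
    have "h * J = - (LINT x|lborel. w x * \<eta>1 (sq_dist (q + h *\<^sub>R e) x) - w x * \<eta>1 (sq_dist q x)
        - h * (w x * (- 2 * ((x - q) \<bullet> e) * \<eta> (sq_dist q x))))"
      using i1 zero[OF s1 z1 q] zero[OF s1 z1 qh] by (simp add: J_def)
    also have "\<bar>\<dots>\<bar> \<le> (LINT x|lborel. \<bar>w x\<bar> * (C * h\<^sup>2))"
      unfolding abs_minus_cancel
    proof (rule order_trans[OF integral_abs_bound], rule integral_mono)
      show "integrable lborel (\<lambda>x. \<bar>w x * \<eta>1 (sq_dist (q + h *\<^sub>R e) x) - w x * \<eta>1 (sq_dist q x)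
        - h * (w x * (- 2 * ((x - q) \<bullet> e) * \<eta> (sq_dist q x)))\<bar>)"
        using i1 by (intro integrable_abs Bochner_Integration.integrable_diff integrable_mult_right) auto
      show "integrable lborel (\<lambda>x. \<bar>w x\<bar> * (C * h\<^sup>2))" using w by simp
      fix x
      have "w x * \<eta>1 (sq_dist (q + h *\<^sub>R e) x) - w x * \<eta>1 (sq_dist q x)
        - h * (w x * (- 2 * ((x - q) \<bullet> e) * \<eta> (sq_dist q x)))
        = w x * (\<eta>1 (sq_dist (q + h *\<^sub>R e) x) - \<eta>1 (sq_dist q x) - h * (- 2 * ((x - q) \<bullet> e) * \<eta> (sq_dist q x)))"
        by (simp add: algebra_simps)
      also have "\<bar>\<dots>\<bar> \<le> \<bar>w x\<bar> * (C * h\<^sup>2)"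
        using pw[of x] K(2)[of x] unfolding abs_mult by (cases "x \<in> K") (auto intro!: mult_left_mono)
      finally show "\<bar>w x * \<eta>1 (sq_dist (q + h *\<^sub>R e) x) - w x * \<eta>1 (sq_dist q x)
        - h * (w x * (- 2 * ((x - q) \<bullet> e) * \<eta> (sq_dist q x)))\<bar> \<le> \<bar>w x\<bar> * (C * h\<^sup>2)" .
    qed
    also have "\<dots> = h * (W * C * h)" by (simp add: W_def power2_eq_square)
    finally have "h * \<bar>J\<bar> \<le> h * (W * C * h)" using h by (simp add: abs_mult)
    then show ?thesis using h by simp
  qed
  have "J = 0"
  proof -
    have "((\<lambda>h. W * C * h) \<longlongrightarrow> W * C * 0) (at_right 0)" by (intro tendsto_intros)
    moreover have "\<forall>\<^sub>F h in at_right 0. \<bar>J\<bar> \<le> W * C * h"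
      unfolding eventually_at_right_field using bound \<delta>(1) by (intro exI[of _ "min \<delta> 1"]) auto
    ultimately have "\<bar>J\<bar> \<le> W * C * 0" by (intro tendsto_lowerbound) auto
    then show ?thesis by simp
  qed
  define A B where "A x = w x * (- 2 * ((x - q) \<bullet> e) * \<eta> (sq_dist q x))"
    and "B x = w x * \<eta> (sq_dist q x)" for x
  have AB: "integrable lborel A" "integrable lborel B" "integral\<^sup>L lborel B = 0" "integral\<^sup>L lborel A = 0"
    unfolding A_def[abs_def] B_def[abs_def]
    using int_w[OF cJ] int_w[OF c\<eta>[OF \<eta>(1)]] zero[OF \<eta> q] \<open>J = 0\<close> by (simp_all only: J_def)
  have "(LINT x|lborel. (w x * (x \<bullet> e)) * \<eta> (sq_dist q x)) = (LINT x|lborel. (- 1/2) * A x + (q \<bullet> e) * B x)"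
    by (intro Bochner_Integration.integral_cong) (auto simp: A_def B_def inner_diff_left algebra_simps)
  then show ?thesis using AB by simp
qed

text \<open>The functions with vanishing radial moments about all centres in \<open>V\<close> are closed under sums and under
multiplication by coordinates, hence form a module over the polynomials.\<close>

lemma radial_moments_times_polynomial:
  fixes w :: "'a::euclidean_space \<Rightarrow> real"
  assumes p: "real_polynomial_function p" and V: "open V"
    and w: "integrable lborel w" and K: "compact K" "\<And>x. x \<notin> K \<Longrightarrow> w x = 0"
    and zero: "\<And>\<eta> q. smooth_on UNIV \<eta> \<Longrightarrow> (\<And>s. s \<ge> S \<Longrightarrow> \<eta> s = 0) \<Longrightarrow> q \<in> V \<Longrightarrow>
      (LINT x|lborel. w x * \<eta> (sq_dist q x)) = 0"
    and \<eta>: "smooth_on UNIV \<eta>" "\<And>s. s \<ge> S \<Longrightarrow> \<eta> s = 0" and q: "q \<in> V"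
  shows "(LINT x|lborel. (w x * p x) * \<eta> (sq_dist q x)) = 0"
proof -
  define good where "good w \<longleftrightarrow> integrable lborel w \<and> (\<forall>x. x \<notin> K \<longrightarrow> w x = 0) \<and>
     (\<forall>\<eta> q. smooth_on UNIV \<eta> \<longrightarrow> (\<forall>s\<ge>S. \<eta> s = 0) \<longrightarrow> q \<in> V \<longrightarrow>
      (LINT x|lborel. w x * \<eta> (sq_dist q x)) = 0)" for w :: "'a \<Rightarrow> real"
  have c\<eta>: "continuous_on UNIV (\<lambda>x. f (sq_dist q x))" if "smooth_on UNIV f" for f :: "real \<Rightarrow> real" and q :: 'a
    by (rule continuous_on_compose2[OF smooth_on_continuous[OF that] continuous_sq_dist]) auto
  have good_add: "good (\<lambda>x. f x + g x)" if fg: "good f" "good g" for f g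
  proof -
    have "(LINT x|lborel. (f x + g x) * \<eta> (sq_dist q x)) = 0"
      if \<eta>: "smooth_on UNIV \<eta>" "\<forall>s\<ge>S. \<eta> s = 0" "q \<in> V" for \<eta> q
    proof -
      have "integrable lborel (\<lambda>x. f x * \<eta> (sq_dist q x))" "integrable lborel (\<lambda>x. g x * \<eta> (sq_dist q x))"
        using fg unfolding good_def by (auto intro!: integrable_mult_continuous[OF _ K(1)] c\<eta> \<eta>)
      then show ?thesis using fg \<eta> by (simp add: good_def distrib_right)
    qed
    then show ?thesis using fg by (simp add: good_def)
  qed
  have good_cmult: "good (\<lambda>x. f x * c)" if "good f" for f c
  proof -
    have "(LINT x|lborel. f x * c * \<eta> (sq_dist q x)) = 0"
      if \<eta>: "smooth_on UNIV \<eta>" "\<forall>s\<ge>S. \<eta> s = 0" "q \<in> V" for \<eta> q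
    proof -
      have "(LINT x|lborel. f x * c * \<eta> (sq_dist q x)) = (LINT x|lborel. c * (f x * \<eta> (sq_dist q x)))"
        by (simp add: mult_ac)
      then show ?thesis using \<open>good f\<close> \<eta> by (simp add: good_def)
    qed
    then show ?thesis using \<open>good f\<close> by (simp add: good_def)
  qed
  have good_coord: "good (\<lambda>x. f x * (x \<bullet> e))" if f: "good f" and e: "e \<in> Basis" for f e
    unfolding good_def
  proof (intro conjI allI impI)
    have f': "integrable lborel f" "\<And>x. x \<notin> K \<Longrightarrow> f x = 0" using f by (auto simp: good_def)
    show "integrable lborel (\<lambda>x. f x * (x \<bullet> e))"
      by (rule integrable_mult_continuous[OF f'(1) K(1) f'(2)]) (auto intro: continuous_intros)
    show "f x * (x \<bullet> e) = 0" if "x \<notin> K" for x using f'(2)[OF that] by simp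
    show "(LINT x|lborel. f x * (x \<bullet> e) * \<eta> (sq_dist q x)) = 0"
      if "smooth_on UNIV \<eta>" "\<forall>s\<ge>S. \<eta> s = 0" "q \<in> V" for \<eta> q
      by (rule radial_moments_times_coordinate[OF f'(1) K(1) f'(2) V e, where S = S])
        (use f that in \<open>auto simp: good_def\<close>)
  qed
  have good_0: "good (\<lambda>x. 0)" by (simp add: good_def)
  have good_sum: "good (\<lambda>x. \<Sum>i\<in>A. f i x)" if "finite A" "\<And>i. i \<in> A \<Longrightarrow> good (f i)"
    for A and f :: "'a \<Rightarrow> 'a \<Rightarrow> real"
    using that by (induction A rule: finite_induct) (auto intro: good_0 good_add)
  have "\<forall>f. good f \<longrightarrow> good (\<lambda>x. f x * p x)"
    using p
  proof (induction rule: real_polynomial_function.induct)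
    case (linear l)
    show ?case
    proof (intro allI impI)
      fix f :: "'a \<Rightarrow> real" assume "good f"
      then have "good (\<lambda>x. \<Sum>b\<in>Basis. f x * (x \<bullet> b) * l b)"
        by (intro good_sum good_cmult good_coord) auto
      moreover have "(\<Sum>b\<in>Basis. f x * (x \<bullet> b) * l b) = f x * l x" for x
      proof -
        have "l x = l (\<Sum>b\<in>Basis. (x \<bullet> b) *\<^sub>R b)" by (simp add: euclidean_representation)
        also have "\<dots> = (\<Sum>b\<in>Basis. (x \<bullet> b) * l b)"
          using linear by (simp add: linear_sum[OF bounded_linear.linear] linear_cmul[OF bounded_linear.linear])
        finally show ?thesis by (simp add: sum_distrib_left mult.assoc)
      qed
      ultimately show "good (\<lambda>x. f x * l x)" by simp
    qed
  next
    case (mult g h)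
    show ?case
    proof (intro allI impI)
      fix f assume "good f"
      then have "good (\<lambda>x. f x * g x * h x)" using mult by blast
      then show "good (\<lambda>x. f x * (g x * h x))" by (simp add: mult.assoc)
    qed
  next
    case (const c)
    show ?case using good_cmult by blast
  next
    case (add g h)
    show ?case
    proof (intro allI impI)
      fix f assume "good f"
      then have "good (\<lambda>x. f x * g x + f x * h x)" using add by (intro good_add) auto
      then show "good (\<lambda>x. f x * (g x + h x))" by (simp add: distrib_left)
    qed
  qed
  moreover have "good w" using w K zero by (simp add: good_def)
  ultimately show ?thesis using \<eta> q by (simp add: good_def)
qed

text \<open>Radial integrals of \<open>f\<close> vanish for all centres close to \<open>p\<close>, so all moments of \<open>f\<close> against a positive
radial weight on the ball of radius \<open>R/2\<close> vanish. The radius is halved to leave room for the centres to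
move; what matters is that the new radius does not depend on \<open>\<sigma>\<close>.\<close>

lemma weak_helmholtz_zero_on_larger_ball:
  fixes f :: "'a::euclidean_space \<Rightarrow> real"
  assumes weak: "weak_helmholtz U m f" and U: "open U" and bU: "bounded U" and ball: "cball p R \<subseteq> U"
    and \<sigma>: "0 < \<sigma>" "\<sigma> < R" and zero: "AE x in lborel. x \<in> ball p \<sigma> \<longrightarrow> f x = 0"
  shows "AE x in lborel. x \<in> ball p (R/2) \<longrightarrow> f x = 0"
proof -
  define w where "w x = indicator U x * f x" for x
  define S where "S = (R/2)\<^sup>2"
  have w: "integrable lborel w" using weak by (simp add: weak_helmholtz_def set_integrable_def w_def[abs_def])
  have K: "compact (closure U)" using bU by simp
  have wK: "w x = 0" if "x \<notin> closure U" for x using that closure_subset[of U] by (auto simp: w_def indicator_def)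
  have rad: "(LINT x|lborel. w x * \<eta> (sq_dist q x)) = 0"
    if \<eta>: "smooth_on UNIV \<eta>" "\<And>s. s \<ge> S \<Longrightarrow> \<eta> s = 0" and q: "q \<in> ball p (\<sigma>/2)" for \<eta> q
  proof -
    have "(LINT x:U|lborel. f x * \<eta> (sq_dist q x)) = 0"
    proof (rule weak_helmholtz_radial_zero[OF weak U, where \<rho> = "R/2" and \<sigma> = "\<sigma>/2"])
      have "cball q (R/2) \<subseteq> cball p R"
        using q \<sigma> by (intro cball_subset_cball_iff[THEN iffD2] disjI1) (auto simp: dist_commute)
      then show "cball q (R/2) \<subseteq> U" using ball by blast
      have "ball q (\<sigma>/2) \<subseteq> ball p \<sigma>"
        using q \<sigma> by (intro ball_subset_ball_iff[THEN iffD2] disjI1) (auto simp: dist_commute)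
      then show "AE x in lborel. x \<in> ball q (\<sigma>/2) \<longrightarrow> f x = 0"
        using zero by (rule_tac eventually_mono) blast+
    qed (use \<sigma> \<eta> in \<open>auto simp: S_def\<close>)
    then show ?thesis by (simp add: set_lebesgue_integral_def w_def mult.assoc)
  qed
  define \<eta> where "\<eta> s = half_bump ((-1) * s + S)" for s
  have \<eta>: "smooth_on UNIV \<eta>" "\<And>s. s \<ge> S \<Longrightarrow> \<eta> s = 0" "\<And>s. s < S \<Longrightarrow> \<eta> s > 0"
    unfolding \<eta>_def by (rule smooth_half_bump_affine, auto intro!: half_bump)
  have c\<eta>: "continuous_on UNIV (\<lambda>x. \<eta> (sq_dist p x))"
    by (rule continuous_on_compose2[OF smooth_on_continuous[OF \<eta>(1)] continuous_sq_dist]) auto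
  have "AE x in lborel. w x * \<eta> (sq_dist p x) = 0"
  proof (rule AE_zero_if_moments_zero[OF _ K])
    show "integrable lborel (\<lambda>x. w x * \<eta> (sq_dist p x))"
      by (rule integrable_mult_continuous[OF w K wK c\<eta>])
    show "w x * \<eta> (sq_dist p x) = 0" if "x \<notin> closure U" for x using wK[OF that] by simp
    fix P :: "'a \<Rightarrow> real" assume P: "real_polynomial_function P"
    have "(LINT x|lborel. w x * P x * \<eta> (sq_dist p x)) = 0"
      by (rule radial_moments_times_polynomial[OF P _ w K wK rad \<eta>(1,2), where V = "ball p (\<sigma>/2)"]) (use \<sigma> in auto)
    then show "(LINT x|lborel. w x * \<eta> (sq_dist p x) * P x) = 0" by (simp add: mult_ac)
  qed
  then show ?thesis
  proof eventually_elim
    case (elim x)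
    show ?case
    proof
      assume x: "x \<in> ball p (R/2)"
      then have "sq_dist p x < S" using sq_dist_less_iff[of "R/2" p x] \<sigma> by (simp add: S_def)
      then have "w x = 0" using elim \<eta>(3)[of "sq_dist p x"] by simp
      moreover have "x \<in> U" using x ball \<sigma> by (auto simp: subset_iff)
      ultimately show "f x = 0" by (simp add: w_def)
    qed
  qed
qed

text \<open>Points near which \<open>f\<close> vanishes form an open set, and they cannot accumulate at another point of \<open>U\<close>,
because from a nearby point the zero set spreads over a ball of definite radius.\<close>

theorem weak_helmholtz_unique_continuation:
  fixes f :: "'a::euclidean_space \<Rightarrow> real"
  assumes weak: "weak_helmholtz U m f" and U: "open U" "connected U" "bounded U"
    and W: "open W" "W \<noteq> {}" "W \<subseteq> U" and zero: "AE x in lborel. x \<in> W \<longrightarrow> f x = 0"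
  shows "AE x in lborel. x \<in> U \<longrightarrow> f x = 0"
proof -
  define Z where "Z = {x\<in>U. \<exists>r>0. AE y in lborel. y \<in> ball x r \<longrightarrow> f y = 0}"
  have Z_ball: "z \<in> Z" if x: "z \<in> ball x r" and ae: "AE y in lborel. y \<in> ball x r \<longrightarrow> f y = 0" and "z \<in> U" for x z r
  proof -
    obtain d where d: "d > 0" "ball z d \<subseteq> ball x r" using openE[OF open_ball x] by blast
    have "AE y in lborel. y \<in> ball z d \<longrightarrow> f y = 0" using ae by eventually_elim (use d in blast)
    then show ?thesis using d \<open>z \<in> U\<close> unfolding Z_def by blast
  qed
  have "open Z"
    unfolding open_contains_ball
  proof
    fix x assume "x \<in> Z"
    then obtain r where r: "r > 0" "AE y in lborel. y \<in> ball x r \<longrightarrow> f y = 0" "x \<in> U" by (auto simp: Z_def)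
    obtain d where d: "d > 0" "ball x d \<subseteq> U" using U(1) r(3) open_contains_ball by blast
    have "ball x (min r d) \<subseteq> Z"
    proof
      fix z assume "z \<in> ball x (min r d)"
      then show "z \<in> Z" using Z_ball[OF _ r(2), of z] d(2) by auto
    qed
    then show "\<exists>e>0. ball x e \<subseteq> Z" using r d by (intro exI[of _ "min r d"]) auto
  qed
  moreover have "open (U - Z)"
    unfolding open_contains_ball
  proof
    fix x assume x: "x \<in> U - Z"
    then obtain R0 where R0: "R0 > 0" "cball x R0 \<subseteq> U" using U(1) open_contains_cball[of U] by blast
    define R where "R = R0 / 2"
    have R: "R > 0" "cball x (2 * R) \<subseteq> U" using R0 by (auto simp: R_def)
    have "z \<notin> Z" if z: "z \<in> ball x (R/2)" for z
    proof
      assume "z \<in> Z"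
      then obtain r where r: "r > 0" "AE y in lborel. y \<in> ball z r \<longrightarrow> f y = 0" by (auto simp: Z_def)
      define \<sigma> where "\<sigma> = min r (R/2)"
      have "AE y in lborel. y \<in> ball z \<sigma> \<longrightarrow> f y = 0"
        using r(2) by eventually_elim (auto simp: \<sigma>_def)
      moreover have "cball z R \<subseteq> U"
      proof -
        have "cball z R \<subseteq> cball x (2 * R)"
          using z R by (intro cball_subset_cball_iff[THEN iffD2] disjI1) (auto simp: dist_commute)
        then show ?thesis using R by blast
      qed
      ultimately have "AE y in lborel. y \<in> ball z (R/2) \<longrightarrow> f y = 0"
        using weak_helmholtz_zero_on_larger_ball[OF weak U(1,3), of z R \<sigma>] r(1) R(1) by (auto simp: \<sigma>_def)
      then have "x \<in> Z" using z x by (intro Z_ball[of x z "R/2"]) (auto simp: dist_commute)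
      then show False using x by simp
    qed
    moreover have "ball x (R/2) \<subseteq> U" using R by (auto simp: subset_iff)
    ultimately have "ball x (R/2) \<subseteq> U - Z" by blast
    then show "\<exists>e>0. ball x e \<subseteq> U - Z" using R(1) by (intro exI[of _ "R/2"]) auto
  qed
  moreover have "Z \<noteq> {}"
  proof -
    obtain x where x: "x \<in> W" using W by blast
    then obtain r where r: "r > 0" "ball x r \<subseteq> W" using W(1) open_contains_ball by blast
    have "AE y in lborel. y \<in> ball x r \<longrightarrow> f y = 0" using zero by eventually_elim (use r in auto)
    then have "x \<in> Z" using x r W unfolding Z_def by blast
    then show ?thesis by blast
  qed
  ultimately have ZU: "Z = U"
    using connectedD[OF U(2), of Z "U - Z"] unfolding Z_def by blast
  then have "\<forall>x\<in>U. \<exists>r>0. AE y in lborel. y \<in> ball x r \<longrightarrow> f y = 0" unfolding Z_def by blast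
  then obtain r where r: "\<And>x. x \<in> U \<Longrightarrow> r x > 0" "\<And>x. x \<in> U \<Longrightarrow> AE y in lborel. y \<in> ball x (r x) \<longrightarrow> f y = 0"
    by metis
  \<comment> \<open>Passing from local null sets to one null set needs a countable cover.\<close>
  obtain \<F> where \<F>: "\<F> \<subseteq> (\<lambda>x. ball x (r x)) ` U" "countable \<F>" "\<Union>\<F> = \<Union>((\<lambda>x. ball x (r x)) ` U)"
    by (rule Lindelof[of "(\<lambda>x. ball x (r x)) ` U"]) auto
  have "AE y in lborel. \<forall>B\<in>\<F>. y \<in> B \<longrightarrow> f y = 0"
    using \<F> r(2) by (subst AE_ball_countable) auto
  then show ?thesis
  proof eventually_elim
    case (elim y)
    show ?case
    proof
      assume "y \<in> U"
      then have "y \<in> \<Union>((\<lambda>x. ball x (r x)) ` U)" using r(1) by (auto intro!: bexI[of _ y])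
      then show "f y = 0" using elim \<F>(3) by blast
    qed
  qed
qed

section \<open>Oscillation of solutions of a Sturm--Liouville equation\<close>

text \<open>\<open>u'' = - Q u\<close> on \<open>[0, H]\<close> with \<open>v = u'\<close>; since \<open>Q\<close> is only bounded and measurable, the
equation for \<open>v\<close> is understood in integrated form.\<close>

definition sturm_solution :: "real \<Rightarrow> (real \<Rightarrow> real) \<Rightarrow> (real \<Rightarrow> real) \<Rightarrow> (real \<Rightarrow> real) \<Rightarrow> bool" where
  "sturm_solution H Q u v \<longleftrightarrow>
     (\<forall>y\<in>{0..H}. (u has_real_derivative v y) (at y within {0..H})) \<and>
     lip_primitive 0 H v (\<lambda>y. - (Q y * u y))"

lemma sturm_solution_continuous:
  assumes "sturm_solution H Q u v"
  shows "continuous_on {0..H} u" "continuous_on {0..H} v"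
  using assms unfolding sturm_solution_def by (blast intro: DERIV_continuous_on lip_primitive_continuous)+

lemma sturm_solution_integrals:
  assumes "sturm_solution H Q u v" "0 \<le> s" "s \<le> t" "t \<le> H"
  shows "(v has_integral u t - u s) {s..t}" "((\<lambda>y. Q y * u y) has_integral v s - v t) {s..t}"
proof -
  have "lip_primitive 0 H u v"
    using assms(1) sturm_solution_continuous(2)[OF assms(1)]
    by (intro lip_primitive_C1) (auto simp: sturm_solution_def)
  then show "(v has_integral u t - u s) {s..t}" using assms by (intro lip_primitiveD)
  have "((\<lambda>y. - (Q y * u y)) has_integral v t - v s) {s..t}"
    using assms by (intro lip_primitiveD) (auto simp: sturm_solution_def)
  from has_integral_neg[OF this] show "((\<lambda>y. Q y * u y) has_integral v s - v t) {s..t}" by simp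
qed

lemma sturm_solution_uminus:
  assumes "sturm_solution H Q u v" shows "sturm_solution H Q (\<lambda>y. - u y) (\<lambda>y. - v y)"
  using assms lip_primitive_cmult[of 0 H v "\<lambda>y. - (Q y * u y)" "-1"]
  by (auto simp: sturm_solution_def intro!: derivative_eq_intros)

lemma has_integral_ge_const:
  fixes f :: "real \<Rightarrow> real"
  assumes "(f has_integral I) {s..t}" "s \<le> t" "\<And>y. y \<in> {s..t} \<Longrightarrow> B \<le> f y"
  shows "B * (t - s) \<le> I"
  using has_integral_le[OF has_integral_const_real[of B s t] assms(1)] assms(2,3) by (simp add: mult.commute)

text \<open>Where \<open>v\<close> keeps a sign, \<open>u\<close> is monotone and hence far from zero on half of the interval; there
\<open>|v|\<close> decreases so fast that it would have to change sign.\<close>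

lemma sturm_critical_point:
  assumes sol: "sturm_solution H Q u v" and Q: "\<And>y. y \<in> {0..H} \<Longrightarrow> k \<le> Q y" and k: "k > 0"
    and s: "0 \<le> s" "s + l \<le> H" and l: "l > 0" "16 \<le> k * l\<^sup>2"
  shows "\<exists>t\<in>{s..s+l}. v t = 0"
proof -
  have no_pos: False if sol: "sturm_solution H Q u v" and pos: "\<And>t. t \<in> {s..s+l} \<Longrightarrow> v t > 0" for u v
  proof -
    have mono: "u x \<le> u y" if "s \<le> x" "x \<le> y" "y \<le> s + l" for x y
    proof -
      have "0 * (y - x) \<le> u y - u x"
        by (rule has_integral_ge_const[OF sturm_solution_integrals(1)[OF sol]])
          (use that s pos in \<open>auto intro: less_imp_le\<close>)
      then show ?thesis by simp
    qed
    \<comment> \<open>On the half where \<open>|u|\<close> grows, one quarter of the interval makes \<open>|u|\<close> large and the other one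
       makes \<open>v\<close> vanish.\<close>
    have Q0: "0 \<le> Q y" if "y \<in> {0..H}" for y using Q[OF that] k by linarith
    have q: "k * (l/4) * (l/4) \<ge> 1" using l by (simp add: power2_eq_square)
    show False
    proof (cases "u (s + l/2) \<ge> 0")
      case True
      have nonneg: "u y \<ge> 0" if "s + l/2 \<le> y" "y \<le> s + l" for y
        using mono[of "s + l/2" y] that True l by auto
      have anti: "v y \<le> v x" if "s + l/2 \<le> x" "x \<le> y" "y \<le> s + l" for x y
      proof -
        have "0 * (y - x) \<le> v x - v y"
          by (rule has_integral_ge_const[OF sturm_solution_integrals(2)[OF sol]])
            (use that s l Q0 nonneg in \<open>auto intro!: mult_nonneg_nonneg\<close>)
        then show ?thesis by simp
      qed
      define n where "n = s + l/2 + l/4"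
      have "v n * (n - (s + l/2)) \<le> u n - u (s + l/2)"
        by (rule has_integral_ge_const[OF sturm_solution_integrals(1)[OF sol]])
          (use s l anti in \<open>auto simp: n_def\<close>)
      then have un: "v n * (l/4) \<le> u n" using True by (simp add: n_def)
      have "k * u n * (s + l - n) \<le> v n - v (s + l)"
      proof (rule has_integral_ge_const[OF sturm_solution_integrals(2)[OF sol]])
        fix y assume y: "y \<in> {n..s+l}"
        then show "k * u n \<le> Q y * u y"
          using s l Q[of y] mono[of n y] nonneg[of n] k by (intro mult_mono) (auto simp: n_def)
      qed (use s l in \<open>auto simp: n_def\<close>)
      moreover have "k * (v n * (l/4)) * (l/4) \<le> k * u n * (l/4)"
        using un k l by (intro mult_right_mono mult_left_mono) auto
      moreover have "v n * 1 \<le> v n * (k * (l/4) * (l/4))"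
        using q pos[of n] l by (intro mult_left_mono) (auto simp: n_def intro: less_imp_le)
      ultimately have "v (s + l) \<le> 0" by (simp add: n_def algebra_simps)
      then show False using pos[of "s + l"] l by simp
    next
      case False
      have neg: "u y \<le> 0" if "s \<le> y" "y \<le> s + l/2" for y
        using mono[of y "s + l/2"] that False l by auto
      have incr: "v x \<le> v y" if "s \<le> x" "x \<le> y" "y \<le> s + l/2" for x y
      proof -
        have "((\<lambda>y. Q y * (- u y)) has_integral - v x - - v y) {x..y}"
          by (rule sturm_solution_integrals(2)[OF sturm_solution_uminus[OF sol]]) (use that s l in auto)
        then have "0 * (y - x) \<le> - v x - - v y"
          by (rule has_integral_ge_const)
            (use that s l Q0 neg in \<open>auto intro!: mult_nonneg_nonpos\<close>)
        then show ?thesis by simp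
      qed
      define n where "n = s + l/4"
      have "v n * ((s + l/2) - n) \<le> u (s + l/2) - u n"
        by (rule has_integral_ge_const[OF sturm_solution_integrals(1)[OF sol]])
          (use s l incr in \<open>auto simp: n_def\<close>)
      then have un: "v n * (l/4) \<le> - u n" using False by (simp add: n_def)
      have "((\<lambda>y. Q y * (- u y)) has_integral - v s - - v n) {s..n}"
        by (rule sturm_solution_integrals(2)[OF sturm_solution_uminus[OF sol]]) (use s l in \<open>auto simp: n_def\<close>)
      then have "k * (- u n) * (n - s) \<le> - v s - - v n"
      proof (rule has_integral_ge_const)
        fix y assume y: "y \<in> {s..n}"
        then show "k * (- u n) \<le> Q y * (- u y)"
          using s l Q[of y] mono[of y n] neg[of n] k by (intro mult_mono) (auto simp: n_def)
      qed (use s l in \<open>auto simp: n_def\<close>)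
      moreover have "k * (v n * (l/4)) * (l/4) \<le> k * (- u n) * (l/4)"
        using un k l by (intro mult_right_mono mult_left_mono) auto
      moreover have "v n * 1 \<le> v n * (k * (l/4) * (l/4))"
        using q pos[of n] l by (intro mult_left_mono) (auto simp: n_def intro: less_imp_le)
      ultimately have "v s \<le> 0" by (simp add: n_def algebra_simps)
      then show False using pos[of s] l by simp
    qed
  qed
  show ?thesis
  proof (rule ccontr)
    assume "\<not> ?thesis"
    then have nz: "\<And>t. t \<in> {s..s+l} \<Longrightarrow> v t \<noteq> 0" by blast
    have cv: "continuous_on {s..s+l} v"
      using sturm_solution_continuous(2)[OF sol] by (rule continuous_on_subset) (use s l in auto)
    have "connected (v ` {s..s+l})" by (intro connected_continuous_image cv) simp
    then have iv: "is_interval (v ` {s..s+l})" by (simp add: is_interval_connected_1)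
    have "(\<forall>t\<in>{s..s+l}. v t > 0) \<or> (\<forall>t\<in>{s..s+l}. v t < 0)"
    proof (rule ccontr)
      assume "\<not> ?thesis"
      then obtain t1 t2 where t: "t1 \<in> {s..s+l}" "t2 \<in> {s..s+l}" "v t1 \<le> 0" "v t2 \<ge> 0"
        by (meson linorder_not_less)
      then have "0 \<in> v ` {s..s+l}"
        using iv[unfolded is_interval_1, rule_format, of "v t1" "v t2" 0] by blast
      then show False using nz by auto
    qed
    then show False
      using no_pos[OF sol] no_pos[OF sturm_solution_uminus[OF sol]] by force
  qed
qed

text \<open>Near a critical point \<open>u\<close> changes only to second order: if \<open>B\<close> is the maximum of \<open>|u|\<close> on the interval,
then \<open>|v| \<le> M B \<delta>\<close> and the total change of \<open>u\<close> is at most \<open>M B \<delta>\<^sup>2 \<le> B/4\<close>.\<close>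

lemma sturm_bulk_near_critical_point:
  assumes sol: "sturm_solution H Q u v" and Q: "\<And>y. y \<in> {0..H} \<Longrightarrow> \<bar>Q y\<bar> \<le> M"
    and t0: "0 \<le> t0" "t0 + \<delta> \<le> H" "v t0 = 0" and \<delta>: "\<delta> \<ge> 0" "M * \<delta>\<^sup>2 \<le> 1/4" and y: "y \<in> {t0..t0+\<delta>}"
  shows "\<bar>u t0\<bar> / 2 \<le> \<bar>u y\<bar>"
proof -
  have "continuous_on {t0..t0+\<delta>} (\<lambda>y. \<bar>u y\<bar>)"
    by (intro continuous_intros continuous_on_subset[OF sturm_solution_continuous(1)[OF sol]]) (use t0 in auto)
  then obtain m where m: "m \<in> {t0..t0+\<delta>}" "\<And>y. y \<in> {t0..t0+\<delta>} \<Longrightarrow> \<bar>u y\<bar> \<le> \<bar>u m\<bar>"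
    using continuous_attains_sup[of "{t0..t0+\<delta>}" "\<lambda>y. \<bar>u y\<bar>"] \<delta> by auto
  define B where "B = \<bar>u m\<bar>"
  have M0: "M \<ge> 0" using Q[of t0] t0 \<delta> by auto
  have v: "\<bar>v y\<bar> \<le> M * B * \<delta>" if y: "y \<in> {t0..t0+\<delta>}" for y
  proof -
    have "norm (v t0 - v y) \<le> (M * B) * measure lborel {t0..y}"
    proof (rule has_integral_bound_real[of _ "{}"])
      show "((\<lambda>y. Q y * u y) has_integral v t0 - v y) {t0..y}"
        by (rule sturm_solution_integrals(2)[OF sol]) (use y t0 in auto)
      show "norm (Q z * u z) \<le> M * B" if "z \<in> {t0..y} - {}" for z
        using that y t0 Q[of z] m(2)[of z] M0 by (auto simp: abs_mult B_def intro!: mult_mono)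
    qed (use M0 in \<open>auto simp: B_def\<close>)
    also have "\<dots> \<le> M * B * \<delta>" using y M0 by (intro mult_left_mono) (auto simp: B_def)
    finally show ?thesis using t0(3) by simp
  qed
  have u: "\<bar>u y - u t0\<bar> \<le> B / 4" if y: "y \<in> {t0..t0+\<delta>}" for y
  proof -
    have "norm (u y - u t0) \<le> (M * B * \<delta>) * measure lborel {t0..y}"
    proof (rule has_integral_bound_real[of _ "{}"])
      show "(v has_integral u y - u t0) {t0..y}"
        by (rule sturm_solution_integrals(1)[OF sol]) (use y t0 in auto)
    qed (use y v M0 \<delta> in \<open>auto simp: B_def\<close>)
    also have "\<dots> \<le> M * B * \<delta> * \<delta>" using y M0 \<delta> by (intro mult_left_mono) (auto simp: B_def)
    also have "\<dots> = (M * \<delta>\<^sup>2) * B" by (simp add: power2_eq_square)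
    also have "\<dots> \<le> 1/4 * B" using \<delta> by (intro mult_right_mono) (auto simp: B_def)
    finally show ?thesis by simp
  qed
  have "B \<le> \<bar>u t0\<bar> + B / 4" using u[OF m(1)] unfolding B_def by linarith
  then show ?thesis using u[OF y] by linarith
qed

lemma integral_mono_subinterval:
  fixes f :: "real \<Rightarrow> real"
  assumes "continuous_on {a..b} f" "\<And>y. y \<in> {a..b} \<Longrightarrow> 0 \<le> f y" "a \<le> s" "s \<le> t" "t \<le> b"
    and "\<And>y. y \<in> {s..t} \<Longrightarrow> B \<le> f y"
  shows "B * (t - s) \<le> integral {a..b} f"
proof -
  have "B * (t - s) \<le> integral {s..t} f"
    by (rule has_integral_ge_const[OF integrable_integral])
      (use assms in \<open>auto intro!: integrable_continuous_real intro: continuous_on_subset\<close>)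
  also have "\<dots> \<le> integral {a..b} f"
    by (rule integral_subset_le)
      (use assms in \<open>auto intro!: integrable_continuous_real intro: continuous_on_subset\<close>)
  finally show ?thesis .
qed

text \<open>At a critical point the amplitude is carried by \<open>u\<close> alone. Each of the disjoint windows of length
\<open>l + \<delta>\<close> contains a critical point followed by an interval of length \<open>\<delta>\<close> on which \<open>u\<^sup>2 \<ge> A/4\<close>.\<close>

lemma sturm_mass_high_frequency:
  assumes sol: "sturm_solution H Q u v" and Q: "\<And>y. y \<in> {0..H} \<Longrightarrow> k \<le> Q y \<and> Q y \<le> M" and k: "k > 0"
    and amp: "\<And>y. y \<in> {0..H} \<Longrightarrow> A \<le> (u y)\<^sup>2 + (v y)\<^sup>2" "A \<ge> 0"
    and l: "l > 0" "16 \<le> k * l\<^sup>2" and \<delta>: "\<delta> > 0" "M * \<delta>\<^sup>2 \<le> 1/4"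
    and ab: "0 \<le> a" "b \<le> H" "l + \<delta> \<le> b - a"
  shows "(b - a) / 2 * (\<delta> / (l + \<delta>)) * (A / 4) \<le> integral {a..b} (\<lambda>y. (u y)\<^sup>2)"
proof -
  define L where "L = l + \<delta>"
  have L: "L > 0" using l \<delta> by (simp add: L_def)
  have cu: "continuous_on S (\<lambda>y. (u y)\<^sup>2)" if "S \<subseteq> {0..H}" for S
    by (intro continuous_intros continuous_on_subset[OF sturm_solution_continuous(1)[OF sol]] that)
  have one: "\<delta> * (A / 4) \<le> integral {s..s+L} (\<lambda>y. (u y)\<^sup>2)" if s: "0 \<le> s" "s + L \<le> H" for s
  proof -
    obtain t where t: "t \<in> {s..s+l}" "v t = 0"
      using sturm_critical_point[OF sol _ k, of s l] Q s l \<delta> by (auto simp: L_def)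
    have tA: "A \<le> (u t)\<^sup>2" using amp(1)[of t] t s \<delta> by (auto simp: L_def)
    have "A / 4 * (t + \<delta> - t) \<le> integral {s..s+L} (\<lambda>y. (u y)\<^sup>2)"
    proof (rule integral_mono_subinterval)
      fix y assume y: "y \<in> {t..t+\<delta>}"
      have "\<bar>u t\<bar> / 2 \<le> \<bar>u y\<bar>"
      proof (rule sturm_bulk_near_critical_point[OF sol _ _ _ t(2) _ \<delta>(2) y])
        show "\<bar>Q y\<bar> \<le> M" if "y \<in> {0..H}" for y using Q[OF that] k by auto
      qed (use t s \<delta> in \<open>auto simp: L_def\<close>)
      then have "(\<bar>u t\<bar> / 2)\<^sup>2 \<le> \<bar>u y\<bar>\<^sup>2" by (intro power_mono) auto
      then show "A / 4 \<le> (u y)\<^sup>2" using tA by (simp add: power_divide)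
    qed (use s t \<delta> in \<open>auto simp: L_def intro!: cu\<close>)
    then show ?thesis by (simp add: mult.commute)
  qed
  have many: "real N * (\<delta> * (A / 4)) \<le> integral {a..a + real N * L} (\<lambda>y. (u y)\<^sup>2)" if "a + real N * L \<le> H" for N
    using that
  proof (induction N)
    case (Suc N)
    have le: "a + real N * L \<le> a + real (Suc N) * L" "0 \<le> a + real N * L" using L ab by (auto simp: algebra_simps)
    have eq: "a + real (Suc N) * L = (a + real N * L) + L" by (simp add: algebra_simps)
    have "integral {a..a + real N * L} (\<lambda>y. (u y)\<^sup>2) + integral {a + real N * L..a + real (Suc N) * L} (\<lambda>y. (u y)\<^sup>2)
      = integral {a..a + real (Suc N) * L} (\<lambda>y. (u y)\<^sup>2)"
      by (rule Henstock_Kurzweil_Integration.integral_combine)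
        (use le ab L Suc.prems in \<open>auto intro!: integrable_continuous_real cu\<close>)
    moreover have "\<delta> * (A / 4) \<le> integral {a + real N * L..a + real (Suc N) * L} (\<lambda>y. (u y)\<^sup>2)"
      unfolding eq by (rule one) (use le Suc.prems eq in auto)
    ultimately show ?case using Suc le by (simp add: algebra_simps)
  qed simp
  define N where "N = nat \<lfloor>(b - a) / L\<rfloor>"
  have q1: "(b - a) / L \<ge> 1" using ab L by (simp add: L_def)
  have N: "real N \<le> (b - a) / L" "(b - a) / L / 2 \<le> real N"
  proof -
    define z where "z = (b - a) / L"
    have z: "1 \<le> \<lfloor>z\<rfloor>" using q1 by (simp add: z_def le_floor_iff)
    then have "real N = of_int \<lfloor>z\<rfloor>" "of_int \<lfloor>z\<rfloor> \<ge> (1::real)" by (simp_all add: N_def z_def)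
    then have "real N \<le> z" "z / 2 \<le> real N"
      using of_int_floor_le[of z] real_of_int_floor_add_one_gt[of z] by linarith+
    then show "real N \<le> (b - a) / L" "(b - a) / L / 2 \<le> real N" by (simp_all only: z_def)
  qed
  have NL: "a + real N * L \<le> b" using N(1) L by (simp add: field_simps)
  have "(b - a) / 2 * (\<delta> / L) * (A / 4) = (b - a) / L / 2 * (\<delta> * (A / 4))" by simp
  also have "\<dots> \<le> real N * (\<delta> * (A / 4))"
    using N(2) \<delta> amp(2) by (intro mult_right_mono) auto
  also have "\<dots> \<le> integral {a..a + real N * L} (\<lambda>y. (u y)\<^sup>2)" using many[of N] NL ab by simp
  also have "\<dots> \<le> integral {a..b} (\<lambda>y. (u y)\<^sup>2)"
    by (rule integral_subset_le) (use NL ab L in \<open>auto intro!: integrable_continuous_real cu\<close>)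
  finally show ?thesis by (simp add: L_def)
qed

text \<open>If \<open>Q\<close> is bounded, the maximum \<open>B\<close> of \<open>|u|\<close> on \<open>[a, b]\<close> controls \<open>v\<close> as well: the mean of \<open>v\<close> is at most
\<open>2 B / (b - a)\<close> and its oscillation at most \<open>M B (b - a)\<close>. So \<open>B\<close> cannot be small compared with the
amplitude, and \<open>u\<close> cannot leave its maximum quickly.\<close>

lemma sturm_mass_low_frequency:
  fixes a b H M A :: real
  assumes sol: "sturm_solution H Q u v" and Q: "\<And>y. y \<in> {0..H} \<Longrightarrow> \<bar>Q y\<bar> \<le> M"
    and amp: "\<And>y. y \<in> {0..H} \<Longrightarrow> A \<le> (u y)\<^sup>2 + (v y)\<^sup>2" and ab: "0 \<le> a" "a < b" "b \<le> H"
  defines "C \<equiv> 2 / (b - a) + 2 * M * (b - a)"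
  shows "A / (1 + C\<^sup>2) / 4 * (1 / (2 * C)) \<le> integral {a..b} (\<lambda>y. (u y)\<^sup>2)"
proof -
  define d where "d = b - a"
  have d: "d > 0" using ab by (simp add: d_def)
  have M0: "M \<ge> 0" using Q[of a] ab by auto
  have C: "C > 0" "1 / (2 * C) \<le> d / 4"
  proof -
    have "2 / d \<le> C" using M0 d unfolding C_def d_def[symmetric] by simp
    moreover have d2: "0 < 2 / d" using d by simp
    ultimately show "C > 0" using less_le_trans[OF d2] by blast
    have "1 / (2 * C) \<le> 1 / (2 * (2 / d))"
      using \<open>2 / d \<le> C\<close> d2 \<open>C > 0\<close> by (intro divide_left_mono mult_pos_pos) auto
    then show "1 / (2 * C) \<le> d / 4" using d by simp
  qed
  have cu: "continuous_on {a..b} (\<lambda>y. \<bar>u y\<bar>)" "continuous_on {a..b} (\<lambda>y. (u y)\<^sup>2)"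
    by (intro continuous_intros continuous_on_subset[OF sturm_solution_continuous(1)[OF sol]]; use ab in auto)+
  obtain m where m: "m \<in> {a..b}" "\<And>y. y \<in> {a..b} \<Longrightarrow> \<bar>u y\<bar> \<le> \<bar>u m\<bar>"
    using continuous_attains_sup[OF _ _ cu(1)] ab by auto
  define B where "B = \<bar>u m\<bar>"
  have B0: "B \<ge> 0" by (simp add: B_def)
  have va: "\<bar>v y - v a\<bar> \<le> M * B * d" if y: "y \<in> {a..b}" for y
  proof -
    have "norm (v a - v y) \<le> (M * B) * measure lborel {a..y}"
    proof (rule has_integral_bound_real[of _ "{}"])
      show "((\<lambda>y. Q y * u y) has_integral v a - v y) {a..y}"
        by (rule sturm_solution_integrals(2)[OF sol]) (use y ab in auto)
      show "norm (Q z * u z) \<le> M * B" if "z \<in> {a..y} - {}" for z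
        using that y ab Q[of z] m(2)[of z] M0 by (auto simp: abs_mult B_def intro!: mult_mono)
    qed (use M0 in \<open>auto simp: B_def\<close>)
    also have "\<dots> \<le> M * B * d" using y M0 B0 by (intro mult_left_mono) (auto simp: d_def)
    finally show ?thesis by (simp add: abs_minus_commute)
  qed
  have "\<bar>v a\<bar> * d \<le> 2 * B + M * B * d * d"
  proof -
    have "((\<lambda>y. v y - v a) has_integral (u b - u a) - d * v a) {a..b}"
      using has_integral_diff[OF sturm_solution_integrals(1)[OF sol, of a b] has_integral_const_real[of "v a" a b]] ab
      by (simp add: d_def)
    then have "norm ((u b - u a) - d * v a) \<le> (M * B * d) * measure lborel {a..b}"
      by (rule has_integral_bound_real[of _ "{}", rotated 2]) (use va M0 B0 d in auto)
    then have "\<bar>(u b - u a) - d * v a\<bar> \<le> M * B * d * d" using ab by (simp add: d_def)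
    moreover have "\<bar>u a\<bar> \<le> B" "\<bar>u b\<bar> \<le> B" using m(2)[of a] m(2)[of b] ab by (auto simp: B_def)
    moreover have "\<bar>v a\<bar> * d = \<bar>d * v a\<bar>" using d by (simp add: abs_mult)
    ultimately show ?thesis by linarith
  qed
  then have "\<bar>v a\<bar> \<le> (2 * B + M * B * d * d) / d" using d by (simp add: pos_le_divide_eq)
  also have "\<dots> = B * (2 / d + M * d)" using d by (simp add: field_simps)
  finally have va0: "\<bar>v a\<bar> \<le> B * (2 / d + M * d)" .
  have v: "\<bar>v y\<bar> \<le> C * B" if "y \<in> {a..b}" for y
  proof -
    have "\<bar>v y\<bar> \<le> \<bar>v a\<bar> + \<bar>v y - v a\<bar>" by linarith
    also have "\<dots> \<le> B * (2 / d + M * d) + M * B * d" using va0 va[OF that] by linarith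
    finally show ?thesis by (simp add: C_def d_def[symmetric] algebra_simps)
  qed
  have "A \<le> (u a)\<^sup>2 + (v a)\<^sup>2" using amp[of a] ab by simp
  also have "\<dots> \<le> B\<^sup>2 + (C * B)\<^sup>2"
  proof (rule add_mono)
    show "(u a)\<^sup>2 \<le> B\<^sup>2" using m(2)[of a] ab B0 by (simp add: abs_le_square_iff[symmetric] B_def)
    show "(v a)\<^sup>2 \<le> (C * B)\<^sup>2" using v[of a] ab B0 C by (simp add: abs_le_square_iff[symmetric] abs_mult)
  qed
  also have "\<dots> = B\<^sup>2 * (1 + C\<^sup>2)" by (simp add: algebra_simps power_mult_distrib)
  finally have AB: "A / (1 + C\<^sup>2) \<le> B\<^sup>2" by (simp add: pos_divide_le_eq add_pos_nonneg)
  define h where "h = 1 / (2 * C)"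
  have h: "h > 0" "h \<le> d / 4" "C * h = 1/2" using C by (auto simp: h_def)
  have du: "(u has_real_derivative v z) (at z within {a..b})" if "z \<in> {a..b}" for z
    by (rule DERIV_subset[of u "v z" z "{0..H}"]) (use sol that ab in \<open>auto simp: sturm_solution_def\<close>)
  have near: "B\<^sup>2 / 4 \<le> (u y)\<^sup>2" if y: "y \<in> {a..b}" "\<bar>y - m\<bar> \<le> h" for y
  proof -
    have "norm (u y - u m) \<le> (C * B) * norm (y - m)"
      by (rule field_differentiable_bound[where S = "{a..b}" and f' = v])
        (use du y m v in auto)
    also have "\<dots> \<le> (C * B) * h" using y B0 C by (intro mult_left_mono) auto
    also have "\<dots> = B / 2" using h(3) by (metis mult.assoc mult.commute mult_1 times_divide_eq_left)
    finally have "B / 2 \<le> \<bar>u y\<bar>" unfolding B_def real_norm_def by linarith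
    then have "(B / 2)\<^sup>2 \<le> \<bar>u y\<bar>\<^sup>2" using B0 by (intro power_mono) auto
    then show ?thesis by (simp add: power_divide)
  qed
  have "B\<^sup>2 / 4 * h \<le> integral {a..b} (\<lambda>y. (u y)\<^sup>2)"
  proof (cases "m + h \<le> b")
    case True
    have "B\<^sup>2 / 4 * (m + h - m) \<le> integral {a..b} (\<lambda>y. (u y)\<^sup>2)"
      by (rule integral_mono_subinterval[OF cu(2)]) (use True m h near in auto)
    then show ?thesis by simp
  next
    case False
    have "B\<^sup>2 / 4 * (m - (m - h)) \<le> integral {a..b} (\<lambda>y. (u y)\<^sup>2)"
      by (rule integral_mono_subinterval[OF cu(2)]) (use False m h near in \<open>auto simp: d_def\<close>)
    then show ?thesis by simp
  qed
  moreover have "A / (1 + C\<^sup>2) / 4 * h \<le> B\<^sup>2 / 4 * h" using h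
    by (intro mult_right_mono divide_right_mono AB) simp_all
  ultimately show ?thesis by (simp add: h_def)
qed

text \<open>For large \<open>\<nu>\<close> a fixed proportion of every interval of length of order \<open>\<nu> powr (-1/2)\<close> carries
mass; small \<open>\<nu>\<close> only see bounded coefficients.\<close>

lemma sturm_mass_uniform:
  assumes ab: "0 \<le> a" "a < b" "b \<le> H" and \<kappa>: "\<kappa> > 0" and K: "K > 0" and A: "A > (0::real)"
  obtains \<beta> where "\<beta> > 0"
    "\<And>\<nu> Q u v. \<nu> > 0 \<Longrightarrow> sturm_solution H Q u v \<Longrightarrow>
       (\<And>y. y \<in> {0..H} \<Longrightarrow> \<kappa> * \<nu> \<le> Q y \<and> Q y \<le> K * \<nu>) \<Longrightarrow>
       (\<And>y. y \<in> {0..H} \<Longrightarrow> A \<le> (u y)\<^sup>2 + (v y)\<^sup>2) \<Longrightarrow> \<beta> \<le> integral {a..b} (\<lambda>y. (u y)\<^sup>2)"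
proof -
  define l0 where "l0 = 4 / sqrt \<kappa>"
  define d0 where "d0 = 1 / (2 * sqrt K)"
  have pos: "l0 > 0" "d0 > 0" using \<kappa> K by (auto simp: l0_def d0_def)
  \<comment> \<open>At frequency \<open>\<nu>\<close> the windows have lengths \<open>l0 / sqrt \<nu>\<close> and \<open>d0 / sqrt \<nu>\<close>; beyond \<open>\<Lambda>\<close> they fit into \<open>[a, b]\<close>.\<close>
  define \<Lambda> where "\<Lambda> = ((l0 + d0) / (b - a))\<^sup>2"
  define C where "C = 2 / (b - a) + 2 * (K * \<Lambda>) * (b - a)"
  have Cpos: "C > 0" using ab K by (auto simp: C_def \<Lambda>_def intro!: add_pos_nonneg)
  define \<beta>1 where "\<beta>1 = (b - a) / 2 * (d0 / (l0 + d0)) * (A / 4)"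
  define \<beta>2 where "\<beta>2 = A / (1 + C\<^sup>2) / 4 * (1 / (2 * C))"
  have \<beta>: "\<beta>1 > 0" "\<beta>2 > 0"
    using ab pos A Cpos by (auto simp: \<beta>1_def \<beta>2_def add_pos_nonneg intro!: mult_pos_pos divide_pos_pos)
  show ?thesis
  proof (rule that[of "min \<beta>1 \<beta>2"])
    fix \<nu> :: real and Q u v
    assume \<nu>: "\<nu> > 0" and sol: "sturm_solution H Q u v"
      and Q: "\<And>y. y \<in> {0..H} \<Longrightarrow> \<kappa> * \<nu> \<le> Q y \<and> Q y \<le> K * \<nu>"
      and amp: "\<And>y. y \<in> {0..H} \<Longrightarrow> A \<le> (u y)\<^sup>2 + (v y)\<^sup>2"
    show "min \<beta>1 \<beta>2 \<le> integral {a..b} (\<lambda>y. (u y)\<^sup>2)"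
    proof (cases "\<nu> \<ge> \<Lambda>")
      case True
      define l where "l = l0 / sqrt \<nu>"
      define \<delta> where "\<delta> = d0 / sqrt \<nu>"
      have sq: "sqrt \<nu> > 0" using \<nu> by simp
      have "(l0 + d0) / (b - a) \<le> sqrt \<nu>"
        using True pos ab real_le_rsqrt unfolding \<Lambda>_def by blast
      then have ld: "l + \<delta> \<le> b - a"
        using sq ab by (simp add: l_def \<delta>_def add_divide_distrib[symmetric] field_simps)
      have "(b - a) / 2 * (\<delta> / (l + \<delta>)) * (A / 4) \<le> integral {a..b} (\<lambda>y. (u y)\<^sup>2)"
      proof (rule sturm_mass_high_frequency[OF sol Q])
        show "16 \<le> \<kappa> * \<nu> * l\<^sup>2" using \<kappa> \<nu> by (simp add: l_def l0_def power_divide power_mult_distrib)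
        show "K * \<nu> * \<delta>\<^sup>2 \<le> 1 / 4" using K \<nu> by (simp add: \<delta>_def d0_def power_divide power_mult_distrib)
      qed (use \<kappa> \<nu> pos sq amp A ab ld in \<open>auto simp: l_def \<delta>_def\<close>)
      moreover have "\<delta> / (l + \<delta>) = d0 / (l0 + d0)"
        using sq by (simp add: l_def \<delta>_def add_divide_distrib[symmetric])
      ultimately show ?thesis by (simp add: \<beta>1_def)
    next
      case False
      have "\<beta>2 \<le> integral {a..b} (\<lambda>y. (u y)\<^sup>2)"
        unfolding \<beta>2_def C_def
      proof (rule sturm_mass_low_frequency[OF sol _ amp ab])
        fix y assume y: "y \<in> {0..H}"
        have "0 \<le> \<kappa> * \<nu>" "K * \<nu> \<le> K * \<Lambda>" using \<kappa> \<nu> K False by auto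
        then show "\<bar>Q y\<bar> \<le> K * \<Lambda>" using Q[OF y] by auto
      qed
      then show ?thesis by simp
    qed
  qed (use \<beta> in auto)
qed


section \<open>Existence of large eigenvalues by shooting\<close>

lemma absolutely_integrable_prufer:
  fixes Q \<theta> :: "real \<Rightarrow> real"
  assumes "Q absolutely_integrable_on {0..H}" "continuous_on {0..H} \<theta>"
  shows "(\<lambda>t. (cos (\<theta> t))\<^sup>2 + Q t * (sin (\<theta> t))\<^sup>2) absolutely_integrable_on {0..H}"
proof -
  have "(\<lambda>t. (sin (\<theta> t))\<^sup>2 * Q t) absolutely_integrable_on {0..H}"
    by (intro absolutely_integrable_continuous_mult continuous_intros assms)
  moreover have "(\<lambda>t. (cos (\<theta> t))\<^sup>2) absolutely_integrable_on {0..H}"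
    by (intro absolutely_integrable_continuous_real continuous_intros assms)
  ultimately show ?thesis by (intro set_integral_add(1)) (simp_all add: mult.commute)
qed

lemma sin_squared_lipschitz: "\<bar>(sin x)\<^sup>2 - (sin y)\<^sup>2\<bar> \<le> 2 * \<bar>x - (y::real)\<bar>"
proof -
  have "\<bar>sin x - sin y\<bar> \<le> \<bar>x - y\<bar>"
    using field_differentiable_bound[of UNIV sin cos 1 x y] by (auto intro: derivative_eq_intros)
  moreover have "\<bar>sin x + sin y\<bar> \<le> 2" using abs_sin_le_one[of x] abs_sin_le_one[of y] by linarith
  ultimately have "\<bar>sin x - sin y\<bar> * \<bar>sin x + sin y\<bar> \<le> \<bar>x - y\<bar> * 2" by (intro mult_mono) auto
  then show ?thesis by (simp add: abs_mult[symmetric] power2_eq_square algebra_simps)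
qed

lemma prufer_lipschitz:
  fixes Q x y :: real
  assumes "\<bar>Q\<bar> \<le> M"
  shows "\<bar>((cos x)\<^sup>2 + Q * (sin x)\<^sup>2) - ((cos y)\<^sup>2 + Q * (sin y)\<^sup>2)\<bar> \<le> 2 * (1 + M) * \<bar>x - y\<bar>"
proof -
  have "((cos x)\<^sup>2 + Q * (sin x)\<^sup>2) - ((cos y)\<^sup>2 + Q * (sin y)\<^sup>2) = (Q - 1) * ((sin x)\<^sup>2 - (sin y)\<^sup>2)"
    by (simp add: cos_squared_eq algebra_simps)
  also have "\<bar>\<dots>\<bar> \<le> (1 + M) * (2 * \<bar>x - y\<bar>)"
    unfolding abs_mult using assms by (intro mult_mono sin_squared_lipschitz) auto
  also have "\<dots> = 2 * (1 + M) * \<bar>x - y\<bar>" by simp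
  finally show ?thesis .
qed

text \<open>In polar coordinates \<open>u = r sin \<theta>\<close>, \<open>v = r cos \<theta>\<close> the angle satisfies an equation of its own.\<close>

definition prufer_angle :: "real \<Rightarrow> (real \<Rightarrow> real) \<Rightarrow> (real \<Rightarrow> real) \<Rightarrow> bool" where
  "prufer_angle H Q \<theta> \<longleftrightarrow> \<theta> 0 = 0 \<and>
     lip_primitive 0 H \<theta> (\<lambda>t. (cos (\<theta> t))\<^sup>2 + Q t * (sin (\<theta> t))\<^sup>2)"

lemma prufer_angle_exists:
  assumes H: "H \<ge> 0" and Q: "Q absolutely_integrable_on {0..H}" "\<And>t. t \<in> {0..H} \<Longrightarrow> \<bar>Q t\<bar> \<le> M"
  shows "\<exists>\<theta>. prufer_angle H Q \<theta>"
proof -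
  define F where "F t x = (cos x)\<^sup>2 + Q t * (sin x)\<^sup>2" for t x
  have M: "M \<ge> 0" using Q(2)[of 0] H by auto
  obtain \<theta> where \<theta>: "continuous_on {0..H} \<theta>"
    "\<And>t. t \<in> {0..H} \<Longrightarrow> \<theta> t = 0 + integral {0..t} (\<lambda>\<tau>. F \<tau> (\<theta> \<tau>))"
  proof (rule picard_lindelof_integral[OF H, of "2 * (1 + M)" F 0])
    show "(\<lambda>\<tau>. F \<tau> (y \<tau>)) integrable_on {0..H}" if "continuous_on {0..H} y" for y
      using absolutely_integrable_prufer[OF Q(1) that] set_lebesgue_integral_eq_integral(1) unfolding F_def by blast
    show "norm (F \<tau> x - F \<tau> y) \<le> 2 * (1 + M) * norm (x - y)" if "\<tau> \<in> {0..H}" for \<tau> x y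
      using prufer_lipschitz[OF Q(2)[OF that], of x y] by (simp add: F_def)
  qed (use M in auto)
  have "lip_primitive 0 H \<theta> (\<lambda>t. F t (\<theta> t))"
  proof (rule lip_primitive_integral[where c = 0])
    show "(\<lambda>t. F t (\<theta> t)) absolutely_integrable_on {0..H}"
      unfolding F_def by (rule absolutely_integrable_prufer[OF Q(1) \<theta>(1)])
    have "\<bar>F t (\<theta> t)\<bar> \<le> 1 + M" if t: "t \<in> {0..H}" for t
    proof -
      have "\<bar>(cos (\<theta> t))\<^sup>2\<bar> \<le> 1" "\<bar>(sin (\<theta> t))\<^sup>2\<bar> \<le> 1" by (auto simp: abs_square_le_1)
      moreover have "\<bar>Q t * (sin (\<theta> t))\<^sup>2\<bar> \<le> M * 1"
        unfolding abs_mult using Q(2)[OF t] calculation M by (intro mult_mono) auto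
      ultimately show ?thesis unfolding F_def by linarith
    qed
    then show "bounded ((\<lambda>t. F t (\<theta> t)) ` {0..H})" unfolding bounded_iff by (auto intro!: exI[of _ "1 + M"])
  qed (use \<theta>(2) in auto)
  moreover have "\<theta> 0 = 0" using \<theta>(2)[of 0] H by simp
  ultimately show ?thesis unfolding prufer_angle_def F_def by blast
qed

text \<open>The radius solves the linear equation \<open>r' = r (1 - Q) sin \<theta> cos \<theta>\<close>, which is integrated explicitly.\<close>

lemma prufer_solution:
  assumes H: "H \<ge> 0" and Q: "Q absolutely_integrable_on {0..H}" "\<And>t. t \<in> {0..H} \<Longrightarrow> \<bar>Q t\<bar> \<le> M"
    and \<theta>: "prufer_angle H Q \<theta>"
  obtains r where "\<And>t. r t > 0" "r 0 = 1" "sturm_solution H Q (\<lambda>t. r t * sin (\<theta> t)) (\<lambda>t. r t * cos (\<theta> t))"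
proof -
  have l\<theta>: "lip_primitive 0 H \<theta> (\<lambda>t. (cos (\<theta> t))\<^sup>2 + Q t * (sin (\<theta> t))\<^sup>2)"
    using \<theta> by (simp add: prufer_angle_def)
  note c\<theta> = lip_primitive_continuous[OF l\<theta>]
  define q where "q t = (sin (\<theta> t) * cos (\<theta> t)) * (1 - Q t)" for t
  define R where "R t = integral {0..t} q" for t
  have M: "M \<ge> 0" using Q(2)[of 0] H by auto
  have lR: "lip_primitive 0 H R q"
  proof (rule lip_primitive_integral[where c = 0])
    show "q absolutely_integrable_on {0..H}"
      unfolding q_def[abs_def]
      by (intro absolutely_integrable_continuous_mult continuous_intros c\<theta> set_integral_diff(1)
          absolutely_integrable_continuous_real Q)
    have "\<bar>q t\<bar> \<le> 1 * (1 + M)" if "t \<in> {0..H}" for t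
    proof -
      have "\<bar>sin (\<theta> t) * cos (\<theta> t)\<bar> \<le> 1 * 1" unfolding abs_mult by (intro mult_mono) auto
      moreover have "\<bar>1 - Q t\<bar> \<le> 1 + M" using Q(2)[OF that] by linarith
      ultimately show ?thesis unfolding q_def abs_mult[of _ "1 - Q t"] by (intro mult_mono) auto
    qed
    then show "bounded (q ` {0..H})" unfolding bounded_iff by (auto intro!: exI[of _ "1 + M"])
  qed (simp add: R_def)
  define r where "r t = exp (R t)" for t
  have lr: "lip_primitive 0 H r (\<lambda>t. r t * q t)"
    unfolding r_def[abs_def] by (rule lip_primitive_chain[OF lR, of exp exp exp]) (auto intro!: derivative_eq_intros continuous_intros)
  define p where "p t = (cos (\<theta> t))\<^sup>2 + Q t * (sin (\<theta> t))\<^sup>2" for t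
  have lp: "lip_primitive 0 H \<theta> p" using l\<theta> by (simp add: p_def[abs_def])
  have ls: "lip_primitive 0 H (\<lambda>t. sin (\<theta> t)) (\<lambda>t. cos (\<theta> t) * p t)"
    by (rule lip_primitive_chain[OF lp, of sin cos "\<lambda>x. - sin x"]) (auto intro!: derivative_eq_intros continuous_intros)
  have lc: "lip_primitive 0 H (\<lambda>t. cos (\<theta> t)) (\<lambda>t. - sin (\<theta> t) * p t)"
    by (rule lip_primitive_chain[OF lp, of cos "\<lambda>x. - sin x" "\<lambda>x. - cos x"]) (auto intro!: derivative_eq_intros continuous_intros)
  have polar: "R * (S * C * (1 - q)) * S + R * (C * (C\<^sup>2 + q * S\<^sup>2)) = R * C * (S\<^sup>2 + C\<^sup>2)"
    "R * (S * C * (1 - q)) * C + R * (- S * (C\<^sup>2 + q * S\<^sup>2)) = - (q * (R * S)) * (S\<^sup>2 + C\<^sup>2)"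
    for R S C q :: real by (simp_all add: algebra_simps power2_eq_square)
  define u v where "u t = r t * sin (\<theta> t)" and "v t = r t * cos (\<theta> t)" for t
  have "r t * q t * sin (\<theta> t) + r t * (cos (\<theta> t) * p t) = v t" for t
    unfolding q_def p_def polar by (simp add: v_def)
  then have lu: "lip_primitive 0 H u v"
    using lip_primitive_mult[OF lr ls] by (simp add: u_def[abs_def])
  have "r t * q t * cos (\<theta> t) + r t * (- sin (\<theta> t) * p t) = - (Q t * u t)" for t
    unfolding q_def p_def polar by (simp add: u_def)
  then have lv: "lip_primitive 0 H v (\<lambda>t. - (Q t * u t))"
    using lip_primitive_mult[OF lr lc] by (simp add: v_def[abs_def])
  have "(u has_real_derivative v t) (at t within {0..H})" if t: "t \<in> {0..H}" for t
  proof -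
    have "((\<lambda>t. u 0 + integral {0..t} v) has_vector_derivative 0 + v t) (at t within {0..H})"
      by (intro has_vector_derivative_add has_vector_derivative_const
          integral_has_vector_derivative[OF lip_primitive_continuous[OF lv] t])
    then have hv: "((\<lambda>t. u 0 + integral {0..t} v) has_vector_derivative v t) (at t within {0..H})" by simp
    have ux: "u x = u 0 + integral {0..x} v" if "x \<in> {0..H}" for x
      using integral_unique[OF lip_primitiveD[OF lu, of 0 x]] that by simp
    show ?thesis using has_vector_derivative_transform[OF t ux hv] by (simp add: has_real_derivative_iff_has_vector_derivative)
  qed
  then have "sturm_solution H Q u v" using lv by (simp add: sturm_solution_def)
  then show ?thesis
    using that[of r] by (simp add: u_def[abs_def] v_def[abs_def] r_def R_def)
qed

lemma prufer_angle_increasing: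
  assumes \<theta>: "prufer_angle H Q \<theta>" and Q: "\<And>t. t \<in> {0..H} \<Longrightarrow> k \<le> Q t" and k: "k > 0"
    and st: "0 \<le> s" "s \<le> t" "t \<le> H"
  shows "min 1 k * (t - s) \<le> \<theta> t - \<theta> s"
proof (rule has_integral_ge_const)
  show "((\<lambda>t. (cos (\<theta> t))\<^sup>2 + Q t * (sin (\<theta> t))\<^sup>2) has_integral \<theta> t - \<theta> s) {s..t}"
    using \<theta> st by (intro lip_primitiveD) (auto simp: prufer_angle_def)
  fix y assume y: "y \<in> {s..t}"
  have "min 1 k * ((cos (\<theta> y))\<^sup>2 + (sin (\<theta> y))\<^sup>2) \<le> 1 * (cos (\<theta> y))\<^sup>2 + Q y * (sin (\<theta> y))\<^sup>2"
    unfolding distrib_left using Q[of y] y st by (intro add_mono mult_right_mono) auto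
  then show "min 1 k \<le> (cos (\<theta> y))\<^sup>2 + Q y * (sin (\<theta> y))\<^sup>2" by simp
qed (use st in auto)

text \<open>Between two critical points of the solution the angle advances by a positive multiple of \<open>\<pi>\<close>.\<close>

lemma prufer_angle_advances:
  assumes H: "H \<ge> 0" and Q: "Q absolutely_integrable_on {0..H}" "\<And>t. t \<in> {0..H} \<Longrightarrow> k \<le> Q t \<and> Q t \<le> M"
    and k: "k > 0" and \<theta>: "prufer_angle H Q \<theta>"
    and l: "l > 0" "16 \<le> k * l\<^sup>2" and s: "0 \<le> s" "s + 3 * l \<le> H"
  shows "\<theta> s + pi \<le> \<theta> (s + 3 * l)"
proof -
  have Q': "\<bar>Q t\<bar> \<le> M" if "t \<in> {0..H}" for t using Q(2)[OF that] k by auto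
  obtain r where r: "\<And>t. r t > 0" "sturm_solution H Q (\<lambda>t. r t * sin (\<theta> t)) (\<lambda>t. r t * cos (\<theta> t))"
    using prufer_solution[OF H Q(1) Q' \<theta>] by metis
  have crit: "\<exists>t\<in>{x..x+l}. cos (\<theta> t) = 0" if "0 \<le> x" "x + l \<le> H" for x
    using sturm_critical_point[OF r(2) _ k that l] Q(2) r(1) by (auto simp: less_imp_neq[symmetric])
  \<comment> \<open>Separated by a third window, so that \<open>t1 < t2\<close>.\<close>
  obtain t1 where t1: "t1 \<in> {s..s+l}" "cos (\<theta> t1) = 0" using crit[of s] s l by auto
  obtain t2 where t2: "t2 \<in> {s+2*l..s+2*l+l}" "cos (\<theta> t2) = 0" using crit[of "s + 2*l"] s l by auto
  have mono: "min 1 k * (y - x) \<le> \<theta> y - \<theta> x" if "0 \<le> x" "x \<le> y" "y \<le> H" for x y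
    by (rule prufer_angle_increasing[OF \<theta> _ k that]) (use Q in auto)
  have mk: "min 1 k > 0" using k by simp
  have "0 < min 1 k * (t2 - t1)" using mk t1 t2 l by (intro mult_pos_pos) auto
  also have "\<dots> \<le> \<theta> t2 - \<theta> t1" using mono[of t1 t2] t1 t2 l s by auto
  finally have d: "0 < \<theta> t2 - \<theta> t1" .
  have "sin (\<theta> t2 - \<theta> t1) = 0" using t1(2) t2(2) by (simp add: sin_diff)
  then have "\<not> \<theta> t2 - \<theta> t1 < pi" using sin_gt_zero[OF d] by auto
  moreover have "0 \<le> min 1 k * (t1 - s)" "0 \<le> min 1 k * (s + 3 * l - t2)"
    using mk t1 t2 by (auto intro!: mult_nonneg_nonneg)
  moreover have "min 1 k * (t1 - s) \<le> \<theta> t1 - \<theta> s" "min 1 k * (s + 3 * l - t2) \<le> \<theta> (s + 3 * l) - \<theta> t2"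
    using mono[of s t1] mono[of t2 "s + 3*l"] t1 t2 s l by auto
  ultimately show ?thesis by linarith
qed

lemma prufer_angle_growth:
  assumes H: "H \<ge> 0" and Q: "Q absolutely_integrable_on {0..H}" "\<And>t. t \<in> {0..H} \<Longrightarrow> k \<le> Q t \<and> Q t \<le> M"
    and k: "k > 0" and \<theta>: "prufer_angle H Q \<theta>"
    and l: "l > 0" "16 \<le> k * l\<^sup>2"
  shows "real n * (3 * l) \<le> H \<Longrightarrow> real n * pi \<le> \<theta> (real n * (3 * l))"
proof (induction n)
  case 0 then show ?case using \<theta> by (simp add: prufer_angle_def)
next
  case (Suc n)
  have "\<theta> (real n * (3 * l)) + pi \<le> \<theta> (real n * (3 * l) + 3 * l)"
    by (rule prufer_angle_advances[OF H Q k \<theta> l]) (use l Suc.prems in \<open>auto simp: algebra_simps\<close>)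
  moreover have "real n * pi \<le> \<theta> (real n * (3 * l))" using Suc l by (auto simp: algebra_simps)
  ultimately show ?case by (simp add: algebra_simps)
qed

lemma prufer_angle_depends_lipschitz:
  assumes H: "H \<ge> 0" and Q: "\<And>t. t \<in> {0..H} \<Longrightarrow> \<bar>Q1 t\<bar> \<le> M" "\<And>t. t \<in> {0..H} \<Longrightarrow> \<bar>Q2 t - Q1 t\<bar> \<le> e"
    and \<theta>: "prufer_angle H Q1 \<theta>1" "prufer_angle H Q2 \<theta>2"
  shows "\<bar>\<theta>2 H - \<theta>1 H\<bar> \<le> e * H * exp (2 * (1 + M) * H)"
proof -
  define v where "v t = \<bar>\<theta>2 t - \<theta>1 t\<bar>" for t
  have M: "M \<ge> 0" using Q(1)[of 0] H by auto
  have e: "e \<ge> 0" using Q(2)[of 0] H by auto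
  have c: "continuous_on {0..H} \<theta>1" "continuous_on {0..H} \<theta>2"
    using \<theta> lip_primitive_continuous unfolding prufer_angle_def by blast+
  have cv: "continuous_on {0..H} v" unfolding v_def[abs_def] by (intro continuous_intros c)
  have "v H \<le> (e * H) * exp ((2 * (1 + M)) * H)"
  proof (rule gronwall[OF cv])
    fix t assume t: "t \<in> {0..H}"
    define p where "p Q \<theta> x = (cos (\<theta> x))\<^sup>2 + Q x * (sin (\<theta> x))\<^sup>2" for Q \<theta> :: "real \<Rightarrow> real" and x
    have "(p Q1 \<theta>1 has_integral \<theta>1 t - \<theta>1 0) {0..t}" "(p Q2 \<theta>2 has_integral \<theta>2 t - \<theta>2 0) {0..t}"
      using \<theta> t lip_primitiveD[of 0 H \<theta>1 "p Q1 \<theta>1" 0 t] lip_primitiveD[of 0 H \<theta>2 "p Q2 \<theta>2" 0 t]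
      unfolding prufer_angle_def p_def by simp_all
    then have i: "((\<lambda>x. p Q2 \<theta>2 x - p Q1 \<theta>1 x) has_integral \<theta>2 t - \<theta>1 t) {0..t}"
      using has_integral_diff[of "p Q2 \<theta>2" "\<theta>2 t" "{0..t}" "p Q1 \<theta>1" "\<theta>1 t"] \<theta> by (simp add: prufer_angle_def)
    have iv: "v integrable_on {0..t}"
      by (intro integrable_continuous_real continuous_on_subset[OF cv]) (use t in auto)
    have ir: "((\<lambda>x. e + 2 * (1 + M) * v x) has_integral e * t + 2 * (1 + M) * integral {0..t} v) {0..t}"
      using has_integral_add[OF has_integral_const_real[of e 0 t] has_integral_mult_right[OF integrable_integral[OF iv], of "2 * (1 + M)"]] t
      by (simp add: mult.commute)
    have "norm (integral {0..t} (\<lambda>x. p Q2 \<theta>2 x - p Q1 \<theta>1 x)) \<le> integral {0..t} (\<lambda>x. e + 2 * (1 + M) * v x)"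
    proof (rule Henstock_Kurzweil_Integration.integral_norm_bound_integral)
      fix x assume "x \<in> {0..t}"
      then have x: "x \<in> {0..H}" using t by auto
      have "p Q2 \<theta>2 x - p Q1 \<theta>1 x = (Q2 x - Q1 x) * (sin (\<theta>2 x))\<^sup>2
          + (((cos (\<theta>2 x))\<^sup>2 + Q1 x * (sin (\<theta>2 x))\<^sup>2) - ((cos (\<theta>1 x))\<^sup>2 + Q1 x * (sin (\<theta>1 x))\<^sup>2))"
        by (simp add: p_def algebra_simps)
      moreover have "\<bar>(Q2 x - Q1 x) * (sin (\<theta>2 x))\<^sup>2\<bar> \<le> e * 1"
        unfolding abs_mult using Q(2)[OF x] e by (intro mult_mono) (auto simp: abs_square_le_1)
      moreover note prufer_lipschitz[OF Q(1)[OF x], of "\<theta>2 x" "\<theta>1 x"]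
      ultimately show "norm (p Q2 \<theta>2 x - p Q1 \<theta>1 x) \<le> e + 2 * (1 + M) * v x"
        unfolding v_def real_norm_def by linarith
    qed (use i ir in auto)
    then have "v t \<le> e * t + 2 * (1 + M) * integral {0..t} v"
      using integral_unique[OF i] integral_unique[OF ir] by (simp add: v_def)
    moreover have "e * t \<le> e * H" using t e by (intro mult_left_mono) auto
    ultimately show "v t \<le> e * H + 2 * (1 + M) * integral {0..t} v" by linarith
  qed (use H M in auto)
  then show ?thesis by (simp add: v_def)
qed

text \<open>The end value of the angle is continuous in \<open>\<nu>\<close> and unbounded, so it attains multiples of \<open>\<pi>\<close>.\<close>

theorem dirichlet_sturm_solution_exists:
  fixes p :: "real \<Rightarrow> real"
  assumes H: "H > 0" and p: "p absolutely_integrable_on {0..H}" "\<And>y. y \<in> {0..H} \<Longrightarrow> 0 \<le> p y \<and> p y \<le> P"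
    and \<kappa>: "\<kappa> > 0" and \<Lambda>: "\<Lambda> > 0"
    and low: "\<And>\<nu> y. \<nu> \<ge> \<Lambda> \<Longrightarrow> y \<in> {0..H} \<Longrightarrow> \<kappa> * \<nu> \<le> \<nu> * p y - q"
  obtains \<nu> u v where "\<nu> \<ge> \<Lambda>" "sturm_solution H (\<lambda>y. \<nu> * p y - q) u v" "u 0 = 0" "u H = 0" "v 0 \<noteq> 0"
proof -
  define Q where "Q \<nu> y = \<nu> * p y - q" for \<nu> y
  have P: "P \<ge> 0" using p(2)[of 0] H by auto
  have Q_int: "Q \<nu> absolutely_integrable_on {0..H}" for \<nu>
    unfolding Q_def[abs_def]
    by (intro set_integral_diff(1) absolutely_integrable_continuous_mult p absolutely_integrable_continuous_real continuous_intros)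
  have Q_up: "Q \<nu> y \<le> \<nu> * P + \<bar>q\<bar>" if "\<nu> \<ge> 0" "y \<in> {0..H}" for \<nu> y
    using mult_left_mono[of "p y" P \<nu>] p(2)[OF that(2)] that(1) unfolding Q_def by linarith
  have Q_bd: "\<bar>Q \<nu> y\<bar> \<le> \<bar>\<nu>\<bar> * P + \<bar>q\<bar>" if "y \<in> {0..H}" for \<nu> y
  proof -
    have "\<bar>\<nu> * p y\<bar> \<le> \<bar>\<nu>\<bar> * P" unfolding abs_mult using p(2)[OF that] by (intro mult_left_mono) auto
    then show ?thesis unfolding Q_def by linarith
  qed
  obtain \<theta> where \<theta>: "\<And>\<nu>. prufer_angle H (Q \<nu>) (\<theta> \<nu>)"
    using prufer_angle_exists[OF less_imp_le[OF H] Q_int Q_bd] by metis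
  have cont: "continuous_on {\<Lambda>..\<Lambda>1} (\<lambda>\<nu>. \<theta> \<nu> H)" for \<Lambda>1
  proof -
    define M where "M = \<Lambda>1 * P + \<bar>q\<bar>"
    have "(P * H * exp (2 * (1 + M) * H))-lipschitz_on {\<Lambda>..\<Lambda>1} (\<lambda>\<nu>. \<theta> \<nu> H)"
    proof (rule lipschitz_onI)
      fix x y assume x: "x \<in> {\<Lambda>..\<Lambda>1}" and y: "y \<in> {\<Lambda>..\<Lambda>1}"
      have "\<bar>\<theta> x H - \<theta> y H\<bar> \<le> (\<bar>x - y\<bar> * P) * H * exp (2 * (1 + M) * H)"
      proof (rule prufer_angle_depends_lipschitz[OF less_imp_le[OF H] _ _ \<theta>[of y] \<theta>[of x]])
        fix t assume t: "t \<in> {0..H}"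
        have "\<bar>y\<bar> * P \<le> \<Lambda>1 * P" using y \<Lambda> P by (intro mult_right_mono) auto
        then show "\<bar>Q y t\<bar> \<le> M" using Q_bd[OF t, of y] unfolding M_def by linarith
        have "Q x t - Q y t = (x - y) * p t" by (simp add: Q_def algebra_simps)
        then show "\<bar>Q x t - Q y t\<bar> \<le> \<bar>x - y\<bar> * P"
          using p(2)[OF t] by (simp add: abs_mult mult_left_mono)
      qed
      then show "dist (\<theta> x H) (\<theta> y H) \<le> (P * H * exp (2 * (1 + M) * H)) * dist x y"
        by (simp add: dist_real_def mult_ac)
    qed (use P H in auto)
    then show ?thesis by (rule lipschitz_on_continuous_on)
  qed
  obtain n :: nat where n: "\<theta> \<Lambda> H / pi < real n" using reals_Archimedean2 by blast
  define N where "N = Suc n"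
  have "\<theta> \<Lambda> H < real n * pi" using n by (simp add: pos_divide_less_eq)
  moreover have "real N * pi = real n * pi + pi" by (simp add: N_def algebra_simps)
  ultimately have N: "\<theta> \<Lambda> H \<le> real N * pi" "N \<ge> 1" using pi_gt_zero by (linarith, simp add: N_def)
  define l where "l = H / (3 * real N)"
  have l: "l > 0" "real N * (3 * l) = H" using H N by (auto simp: l_def)
  define \<Lambda>1 where "\<Lambda>1 = max \<Lambda> (16 / (\<kappa> * l\<^sup>2))"
  have "16 / (\<kappa> * l\<^sup>2) * (\<kappa> * l\<^sup>2) \<le> \<Lambda>1 * (\<kappa> * l\<^sup>2)"
    using \<kappa> l by (intro mult_right_mono) (auto simp: \<Lambda>1_def)
  then have l2: "16 \<le> (\<kappa> * \<Lambda>1) * l\<^sup>2" using \<kappa> l by (simp add: mult_ac)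
  have \<Lambda>1: "\<Lambda>1 \<ge> \<Lambda>" "\<Lambda>1 > 0" using \<Lambda> by (auto simp: \<Lambda>1_def)
  have "real N * pi \<le> \<theta> \<Lambda>1 (real N * (3 * l))"
  proof (rule prufer_angle_growth[OF less_imp_le[OF H] Q_int _ _ \<theta> l(1) l2])
    show "\<kappa> * \<Lambda>1 \<le> Q \<Lambda>1 t \<and> Q \<Lambda>1 t \<le> \<Lambda>1 * P + \<bar>q\<bar>" if "t \<in> {0..H}" for t
      using low[OF \<Lambda>1(1) that] Q_up[of \<Lambda>1 t] \<Lambda>1 that by (simp add: Q_def)
  qed (use \<kappa> \<Lambda>1 l in auto)
  then obtain \<nu> where \<nu>: "\<Lambda> \<le> \<nu>" "\<theta> \<nu> H = real N * pi"
    using IVT'[of "\<lambda>\<nu>. \<theta> \<nu> H" \<Lambda> "real N * pi" \<Lambda>1] N \<Lambda>1 cont l by auto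
  obtain r where r: "r 0 = 1" "sturm_solution H (Q \<nu>) (\<lambda>t. r t * sin (\<theta> \<nu> t)) (\<lambda>t. r t * cos (\<theta> \<nu> t))"
    using prufer_solution[OF less_imp_le[OF H] Q_int Q_bd \<theta>] by metis
  have "\<theta> \<nu> 0 = 0" using \<theta> by (simp add: prufer_angle_def)
  then show ?thesis
    using that[OF \<nu>(1) r(2)[unfolded Q_def[abs_def]]] r(1) \<nu>(2) by simp
qed

section \<open>Weak and classical solutions on an interval\<close>

text \<open>Truncation turns the almost everywhere bounds of \<open>c\<close> into bounds that hold everywhere.\<close>

lemma Linf_truncation:
  fixes H :: real
  assumes c: "Linf_on {0<..<H} c" and pos: "0 < ess_inf_on {0<..<H} c"
    and lt: "ess_inf_on {0<..<H} c < ess_sup_on {0<..<H} c"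
  obtains C where "C \<in> borel_measurable borel"
    "\<And>y. ess_inf_on {0<..<H} c \<le> C y \<and> C y \<le> ess_sup_on {0<..<H} c"
    "AE y in lborel. y \<in> {0<..<H} \<longrightarrow> C y = c y"
proof -
  let ?U = "{0<..<H}"
  define m where "m = ess_inf_on ?U c"
  define M where "M = ess_sup_on ?U c"
  let ?M = "restrict_space lborel ?U"
  have cm: "c \<in> borel_measurable ?M" using c by (simp add: Linf_on_def)
  \<comment> \<open>An infinite essential supremum is turned into \<open>0\<close> by the coercion, which the signs exclude.\<close>
  have up: "AE x in ?M. c x \<le> M"
  proof -
    have "esssup ?M (\<lambda>x. ereal (c x)) = ereal M"
      using pos lt unfolding M_def ess_sup_on_def
      by (cases "esssup ?M (\<lambda>x. ereal (c x))") auto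
    moreover have "AE x in ?M. ereal (c x) \<le> esssup ?M (\<lambda>x. ereal (c x))" by (rule esssup_AE)
    ultimately show ?thesis by simp
  qed
  have low: "AE x in ?M. m \<le> c x"
  proof -
    have "esssup ?M (\<lambda>x. ereal (- c x)) = ereal (- m)"
      using pos unfolding m_def ess_inf_on_def ess_sup_on_def
      by (cases "esssup ?M (\<lambda>x. ereal (- c x))") auto
    moreover have "AE x in ?M. ereal (- c x) \<le> esssup ?M (\<lambda>x. ereal (- c x))" by (rule esssup_AE)
    ultimately show ?thesis by simp
  qed
  define C where "C y = max m (min M (indicator ?U y * c y))" for y
  show ?thesis
  proof (rule that[of C])
    have "(\<lambda>y. indicator ?U y *\<^sub>R c y) \<in> borel_measurable lborel"
      using cm by (subst (asm) borel_measurable_restrict_space_iff) auto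
    then have [measurable]: "(\<lambda>y. indicator ?U y * c y) \<in> borel_measurable borel" by simp
    show "C \<in> borel_measurable borel" unfolding C_def[abs_def] by measurable
    show "ess_inf_on ?U c \<le> C y \<and> C y \<le> ess_sup_on ?U c" for y
      using lt by (auto simp: C_def m_def M_def)
    have "AE y in lborel. y \<in> ?U \<longrightarrow> c y \<le> M" "AE y in lborel. y \<in> ?U \<longrightarrow> m \<le> c y"
      using up low by (simp_all add: AE_restrict_space_iff)
    then show "AE y in lborel. y \<in> ?U \<longrightarrow> C y = c y"
      by eventually_elim (auto simp: C_def)
  qed
qed

lemma potential_bounded:
  fixes C :: "real \<Rightarrow> real"
  assumes C: "C \<in> borel_measurable borel" "\<And>y. m \<le> C y" "m > 0"
  shows "(\<lambda>y. l / C y - q) \<in> borel_measurable borel" "\<bar>l / C y - q\<bar> \<le> \<bar>l\<bar> / m + \<bar>q\<bar>"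
proof -
  show "(\<lambda>y. l / C y - q) \<in> borel_measurable borel" using C(1) by measurable
  have "0 < C y" using C(2)[of y] C(3) by linarith
  then have "\<bar>l / C y\<bar> \<le> \<bar>l\<bar> / m"
    using divide_left_mono[OF C(2)[of y], of "\<bar>l\<bar>"] C(3) by (simp add: abs_divide)
  then show "\<bar>l / C y - q\<bar> \<le> \<bar>l\<bar> / m + \<bar>q\<bar>" by linarith
qed

lemma test_fun_outside: "test_fun U \<psi> \<Longrightarrow> x \<notin> U \<Longrightarrow> \<psi> x = 0"
  unfolding test_fun_def using closure_subset[of "{x. \<psi> x \<noteq> 0}"] by blast

lemma test_fun_continuous: "test_fun U \<psi> \<Longrightarrow> continuous_on A \<psi>"
  unfolding test_fun_def using smooth_on_continuous continuous_on_subset by blast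

lemma test_fun_lip_primitive:
  assumes "test_fun U \<psi>" shows "lip_primitive \<alpha> \<beta> \<psi> (partial 1 \<psi>)"
proof (rule lip_primitive_C1)
  have "smooth_on UNIV \<psi>" using assms by (simp add: test_fun_def)
  from smooth_on_has_real_derivative[OF open_UNIV this]
  show "(\<psi> has_real_derivative partial 1 \<psi> t) (at t within {\<alpha>..\<beta>})" for t
    by (auto intro: has_field_derivative_at_within)
  show "continuous_on {\<alpha>..\<beta>} (partial 1 \<psi>)"
    by (rule test_fun_continuous[OF test_fun_partial[OF assms]]) simp
qed

lemma test_fun_antiderivative:
  fixes f :: "real \<Rightarrow> real"
  assumes f: "smooth_on UNIV f" "\<And>x. x \<le> \<alpha> \<or> \<beta> \<le> x \<Longrightarrow> f x = 0"
    and I: "integral {\<alpha>..\<beta>} f = 0" and \<alpha>\<beta>: "\<alpha> \<le> \<beta>" "{\<alpha>..\<beta>} \<subseteq> U"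
  obtains \<psi> where "test_fun U \<psi>" "\<And>x. partial 1 \<psi> x = f x" "\<And>x. x \<ge> \<alpha> \<Longrightarrow> \<psi> x = integral {\<alpha>..x} f"
    "\<And>x. x \<le> \<alpha> \<Longrightarrow> \<psi> x = 0"
proof -
  obtain \<psi> where \<psi>: "\<And>x. (\<psi> has_real_derivative f x) (at x)" "\<psi> \<alpha> = 0"
    using obtain_antiderivative[OF smooth_on_continuous[OF f(1)]] by metis
  have int: "\<psi> x = integral {\<alpha>..x} f" if "x \<ge> \<alpha>" for x
  proof -
    have "(f has_integral \<psi> x - \<psi> \<alpha>) {\<alpha>..x}"
      using that \<psi>(1) by (intro fundamental_theorem_of_calculus)
        (auto simp: has_real_derivative_iff_has_vector_derivative[symmetric] intro: has_field_derivative_at_within)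
    then show ?thesis using \<psi>(2) by (simp add: integral_unique)
  qed
  have const: "\<psi> x = \<psi> y" if "convex S" "x \<in> S" "y \<in> S" "\<And>z. z \<in> S \<Longrightarrow> f z = 0" for S x y
  proof -
    have "\<exists>c. \<forall>x\<in>S. \<psi> x = c"
    proof (rule has_field_derivative_zero_constant[OF that(1)])
      fix z assume "z \<in> S"
      then show "(\<psi> has_field_derivative 0) (at z within S)"
        using \<psi>(1)[of z] that(4)[of z] by (auto intro: has_field_derivative_at_within)
    qed
    then show ?thesis using that by auto
  qed
  have left: "\<psi> x = 0" if "x \<le> \<alpha>" for x
    using const[of "{..\<alpha>}" x \<alpha>] that f(2) \<psi>(2) by auto
  have right: "\<psi> x = 0" if "x \<ge> \<beta>" for x
    using const[of "{\<beta>..}" x \<beta>] that f(2) int[OF \<alpha>\<beta>(1)] I by auto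
  show ?thesis
  proof (rule that[of \<psi>])
    show "test_fun U \<psi>"
    proof (rule test_funI[OF _ compact_Icc[of \<alpha> \<beta>]])
      show "smooth_on UNIV \<psi>" by (rule smooth_on_antiderivative[OF open_UNIV \<psi>(1) f(1)])
      show "\<psi> x = 0" if "x \<notin> {\<alpha>..\<beta>}" for x using that left[of x] right[of x] by auto
    qed (rule \<alpha>\<beta>)
    show "partial 1 \<psi> x = f x" for x by (rule partial_real_eqI[OF \<psi>(1)])
  qed (use int left in auto)
qed

lemma integral_by_parts_test_fun:
  assumes F: "lip_primitive 0 H F p" and \<psi>: "test_fun {0<..<H} \<psi>" and H: "H > 0"
  shows "integral {0..H} (\<lambda>t. F t * partial 1 \<psi> t) = - integral {0..H} (\<lambda>t. p t * \<psi> t)"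
proof -
  have "((\<lambda>t. p t * \<psi> t + F t * partial 1 \<psi> t) has_integral F H * \<psi> H - F 0 * \<psi> 0) {0..H}"
    by (rule lip_primitiveD[OF lip_primitive_mult[OF F test_fun_lip_primitive[OF \<psi>]]]) (use H in auto)
  moreover have "\<psi> H = 0" "\<psi> 0 = 0" using test_fun_outside[OF \<psi>] by auto
  ultimately have "integral {0..H} (\<lambda>t. p t * \<psi> t + F t * partial 1 \<psi> t) = 0" by (simp add: integral_unique)
  moreover have "(\<lambda>t. p t * \<psi> t) integrable_on {0..H}"
    using absolutely_integrable_continuous_mult[OF test_fun_continuous[OF \<psi>], of 0 H p] F
      set_lebesgue_integral_eq_integral(1) by (force simp: lip_primitive_def mult.commute)
  moreover have "(\<lambda>t. F t * partial 1 \<psi> t) integrable_on {0..H}"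
    by (intro integrable_continuous_real continuous_intros lip_primitive_continuous[OF F]
        test_fun_continuous[OF test_fun_partial[OF \<psi>]]) simp
  ultimately show ?thesis by (simp add: Henstock_Kurzweil_Integration.integral_add)
qed

lemma set_integrable_mult_continuous:
  fixes q f :: "real \<Rightarrow> real"
  assumes q: "q \<in> borel_measurable borel" "\<And>y. \<bar>q y\<bar> \<le> M" and f: "continuous_on {0..H} f"
  shows "set_integrable lborel {0<..<H} (\<lambda>y. q y * f y)"
proof -
  have f': "set_integrable lborel {0<..<H} f"
    by (rule set_integrable_subset[OF borel_integrable_atLeastAtMost'[OF f]]) auto
  then have "integrable lborel (\<lambda>y. indicator {0<..<H} y *\<^sub>R f y)" by (simp add: set_integrable_def)
  then have "integrable lborel (\<lambda>y. M * (indicator {0<..<H} y *\<^sub>R f y))" by simp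
  then have "integrable lborel (\<lambda>y. q y * (indicator {0<..<H} y *\<^sub>R f y))"
  proof (rule Bochner_Integration.integrable_bound)
    show "(\<lambda>y. q y * (indicator {0<..<H} y *\<^sub>R f y)) \<in> borel_measurable lborel"
      using q(1) borel_measurable_integrable[OF f'[unfolded set_integrable_def]] by measurable
    have "\<bar>q y * (indicator {0<..<H} y *\<^sub>R f y)\<bar> \<le> \<bar>M * (indicator {0<..<H} y *\<^sub>R f y)\<bar>" for y
      unfolding abs_mult using q(2)[of y] by (intro mult_right_mono) auto
    then show "AE y in lborel. norm (q y * (indicator {0<..<H} y *\<^sub>R f y)) \<le> norm (M * (indicator {0<..<H} y *\<^sub>R f y))"
      by simp
  qed
  then show ?thesis by (simp add: set_integrable_def mult_ac)
qed

lemma LINT_eq_integral: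
  fixes f :: "real \<Rightarrow> real"
  assumes "set_integrable lborel {0<..<H} f"
  shows "(LINT y:{0<..<H}|lborel. f y) = integral {0..H} f"
  using set_borel_integral_eq_integral(2)[OF assms] integral_open_interval_real[of 0 H f] by simp

lemma LINT_eq_integral_continuous:
  fixes f :: "real \<Rightarrow> real"
  assumes "continuous_on {0..H} f"
  shows "(LINT y:{0<..<H}|lborel. f y) = integral {0..H} f" "set_integrable lborel {0<..<H} f"
proof -
  show "set_integrable lborel {0<..<H} f"
    by (rule set_integrable_subset[OF borel_integrable_atLeastAtMost'[OF assms]]) auto
  then show "(LINT y:{0<..<H}|lborel. f y) = integral {0..H} f" by (rule LINT_eq_integral)
qed

lemma continuous_zero_if_AE_zero:
  fixes f :: "real \<Rightarrow> real"
  assumes f: "continuous_on {\<alpha>..\<beta>} f" and "\<alpha> < \<beta>" and ae: "AE x in lborel. x \<in> {\<alpha><..<\<beta>} \<longrightarrow> f x = 0"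
    and x: "x \<in> {\<alpha>..\<beta>}"
  shows "f x = 0"
proof -
  have c: "continuous_on {\<alpha>..\<beta>} (\<lambda>x. (f x)\<^sup>2)" by (intro continuous_intros f)
  have s: "set_integrable lborel {\<alpha>..\<beta>} (\<lambda>x. (f x)\<^sup>2)" by (rule borel_integrable_atLeastAtMost'[OF c])
  have "AE x in lborel. x \<noteq> \<alpha>" "AE x in lborel. x \<noteq> \<beta>" by (rule AE_lborel_singleton)+
  with ae have "AE x in lborel. indicator {\<alpha>..\<beta>} x *\<^sub>R (f x)\<^sup>2 = 0"
    by eventually_elim (auto simp: indicator_def)
  then have "(LINT x:{\<alpha>..\<beta>}|lborel. (f x)\<^sup>2) = 0"
    unfolding set_lebesgue_integral_def by (rule integral_eq_zero_AE)
  then have "integral {\<alpha>..\<beta>} (\<lambda>x. (f x)\<^sup>2) = 0"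
    using set_borel_integral_eq_integral(2)[OF s] by simp
  then have "(f x)\<^sup>2 = 0"
    using integral_eq_0_iff[OF c \<open>\<alpha> < \<beta>\<close>] x by simp
  then show ?thesis by simp
qed

text \<open>The du Bois-Reymond lemma. Testing with primitives of \<open>\<rho> P - (const) \<rho>\<close>, for a bump \<open>\<rho>\<close> and
polynomials \<open>P\<close>, shows that all moments of \<open>(w - mean) \<rho>\<close> vanish.\<close>

lemma constant_if_weak_derivative_zero:
  fixes w :: "real \<Rightarrow> real"
  assumes w: "continuous_on {0..H} w" and H: "H > 0"
    and zero: "\<And>\<psi>. test_fun {0<..<H} \<psi> \<Longrightarrow> integral {0..H} (\<lambda>t. w t * partial 1 \<psi> t) = 0"
  shows "\<exists>k. \<forall>t\<in>{0..H}. w t = k"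
proof -
  have inner: "\<exists>k. \<forall>t\<in>{\<alpha><..<\<beta>}. w t = k" if \<alpha>\<beta>: "0 < \<alpha>" "\<alpha> < \<beta>" "\<beta> < H" for \<alpha> \<beta>
  proof -
    obtain \<rho> :: "real \<Rightarrow> real" where \<rho>: "smooth_on UNIV \<rho>" "\<And>x. \<alpha> < x \<Longrightarrow> x < \<beta> \<Longrightarrow> \<rho> x > 0"
      "\<And>x. x \<le> \<alpha> \<or> \<beta> \<le> x \<Longrightarrow> \<rho> x = 0" "\<And>x. \<rho> x \<ge> 0"
      using obtain_bump by metis
    have c\<rho>: "continuous_on S \<rho>" for S by (rule smooth_on_UNIV_continuous[OF \<rho>(1)])
    have cw: "continuous_on {\<alpha>..\<beta>} w" using w by (rule continuous_on_subset) (use \<alpha>\<beta> in auto)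
    define J where "J f = integral {\<alpha>..\<beta>} f" for f :: "real \<Rightarrow> real"
    have J\<rho>: "J \<rho> \<noteq> 0"
    proof
      assume "J \<rho> = 0"
      then have "\<rho> ((\<alpha> + \<beta>) / 2) = 0"
        using integral_eq_0_iff[OF c\<rho> \<alpha>\<beta>(2)] \<rho>(4) \<alpha>\<beta> by (auto simp: J_def)
      then show False using \<rho>(2)[of "(\<alpha> + \<beta>) / 2"] \<alpha>\<beta> by simp
    qed
    define k where "k = J (\<lambda>x. w x * \<rho> x) / J \<rho>"
    define W where "W x = (if x \<in> {\<alpha>..\<beta>} then (w x - k) * \<rho> x else 0)" for x
    have W: "integrable lborel (\<lambda>x. W x)"
    proof -
      have "set_integrable lborel {\<alpha>..\<beta>} (\<lambda>x. (w x - k) * \<rho> x)"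
        by (rule borel_integrable_atLeastAtMost') (intro continuous_intros cw c\<rho>)
      then show ?thesis unfolding set_integrable_def
        by (rule Bochner_Integration.integrable_cong[THEN iffD1, rotated 2]) (auto simp: W_def)
    qed
    have "AE x in lborel. W x = 0"
    proof (rule AE_zero_if_moments_zero[OF W compact_Icc[of \<alpha> \<beta>]])
      fix P :: "real \<Rightarrow> real" assume P: "real_polynomial_function P"
      have sP: "smooth_on UNIV P" by (rule smooth_on_polynomial[OF open_UNIV P])
      have cP: "continuous_on S P" for S by (rule smooth_on_UNIV_continuous[OF sP])
      define a where "a = J (\<lambda>x. \<rho> x * P x) / J \<rho>"
      define f where "f x = \<rho> x * P x - a * \<rho> x" for x
      have sf: "smooth_on UNIV f"
        unfolding f_def[abs_def] by (intro smooth_on_diff smooth_on_simps(4) smooth_on_simps(1) \<rho> sP open_UNIV)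
      have i: "g integrable_on {\<alpha>..\<beta>}" if "continuous_on {\<alpha>..\<beta>} g" for g :: "real \<Rightarrow> real"
        using that by (rule integrable_continuous_real)
      have "integral {\<alpha>..\<beta>} f = J (\<lambda>x. \<rho> x * P x) - a * J \<rho>"
        unfolding f_def J_def
        by (subst Henstock_Kurzweil_Integration.integral_diff) (auto intro!: i continuous_intros c\<rho> cP)
      then have f0: "integral {\<alpha>..\<beta>} f = 0" using J\<rho> by (simp add: a_def)
      obtain \<psi> where \<psi>: "test_fun {0<..<H} \<psi>" "\<And>x. partial 1 \<psi> x = f x"
        by (rule test_fun_antiderivative[OF sf _ f0 less_imp_le[OF \<alpha>\<beta>(2)], of "{0<..<H}"])
          (use \<alpha>\<beta> \<rho>(3) in \<open>auto simp: f_def\<close>)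
      have "0 = integral {0..H} (\<lambda>t. w t * f t)" using zero[OF \<psi>(1)] \<psi>(2) by simp
      also have "\<dots> = integral {\<alpha>..\<beta>} (\<lambda>t. w t * f t)"
      proof (rule integral_unique, rule has_integral_on_superset[OF integrable_integral])
        show "(\<lambda>t. w t * f t) integrable_on {\<alpha>..\<beta>}"
          unfolding f_def by (intro i continuous_intros cw c\<rho> cP)
      qed (use \<alpha>\<beta> \<rho>(3) in \<open>auto simp: f_def\<close>)
      also have "\<dots> = integral {\<alpha>..\<beta>} (\<lambda>t. w t * \<rho> t * P t - a * (w t * \<rho> t))"
        by (simp add: f_def algebra_simps)
      also have "\<dots> = J (\<lambda>t. w t * \<rho> t * P t) - a * J (\<lambda>t. w t * \<rho> t)"
        unfolding J_def
        by (subst Henstock_Kurzweil_Integration.integral_diff) (auto intro!: i continuous_intros c\<rho> cP cw)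
      also have "a * J (\<lambda>t. w t * \<rho> t) = k * J (\<lambda>t. \<rho> t * P t)" by (simp add: a_def k_def)
      also have "J (\<lambda>t. w t * \<rho> t * P t) - k * J (\<lambda>t. \<rho> t * P t) = J (\<lambda>t. w t * \<rho> t * P t - k * (\<rho> t * P t))"
        unfolding J_def
        by (subst Henstock_Kurzweil_Integration.integral_diff) (auto intro!: i continuous_intros c\<rho> cP cw)
      also have "\<dots> = J (\<lambda>t. (w t - k) * \<rho> t * P t)" by (simp add: algebra_simps)
      finally have J0: "J (\<lambda>t. (w t - k) * \<rho> t * P t) = 0" by simp
      have "(LINT x|lborel. W x * P x) = (LINT x:{\<alpha>..\<beta>}|lborel. (w x - k) * \<rho> x * P x)"
        unfolding set_lebesgue_integral_def by (rule Bochner_Integration.integral_cong) (auto simp: W_def)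
      also have "\<dots> = J (\<lambda>t. (w t - k) * \<rho> t * P t)"
        unfolding J_def
        by (rule set_borel_integral_eq_integral(2), rule borel_integrable_atLeastAtMost')
          (intro continuous_intros cw c\<rho> cP)
      finally show "(LINT x|lborel. W x * P x) = 0" using J0 by simp
    qed (auto simp: W_def)
    then have ae: "AE x in lborel. x \<in> {\<alpha><..<\<beta>} \<longrightarrow> (w x - k) * \<rho> x = 0"
      by eventually_elim (auto simp: W_def)
    have "w t = k" if t: "t \<in> {\<alpha><..<\<beta>}" for t
    proof -
      have "(w t - k) * \<rho> t = 0"
        by (rule continuous_zero_if_AE_zero[OF _ \<alpha>\<beta>(2) ae]) (use t in \<open>auto intro!: continuous_intros cw c\<rho>\<close>)
      then show ?thesis using \<rho>(2)[of t] t by simp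
    qed
    then show ?thesis by blast
  qed
  have open_const: "w t = w (H/2)" if t: "t \<in> {0<..<H}" for t
  proof -
    define \<alpha> where "\<alpha> = min t (H/2) / 2"
    define \<beta> where "\<beta> = (max t (H/2) + H) / 2"
    have ab: "0 < \<alpha>" "\<alpha> < t" "\<alpha> < H/2" "t < \<beta>" "H/2 < \<beta>" "\<beta> < H"
      using t H unfolding \<alpha>_def \<beta>_def by (auto simp: min_def max_def)
    then show ?thesis using inner[of \<alpha> \<beta>] by force
  qed
  then have ae: "AE t in lborel. t \<in> {0<..<H} \<longrightarrow> w t - w (H/2) = 0"
    by (intro AE_I2) (metis diff_self)
  have "continuous_on {0..H} (\<lambda>t. w t - w (H/2))" by (intro continuous_intros w)
  from continuous_zero_if_AE_zero[OF this H ae] show ?thesis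
    by (metis eq_iff_diff_eq_0)
qed

text \<open>The weak equation says that \<open>u' + \<integral> Q u\<close> has weak derivative zero.\<close>

lemma eigenfunction_sturm_solution:
  assumes H: "H > 0" and C: "C \<in> borel_measurable borel" "\<And>y. m \<le> C y" "m > 0"
    and Cc: "AE y in lborel. y \<in> {0<..<H} \<longrightarrow> C y = c y"
    and u: "eigenfunction c q {0<..<H} l u"
    and v: "continuous_on {0..H} v" "\<And>y. y \<in> {0..H} \<Longrightarrow> (u has_vector_derivative v y) (at y within {0..H})"
  shows "sturm_solution H (\<lambda>y. l / C y - q) u v"
proof -
  define U where "U = {0<..<H}"
  define Q where "Q y = l / C y - q" for y
  have Cpos: "C y > 0" for y using C(2)[of y] C(3) by linarith
  have Qm: "Q \<in> borel_measurable borel" and Qb: "\<bar>Q y\<bar> \<le> \<bar>l\<bar> / m + \<bar>q\<bar>" for y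
    unfolding Q_def[abs_def] by (rule potential_bounded[OF C])+
  have du: "(u has_real_derivative v y) (at y within {0..H})" if "y \<in> {0..H}" for y
    using v(2)[OF that] by (simp add: has_real_derivative_iff_has_vector_derivative)
  have lu: "lip_primitive 0 H u v" by (rule lip_primitive_C1[OF du v(1)])
  have cu: "continuous_on {0..H} u" by (rule lip_primitive_continuous[OF lu])
  define p where "p y = Q y * u y" for y
  define W where "W t = integral {0..t} p" for t
  have p_int: "p absolutely_integrable_on {0..H}"
  proof -
    have "set_integrable lborel {0<..<H} p" unfolding p_def[abs_def] by (rule set_integrable_mult_continuous[OF Qm Qb cu])
    then have "set_integrable lebesgue {0<..<H} p"
      unfolding set_integrable_def using borel_measurable_integrable integrable_completion by blast
    then show ?thesis using absolutely_integrable_on_open_interval[where f = p and a = 0 and b = H] by simp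
  qed
  have lW: "lip_primitive 0 H W p"
  proof (rule lip_primitive_integral[where c = 0])
    obtain B where B: "\<And>y. y \<in> {0..H} \<Longrightarrow> \<bar>u y\<bar> \<le> B"
      by (rule continuous_on_Icc_bounded[OF cu]) blast+
    have "\<bar>p y\<bar> \<le> (\<bar>l\<bar> / m + \<bar>q\<bar>) * B" if "y \<in> {0..H}" for y
      unfolding p_def abs_mult using Qb[of y] B[OF that] by (intro mult_mono) (auto intro: order_trans[OF abs_ge_zero])
    then show "bounded (p ` {0..H})" unfolding bounded_iff by (auto intro!: exI[of _ "(\<bar>l\<bar> / m + \<bar>q\<bar>) * B"])
  qed (use p_int in \<open>auto simp: W_def\<close>)
  obtain h g where g: "weak_deriv U 1 u g" "weak_deriv U 1 g h" "h \<in> L2_on U"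
    and h: "AE y\<in>U in lborel. c y * (q * u y - h y) = l * u y"
    using u unfolding eigenfunction_def weak_laplacian_def U_def[symmetric] by auto
  have hQ: "AE y in lborel. y \<in> U \<longrightarrow> h y = - p y"
    using h Cc unfolding U_def[symmetric]
  proof eventually_elim
    case (elim y)
    then show ?case using Cpos[of y] by (auto simp: p_def Q_def field_simps)
  qed
  have "\<exists>k. \<forall>t\<in>{0..H}. v t + W t = k"
  proof (rule constant_if_weak_derivative_zero[OF _ H])
    show cvW: "continuous_on {0..H} (\<lambda>t. v t + W t)" by (intro continuous_intros v lip_primitive_continuous[OF lW])
    fix \<psi> assume \<psi>: "test_fun {0<..<H} \<psi>"
    define \<psi>1 where "\<psi>1 = partial 1 \<psi>"
    have \<psi>1: "test_fun {0<..<H} \<psi>1" unfolding \<psi>1_def by (rule test_fun_partial[OF \<psi>]) simp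
    have \<psi>2: "test_fun {0<..<H} (partial 1 \<psi>1)" by (rule test_fun_partial[OF \<psi>1]) simp
    have "(LINT y:U|lborel. u y * partial 1 \<psi>1 y) = - (LINT y:U|lborel. g y * \<psi>1 y)"
      using g(1) \<psi>1 unfolding weak_deriv_def U_def by blast
    also have "(LINT y:U|lborel. g y * \<psi>1 y) = - (LINT y:U|lborel. h y * \<psi> y)"
      using g(2) \<psi> unfolding weak_deriv_def U_def \<psi>1_def by blast
    also have "(LINT y:U|lborel. h y * \<psi> y) = (LINT y:U|lborel. - (p y * \<psi> y))"
      unfolding set_lebesgue_integral_def
    proof (rule integral_cong_AE)
      have m\<psi>: "\<psi> \<in> borel_measurable borel" using test_fun_continuous[OF \<psi>] by (rule borel_measurable_continuous_onI)
      have "(\<lambda>y. indicator U y *\<^sub>R h y) \<in> borel_measurable lborel"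
        using g(3) by (simp add: L2_on_def set_borel_measurable_def)
      then have "(\<lambda>y. (indicator U y *\<^sub>R h y) * \<psi> y) \<in> borel_measurable lborel" using m\<psi> by measurable
      then show "(\<lambda>y. indicator U y *\<^sub>R (h y * \<psi> y)) \<in> borel_measurable lborel" by (simp add: mult.assoc)
      have "set_integrable lborel U (\<lambda>y. Q y * (u y * \<psi> y))" unfolding U_def
        by (rule set_integrable_mult_continuous[OF Qm Qb]) (intro continuous_intros cu test_fun_continuous[OF \<psi>])
      then have "(\<lambda>y. indicator U y *\<^sub>R (Q y * (u y * \<psi> y))) \<in> borel_measurable lborel"
        unfolding set_integrable_def by (rule borel_measurable_integrable)
      then have "(\<lambda>y. - (indicator U y *\<^sub>R (Q y * (u y * \<psi> y)))) \<in> borel_measurable lborel" by (rule borel_measurable_uminus)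
      then show "(\<lambda>y. indicator U y *\<^sub>R - (p y * \<psi> y)) \<in> borel_measurable lborel" by (simp add: p_def mult.assoc)
      show "AE y in lborel. indicator U y *\<^sub>R (h y * \<psi> y) = indicator U y *\<^sub>R - (p y * \<psi> y)"
        using hQ by eventually_elim (auto simp: indicator_def)
    qed
    also have "\<dots> = - (LINT y:U|lborel. p y * \<psi> y)" by (simp add: set_lebesgue_integral_def)
    also have "(LINT y:U|lborel. p y * \<psi> y) = integral {0..H} (\<lambda>y. p y * \<psi> y)"
    proof -
      have "set_integrable lborel U (\<lambda>y. Q y * (u y * \<psi> y))" unfolding U_def
        by (rule set_integrable_mult_continuous[OF Qm Qb]) (intro continuous_intros cu test_fun_continuous[OF \<psi>])
      then show ?thesis unfolding U_def by (intro LINT_eq_integral) (simp add: p_def mult.assoc)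
    qed
    also have "integral {0..H} (\<lambda>y. p y * \<psi> y) = - integral {0..H} (\<lambda>y. W y * \<psi>1 y)"
      using integral_by_parts_test_fun[OF lW \<psi> H] by (simp add: \<psi>1_def)
    finally have e1: "(LINT y:U|lborel. u y * partial 1 \<psi>1 y) = integral {0..H} (\<lambda>y. W y * \<psi>1 y)" by simp
    have "(LINT y:U|lborel. u y * partial 1 \<psi>1 y) = integral {0..H} (\<lambda>y. u y * partial 1 \<psi>1 y)"
      unfolding U_def by (rule LINT_eq_integral_continuous) (intro continuous_intros cu test_fun_continuous[OF \<psi>2])
    also have "\<dots> = - integral {0..H} (\<lambda>y. v y * \<psi>1 y)"
      by (rule integral_by_parts_test_fun[OF lu \<psi>1 H])
    finally have "integral {0..H} (\<lambda>y. v y * \<psi>1 y) + integral {0..H} (\<lambda>y. W y * \<psi>1 y) = 0" using e1 by simp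
    moreover have "(\<lambda>y. v y * \<psi>1 y) integrable_on {0..H}" "(\<lambda>y. W y * \<psi>1 y) integrable_on {0..H}"
      by (intro integrable_continuous_real continuous_intros v test_fun_continuous[OF \<psi>1] lip_primitive_continuous[OF lW])+
    ultimately show "integral {0..H} (\<lambda>t. (v t + W t) * partial 1 \<psi> t) = 0"
      by (simp add: \<psi>1_def distrib_right Henstock_Kurzweil_Integration.integral_add)
  qed
  then obtain k where k: "\<And>t. t \<in> {0..H} \<Longrightarrow> v t + W t = k" by blast
  have "lip_primitive 0 H v (\<lambda>y. - (Q y * u y))"
  proof -
    have 1: "lip_primitive 0 H (\<lambda>t. (-1) * W t) (\<lambda>y. (-1) * p y)" by (rule lip_primitive_cmult[OF lW])
    have "v t - v s = (-1) * W t - (-1) * W s" if "0 \<le> s" "s \<le> t" "t \<le> H" for s t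
      using k[of s] k[of t] that by auto
    then show ?thesis using 1 by (auto simp: lip_primitive_def p_def)
  qed
  then show ?thesis using du by (simp add: sturm_solution_def Q_def)
qed

section \<open>Sturm--Liouville solutions as Dirichlet eigenfunctions\<close>

lemma L2_on_set_integrable:
  fixes f :: "'a::euclidean_space \<Rightarrow> real"
  assumes U: "open U" "bounded U" and f: "f \<in> L2_on U"
  shows "set_integrable lborel U f"
proof -
  have m: "(\<lambda>x. indicator U x *\<^sub>R f x) \<in> borel_measurable lborel"
    using f by (simp add: L2_on_def set_borel_measurable_def)
  have i2: "integrable lborel (\<lambda>x. indicator U x *\<^sub>R (f x)\<^sup>2)"
    using f by (simp add: L2_on_def set_integrable_def)
  have "integrable lborel (\<lambda>x. indicator U x :: real)"
    using U emeasure_bounded_finite[of U] by (intro integrable_real_indicator) auto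
  with i2 have i: "integrable lborel (\<lambda>x. indicator U x + indicator U x *\<^sub>R (f x)\<^sup>2)"
    by (intro Bochner_Integration.integrable_add)
  have b: "\<bar>x\<bar> \<le> 1 + x\<^sup>2" for x :: real
    using sum_power2_ge_zero[of "\<bar>x\<bar> - 1/2" 0] by (simp add: power2_eq_square algebra_simps)
  show ?thesis
    unfolding set_integrable_def
    by (rule Bochner_Integration.integrable_bound[OF i m])
      (use b in \<open>auto simp: indicator_def\<close>)
qed

lemma L2_on_continuous:
  fixes f :: "real \<Rightarrow> real"
  assumes "continuous_on {0..H} f" shows "f \<in> L2_on {0<..<H}"
  using LINT_eq_integral_continuous(2)[OF assms] LINT_eq_integral_continuous(2)[of H "\<lambda>y. (f y)\<^sup>2"] assms
  unfolding L2_on_def set_borel_measurable_def set_integrable_def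
  by (auto intro: borel_measurable_integrable continuous_intros)

lemma L2_on_mult_continuous:
  fixes f q :: "real \<Rightarrow> real"
  assumes q: "q \<in> borel_measurable borel" "\<And>y. \<bar>q y\<bar> \<le> M" and f: "continuous_on {0..H} f"
  shows "(\<lambda>y. q y * f y) \<in> L2_on {0<..<H}"
proof -
  have "set_integrable lborel {0<..<H} (\<lambda>y. q y * f y)" by (rule set_integrable_mult_continuous[OF q f])
  moreover have "set_integrable lborel {0<..<H} (\<lambda>y. (q y)\<^sup>2 * (f y)\<^sup>2)"
  proof (rule set_integrable_mult_continuous)
    show "\<bar>(q y)\<^sup>2\<bar> \<le> M\<^sup>2" for y using power_mono[OF q(2)[of y], of 2] by simp
    show "(\<lambda>y. (q y)\<^sup>2) \<in> borel_measurable borel" using q(1) by measurable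
  qed (intro continuous_intros f)
  ultimately show ?thesis
    unfolding L2_on_def set_borel_measurable_def set_integrable_def
    by (auto intro: borel_measurable_integrable simp: power_mult_distrib)
qed

lemma weak_deriv_lip_primitive:
  assumes H: "H > 0" and F: "lip_primitive 0 H F (\<lambda>y. q y * f y)"
    and q: "q \<in> borel_measurable borel" "\<And>y. \<bar>q y\<bar> \<le> M" and f: "continuous_on {0..H} f"
  shows "weak_deriv {0<..<H} 1 F (\<lambda>y. q y * f y)"
  unfolding weak_deriv_def
proof (intro allI impI)
  fix \<psi> :: "real \<Rightarrow> real" assume \<psi>: "test_fun {0<..<H} \<psi>"
  have "(LINT y:{0<..<H}|lborel. F y * partial 1 \<psi> y) = integral {0..H} (\<lambda>y. F y * partial 1 \<psi> y)"
    by (rule LINT_eq_integral_continuous)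
      (intro continuous_intros lip_primitive_continuous[OF F] test_fun_continuous[OF test_fun_partial[OF \<psi>]], simp)
  moreover have "(LINT y:{0<..<H}|lborel. q y * f y * \<psi> y) = integral {0..H} (\<lambda>y. q y * f y * \<psi> y)"
  proof (rule LINT_eq_integral)
    have "set_integrable lborel {0<..<H} (\<lambda>y. q y * (f y * \<psi> y))"
      by (rule set_integrable_mult_continuous[OF q]) (intro continuous_intros f test_fun_continuous[OF \<psi>])
    then show "set_integrable lborel {0<..<H} (\<lambda>y. q y * f y * \<psi> y)" by (simp add: mult.assoc)
  qed
  ultimately show "(LINT y:{0<..<H}|lborel. F y * partial 1 \<psi> y) = - (LINT y:{0<..<H}|lborel. q y * f y * \<psi> y)"
    using integral_by_parts_test_fun[OF F \<psi> H] by simp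
qed

text \<open>A polynomial times a bump is a test function, so all moments of the difference times the bump vanish.\<close>

lemma weak_deriv_unique_AE:
  fixes H :: real
  assumes H: "H > 0" and g: "weak_deriv {0<..<H} 1 u g" "g \<in> L2_on {0<..<H}"
    and v: "weak_deriv {0<..<H} 1 u v" "v \<in> L2_on {0<..<H}"
  shows "AE y in lborel. y \<in> {0<..<H} \<longrightarrow> g y = v y"
proof -
  let ?U = "{0<..<H}"
  have gv: "set_integrable lborel ?U g" "set_integrable lborel ?U v"
    using L2_on_set_integrable[OF _ _ g(2)] L2_on_set_integrable[OF _ _ v(2)] by auto
  define w where "w y = indicator ?U y *\<^sub>R (g y - v y)" for y
  have w: "integrable lborel w"
    using set_integral_diff(1)[OF gv] by (simp add: set_integrable_def w_def[abs_def])
  have wz: "w y = 0" if "y \<notin> {0..H}" for y using that by (auto simp: w_def)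
  have inner: "AE y in lborel. y \<in> {\<alpha><..<\<beta>} \<longrightarrow> g y = v y" if ab: "0 < \<alpha>" "\<alpha> < \<beta>" "\<beta> < H" for \<alpha> \<beta>
  proof -
    obtain \<rho> :: "real \<Rightarrow> real" where \<rho>: "smooth_on UNIV \<rho>" "\<And>x. \<alpha> < x \<Longrightarrow> x < \<beta> \<Longrightarrow> \<rho> x > 0"
      "\<And>x. x \<le> \<alpha> \<or> \<beta> \<le> x \<Longrightarrow> \<rho> x = 0"
      using obtain_bump by metis
    have "AE y in lborel. w y * \<rho> y = 0"
    proof (rule AE_zero_if_moments_zero[OF _ compact_Icc[of 0 H]])
      show "integrable lborel (\<lambda>y. w y * \<rho> y)"
        by (rule integrable_mult_continuous[OF w compact_Icc[of 0 H] wz smooth_on_continuous[OF \<rho>(1)]])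
      show "w y * \<rho> y = 0" if "y \<notin> {0..H}" for y using wz[OF that] by simp
      fix P :: "real \<Rightarrow> real" assume P: "real_polynomial_function P"
      define \<psi> where "\<psi> y = \<rho> y * P y" for y
      have s: "smooth_on UNIV \<psi>"
        unfolding \<psi>_def[abs_def] by (intro smooth_on_simps(4) \<rho> smooth_on_polynomial P open_UNIV)
      have \<psi>: "test_fun ?U \<psi>"
        by (rule test_funI[OF s compact_Icc[of \<alpha> \<beta>]]) (use \<rho>(3) ab in \<open>auto simp: \<psi>_def\<close>)
      have int: "set_integrable lborel ?U (\<lambda>y. f y * \<psi> y)" if f: "set_integrable lborel ?U f" for f
      proof -
        have "integrable lborel (\<lambda>y. (indicator ?U y *\<^sub>R f y) * \<psi> y)"
          by (rule integrable_mult_continuous[OF f[unfolded set_integrable_def] compact_Icc[of 0 H] _ test_fun_continuous[OF \<psi>]])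
            auto
        then show ?thesis by (simp add: set_integrable_def mult.assoc)
      qed
      have "(LINT y|lborel. w y * \<rho> y * P y) = (LINT y:?U|lborel. g y * \<psi> y - v y * \<psi> y)"
        unfolding set_lebesgue_integral_def
        by (rule Bochner_Integration.integral_cong) (auto simp: w_def \<psi>_def algebra_simps)
      also have "\<dots> = (LINT y:?U|lborel. g y * \<psi> y) - (LINT y:?U|lborel. v y * \<psi> y)"
        by (rule set_integral_diff(2)[OF int[OF gv(1)] int[OF gv(2)]])
      also have "\<dots> = 0" using g(1) v(1) \<psi> unfolding weak_deriv_def by force
      finally show "(LINT y|lborel. w y * \<rho> y * P y) = 0" .
    qed
    then show ?thesis
    proof eventually_elim
      case (elim y)
      show ?case
      proof
        assume y: "y \<in> {\<alpha><..<\<beta>}"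
        then have "w y = 0" using elim \<rho>(2)[of y] by auto
        then show "g y = v y" using y ab by (simp add: w_def)
      qed
    qed
  qed
  have "AE y in lborel. y \<in> {H / (real n + 3)<..<H - H / (real n + 3)} \<longrightarrow> g y = v y" for n :: nat
  proof (rule inner)
    have "H / (real n + 3) \<le> H / 3" using H by (intro divide_left_mono) auto
    then show "H / (real n + 3) < H - H / (real n + 3)" using H by linarith
  qed (use H in auto)
  then have "AE y in lborel. \<forall>n::nat. y \<in> {H / (real n + 3)<..<H - H / (real n + 3)} \<longrightarrow> g y = v y"
    by (simp only: AE_all_countable) blast
  then show ?thesis
  proof eventually_elim
    case (elim y)
    show ?case
    proof
      assume y: "y \<in> ?U"
      define d where "d = min y (H - y)"
      have d: "d > 0" using y by (auto simp: d_def)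
      obtain n :: nat where n: "H / d < real n" using reals_Archimedean2 by blast
      have "H < d * (real n + 3)" using n d by (simp add: pos_divide_less_eq mult.commute algebra_simps)
      then have "H / (real n + 3) < d" by (simp add: pos_divide_less_eq)
      then have "y \<in> {H / (real n + 3)<..<H - H / (real n + 3)}" by (auto simp: d_def)
      then show "g y = v y" using elim by blast
    qed
  qed
qed

lemma L2_norm_tendsto_0:
  fixes f :: "nat \<Rightarrow> real \<Rightarrow> real"
  assumes f: "\<And>n. continuous_on {0..H} (f n)" and B: "\<And>n y. y \<in> {0<..<H} \<Longrightarrow> \<bar>f n y\<bar> \<le> B"
    and lim: "\<And>y. y \<in> {0<..<H} \<Longrightarrow> (\<lambda>n. f n y) \<longlonglongrightarrow> 0"
  shows "(\<lambda>n. L2_norm_on {0<..<H} (f n)) \<longlonglongrightarrow> 0"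
proof -
  let ?U = "{0<..<H}"
  have "(\<lambda>n. LINT y|lborel. indicator ?U y *\<^sub>R (f n y)\<^sup>2) \<longlonglongrightarrow> integral\<^sup>L lborel (\<lambda>y::real. 0::real)"
  proof (rule integral_dominated_convergence[where M = lborel and f = "\<lambda>_. 0"
      and s = "\<lambda>n y. indicator ?U y *\<^sub>R (f n y)\<^sup>2" and w = "\<lambda>y. indicator ?U y * B\<^sup>2"])
    show "integrable lborel (\<lambda>y. indicator ?U y * B\<^sup>2 :: real)"
      using emeasure_bounded_finite[of ?U] by (intro integrable_mult_left integrable_real_indicator) auto
    show "(\<lambda>y. indicator ?U y *\<^sub>R (f n y)\<^sup>2) \<in> borel_measurable lborel" for n
    proof -
      have "set_integrable lborel ?U (\<lambda>y. (f n y)\<^sup>2)"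
        by (rule LINT_eq_integral_continuous(2)) (intro continuous_intros f)
      then show ?thesis unfolding set_integrable_def by (rule borel_measurable_integrable)
    qed
    have "(\<lambda>n. indicator ?U y *\<^sub>R (f n y)\<^sup>2) \<longlonglongrightarrow> 0" for y
    proof (cases "y \<in> ?U")
      case True
      then show ?thesis using tendsto_power[OF lim[OF True], of 2] by simp
    qed simp
    then show "AE y in lborel. (\<lambda>n. indicator ?U y *\<^sub>R (f n y)\<^sup>2) \<longlonglongrightarrow> 0" by simp
    have "norm (indicator ?U y *\<^sub>R (f n y)\<^sup>2) \<le> indicator ?U y * B\<^sup>2" for n y
      using power_mono[OF B[of y n], of 2] by (cases "y \<in> ?U") auto
    then show "AE y in lborel. norm (indicator ?U y *\<^sub>R (f n y)\<^sup>2) \<le> indicator ?U y * B\<^sup>2" for n by simp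
  qed simp
  then have "(\<lambda>n. LINT y:?U|lborel. (f n y)\<^sup>2) \<longlonglongrightarrow> 0" by (simp add: set_lebesgue_integral_def)
  from tendsto_real_sqrt[OF this] show ?thesis by (simp add: L2_norm_on_def)
qed

text \<open>Weierstrass approximants multiplied by smooth cutoffs at both end points, the cutoffs retreating to
the end points as \<open>n\<close> grows.\<close>

lemma smooth_interior_approximation:
  fixes v :: "real \<Rightarrow> real"
  assumes H: "H > 0" and v: "continuous_on {0..H} v" and V: "\<And>y. y \<in> {0..H} \<Longrightarrow> \<bar>v y\<bar> \<le> V"
  obtains f and d :: "nat \<Rightarrow> real" where "\<And>n. smooth_on UNIV (f n)" "\<And>n. 0 < d n \<and> d n \<le> H / 5"
    "\<And>n x. x \<le> d n \<or> H - d n \<le> x \<Longrightarrow> f n x = 0"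
    "\<And>n x. x \<in> {0..H} \<Longrightarrow> \<bar>f n x\<bar> \<le> V + 1" "\<And>x. x \<in> {0<..<H} \<Longrightarrow> (\<lambda>n. f n x) \<longlonglongrightarrow> v x"
proof -
  define d where "d n = H / (real n + 5)" for n
  have d: "d n > 0" "d n \<le> H / 5" for n
    unfolding d_def using H by (simp, intro divide_left_mono) auto
  have "\<exists>P. real_polynomial_function P \<and> (\<forall>y\<in>{0..H}. \<bar>v y - P y\<bar> < 1 / (real n + 1))" for n :: nat
  proof -
    have "0 < 1 / (real n + 1)" by simp
    then obtain g where "real_polynomial_function g" "\<And>y. y \<in> {0..H} \<Longrightarrow> \<bar>v y - g y\<bar> < 1 / (real n + 1)"
      using Stone_Weierstrass_real_polynomial_function[OF compact_Icc v] by blast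
    then show ?thesis by blast
  qed
  then obtain P where P: "\<And>n::nat. real_polynomial_function (P n)"
    "\<And>n y. y \<in> {0..H} \<Longrightarrow> \<bar>v y - P n y\<bar> < 1 / (real n + 1)" by metis
  have "\<exists>\<kappa>::real \<Rightarrow> real. smooth_on UNIV \<kappa> \<and> (\<forall>x\<le>d n. \<kappa> x = 0) \<and> (\<forall>x\<ge>2 * d n. \<kappa> x = 1) \<and> (\<forall>x. 0 \<le> \<kappa> x \<and> \<kappa> x \<le> 1)" for n
    using obtain_cutoff[of "d n" "2 * d n"] d[of n] by (smt (verit, best))
  then obtain \<kappa> :: "nat \<Rightarrow> real \<Rightarrow> real" where \<kappa>: "\<And>n. smooth_on UNIV (\<kappa> n)" "\<And>n x. x \<le> d n \<Longrightarrow> \<kappa> n x = 0"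
    "\<And>n x. x \<ge> 2 * d n \<Longrightarrow> \<kappa> n x = 1" "\<And>n x. 0 \<le> \<kappa> n x \<and> \<kappa> n x \<le> 1" by metis
  define f where "f n x = \<kappa> n x * \<kappa> n (-1 * x + H) * P n x" for n x
  have sf: "smooth_on UNIV (f n)" for n
    unfolding f_def[abs_def]
    by (intro smooth_on_simps(4) \<kappa> smooth_on_polynomial P open_UNIV smooth_on_compose[OF _ _ \<kappa>(1) smooth_on_affine] subset_UNIV)
  have f0: "f n x = 0" if "x \<le> d n \<or> H - d n \<le> x" for n x
    using that \<kappa>(2)[of x n] \<kappa>(2)[of "-1 * x + H" n] by (auto simp: f_def)
  have fb: "\<bar>f n x\<bar> \<le> V + 1" if x: "x \<in> {0..H}" for n x
  proof -
    have "\<bar>f n x\<bar> \<le> 1 * 1 * \<bar>P n x\<bar>"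
      unfolding f_def abs_mult using \<kappa>(4)[of n x] \<kappa>(4)[of n "-1 * x + H"] by (intro mult_mono) auto
    moreover have "1 / (real n + 1) \<le> 1" by simp
    ultimately show ?thesis using P(2)[OF x, of n] V[OF x] by linarith
  qed
  have flim: "(\<lambda>n. f n x) \<longlonglongrightarrow> v x" if x: "x \<in> {0<..<H}" for x
  proof -
    have "(\<lambda>n. P n x) \<longlonglongrightarrow> v x"
    proof (rule LIMSEQ_I)
      fix e :: real assume "e > 0"
      then obtain N :: nat where N: "1 / e < real N" using reals_Archimedean2 by blast
      have "norm (P n x - v x) < e" if "n \<ge> N" for n
      proof -
        have "1 / e < real n + 1" using N that by linarith
        then have "1 / (real n + 1) < e" using \<open>e > 0\<close> by (simp add: pos_divide_less_eq mult.commute)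
        then show ?thesis using P(2)[of x n] x by auto
      qed
      then show "\<exists>N. \<forall>n\<ge>N. norm (P n x - v x) < e" by blast
    qed
    moreover have "\<forall>\<^sub>F n in sequentially. P n x = f n x"
    proof -
      define e where "e = min x (H - x)"
      have e: "e > 0" using x by (auto simp: e_def)
      obtain N :: nat where N: "2 * H / e < real N" using reals_Archimedean2 by blast
      have "P n x = f n x" if "n \<ge> N" for n
      proof -
        have "2 * H / e < real n + 5" using N that by linarith
        then have "2 * d n < e" using e by (simp add: d_def field_simps)
        then have "\<kappa> n x = 1" "\<kappa> n (-1 * x + H) = 1" by (auto simp: e_def intro!: \<kappa>(3))
        then show ?thesis by (simp add: f_def)
      qed
      then show ?thesis using eventually_sequentially by blast
    qed
    ultimately show ?thesis by (rule Lim_transform_eventually)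
  qed
  show ?thesis by (rule that[OF sf _ f0 fb flim]) (use d in auto)
qed

text \<open>The derivative \<open>v\<close> is replaced by a polynomial, cut off near the end points, and corrected by a
multiple of a fixed bump so that its primitive vanishes at \<open>H\<close> too.\<close>

lemma test_fun_approximation:
  assumes H: "H > 0" and du: "\<And>y. y \<in> {0..H} \<Longrightarrow> (u has_real_derivative v y) (at y within {0..H})"
    and v: "continuous_on {0..H} v" and bc: "u 0 = 0" "u H = 0"
  obtains \<psi> where "\<And>n::nat. test_fun {0<..<H} (\<psi> n)"
    "(\<lambda>n. L2_norm_on {0<..<H} (\<lambda>y. \<psi> n y - u y)) \<longlonglongrightarrow> 0"
    "(\<lambda>n. L2_norm_on {0<..<H} (\<lambda>y. partial 1 (\<psi> n) y - v y)) \<longlonglongrightarrow> 0"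
proof -
  have lu: "lip_primitive 0 H u v" by (rule lip_primitive_C1[OF du v])
  have cu: "continuous_on {0..H} u" by (rule lip_primitive_continuous[OF lu])
  obtain V where V: "\<And>y. y \<in> {0..H} \<Longrightarrow> \<bar>v y\<bar> \<le> V"
    by (rule continuous_on_Icc_bounded[OF v]) blast+
  have V0: "V \<ge> 0" using V[of 0] H by auto
  obtain f and d :: "nat \<Rightarrow> real" where sf: "\<And>n. smooth_on UNIV (f n)" and dd: "\<And>n. 0 < d n \<and> d n \<le> H / 5"
    and f0: "\<And>n x. x \<le> d n \<or> H - d n \<le> x \<Longrightarrow> f n x = 0"
    and fb: "\<And>n x. x \<in> {0..H} \<Longrightarrow> \<bar>f n x\<bar> \<le> V + 1"
    and flim: "\<And>x. x \<in> {0<..<H} \<Longrightarrow> (\<lambda>n. f n x) \<longlonglongrightarrow> v x"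
    by (rule smooth_interior_approximation[OF H v V]) blast+
  have d: "d n > 0" "d n \<le> H / 5" for n using dd[of n] by auto
  obtain \<rho>0 :: "real \<Rightarrow> real" where \<rho>0: "smooth_on UNIV \<rho>0" "\<And>x. H/3 < x \<Longrightarrow> x < 2*H/3 \<Longrightarrow> \<rho>0 x > 0"
      "\<And>x. x \<le> H/3 \<or> 2*H/3 \<le> x \<Longrightarrow> \<rho>0 x = 0" "\<And>x. \<rho>0 x \<ge> 0"
    using obtain_bump by metis
  have c\<rho>0: "continuous_on S \<rho>0" for S by (rule smooth_on_UNIV_continuous[OF \<rho>0(1)])
  define R where "R = integral {0..H} \<rho>0"
  have R: "R \<noteq> 0"
  proof
    assume "R = 0"
    then have "\<rho>0 (H / 2) = 0"
      using integral_eq_0_iff[OF c\<rho>0 H] \<rho>0(4) H by (auto simp: R_def)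
    then show False using \<rho>0(2)[of "H / 2"] H by simp
  qed
  define \<rho> where "\<rho> x = (1 / R) * \<rho>0 x" for x
  have s\<rho>: "smooth_on UNIV \<rho>" unfolding \<rho>_def[abs_def] by (intro smooth_on_simps(4) smooth_on_simps(1) \<rho>0 open_UNIV)
  have c\<rho>: "continuous_on S \<rho>" for S by (rule smooth_on_UNIV_continuous[OF s\<rho>])
  have cf: "continuous_on S (f n)" for S n by (rule smooth_on_UNIV_continuous[OF sf])
  have I\<rho>: "integral {0..H} \<rho> = 1" using R by (simp add: \<rho>_def[abs_def] R_def)
  obtain B where B: "\<And>y. y \<in> {0..H} \<Longrightarrow> \<bar>\<rho> y\<bar> \<le> B"
    by (rule continuous_on_Icc_bounded[OF c\<rho>]) blast+
  \<comment> \<open>The defect \<open>a n\<close> tends to \<open>u H - u 0 = 0\<close>, so the correction by \<open>a n * \<rho>\<close> is harmless.\<close>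
  define a where "a n = integral {0..H} (f n)" for n
  have int_lim: "(\<lambda>n. integral {0..x} (F n)) \<longlonglongrightarrow> integral {0..x} v"
    if x: "x \<in> {0..H}" and F: "\<And>n. continuous_on {0..H} (F n)" "\<And>n y. y \<in> {0..H} \<Longrightarrow> \<bar>F n y\<bar> \<le> K"
      "\<And>y. y \<in> {0<..<H} \<Longrightarrow> (\<lambda>n. F n y) \<longlonglongrightarrow> v y" for x K and F :: "nat \<Rightarrow> real \<Rightarrow> real"
  proof -
    have "(\<lambda>n. integral {0<..<x} (F n)) \<longlonglongrightarrow> integral {0<..<x} v"
    proof (rule dominated_convergence(2)[where h = "\<lambda>_. K"])
      show "F n integrable_on {0<..<x}" for n
      proof -
        have "F n integrable_on {0..x}"
          by (intro integrable_continuous_real continuous_on_subset[OF F(1)]) (use x in auto)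
        then show ?thesis by (simp add: integrable_on_Icc_iff_Ioo)
      qed
      have "(\<lambda>_. K) integrable_on {0..x}" by (rule integrable_const_ivl)
      then show "(\<lambda>_. K) integrable_on {0<..<x}" by (simp add: integrable_on_Icc_iff_Ioo)
    qed (use F x in auto)
    then show ?thesis by (simp add: integral_open_interval_real)
  qed
  have Iv: "integral {0..x} v = u x" if "x \<in> {0..H}" for x
    using integral_unique[OF lip_primitiveD[OF lu, of 0 x]] that bc by simp
  have "(\<lambda>n. a n) \<longlonglongrightarrow> integral {0..H} v"
    unfolding a_def by (rule int_lim[where K = "V + 1"]) (use H fb flim cf in auto)
  then have alim: "a \<longlonglongrightarrow> 0" using Iv[of H] H bc by simp
  have ab: "\<bar>a n\<bar> \<le> (V + 1) * H" for n
  proof -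
    have "norm (integral {0..H} (f n)) \<le> (V + 1) * (H - 0)"
      by (rule integral_bound) (use H fb cf in auto)
    then show ?thesis by (simp add: a_def)
  qed
  define F where "F n x = f n x - a n * \<rho> x" for n x
  have sF: "smooth_on UNIV (F n)" for n
    unfolding F_def[abs_def] by (intro smooth_on_diff smooth_on_simps(4) smooth_on_simps(1) sf s\<rho> open_UNIV)
  have F0: "F n x = 0" if "x \<le> d n \<or> H - d n \<le> x" for n x
    using f0[OF that] \<rho>0(3)[of x] that d(2)[of n] H by (auto simp: F_def \<rho>_def)
  have cF: "continuous_on S (F n)" for S n by (rule smooth_on_UNIV_continuous[OF sF])
  define K where "K = (V + 1) + (V + 1) * H * B"
  have FK: "\<bar>F n x\<bar> \<le> K" if x: "x \<in> {0..H}" for n x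
  proof -
    have "\<bar>a n * \<rho> x\<bar> \<le> (V + 1) * H * B" unfolding abs_mult
      using ab[of n] B[OF x] V0 H by (intro mult_mono) auto
    then show ?thesis using fb[OF x, of n] unfolding F_def K_def by linarith
  qed
  have Flim: "(\<lambda>n. F n x) \<longlonglongrightarrow> v x" if x: "x \<in> {0<..<H}" for x
    using tendsto_diff[OF flim[OF x] tendsto_mult_right[OF alim, of "\<rho> x"]] by (simp add: F_def)
  have dH: "d n \<le> H - d n" "{d n..H - d n} \<subseteq> {0<..<H}" for n using d[of n] H by auto
  have IF0: "integral {d n..x} (F n) = integral {0..x} (F n)" if "d n \<le> x" for n x
  proof -
    have "integral {0..d n} (F n) + integral {d n..x} (F n) = integral {0..x} (F n)"
      by (rule Henstock_Kurzweil_Integration.integral_combine)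
        (use that d(1)[of n] in \<open>auto intro!: integrable_continuous_real cF\<close>)
    moreover have "integral {0..d n} (F n) = integral {0..d n} (\<lambda>_. 0)"
      by (rule Henstock_Kurzweil_Integration.integral_cong) (use F0 in auto)
    ultimately show ?thesis by simp
  qed
  have IF: "integral {d n..H - d n} (F n) = 0" for n
  proof -
    have "integral {0..H - d n} (F n) + integral {H - d n..H} (F n) = integral {0..H} (F n)"
      by (rule Henstock_Kurzweil_Integration.integral_combine)
        (use d(1)[of n] dH(1)[of n] in \<open>auto intro!: integrable_continuous_real cF\<close>)
    moreover have "integral {H - d n..H} (F n) = integral {H - d n..H} (\<lambda>_. 0)"
      by (rule Henstock_Kurzweil_Integration.integral_cong) (use F0 in auto)
    moreover have "integral {0..H} (F n) = a n - a n * integral {0..H} \<rho>"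
      unfolding F_def a_def
      by (subst Henstock_Kurzweil_Integration.integral_diff)
        (auto intro!: integrable_continuous_real continuous_intros cf c\<rho>)
    ultimately show ?thesis using I\<rho> IF0[OF dH(1)] by simp
  qed
  have "\<exists>\<psi>. test_fun {0<..<H} \<psi> \<and> (\<forall>x. partial 1 \<psi> x = F n x) \<and> (\<forall>x\<ge>d n. \<psi> x = integral {d n..x} (F n)) \<and>
      (\<forall>x\<le>d n. \<psi> x = 0)" for n
  proof -
    obtain \<psi> where "test_fun {0<..<H} \<psi>" "\<And>x. partial 1 \<psi> x = F n x"
      "\<And>x. x \<ge> d n \<Longrightarrow> \<psi> x = integral {d n..x} (F n)" "\<And>x. x \<le> d n \<Longrightarrow> \<psi> x = 0"
      by (rule test_fun_antiderivative[OF sF[of n] F0[of _ n] IF[of n] dH(1)[of n] dH(2)[of n]]) blast+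
    then show ?thesis by blast
  qed
  then obtain \<psi> where \<psi>: "\<And>n. test_fun {0<..<H} (\<psi> n)" "\<And>n x. partial 1 (\<psi> n) x = F n x"
    "\<And>n x. x \<ge> d n \<Longrightarrow> \<psi> n x = integral {d n..x} (F n)" "\<And>n x. x \<le> d n \<Longrightarrow> \<psi> n x = 0"
    by metis
  have \<psi>I: "\<psi> n x = integral {0..x} (F n)" if "x \<in> {0..H}" for n x
  proof (cases "d n \<le> x")
    case False
    have "integral {0..x} (F n) = integral {0..x} (\<lambda>_. 0)"
      by (rule Henstock_Kurzweil_Integration.integral_cong) (use F0 False in auto)
    then show ?thesis using False \<psi>(4) by simp
  qed (simp add: \<psi>(3) IF0)
  obtain Bu where Bu: "\<And>y. y \<in> {0..H} \<Longrightarrow> \<bar>u y\<bar> \<le> Bu"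
    by (rule continuous_on_Icc_bounded[OF cu]) blast+
  have K0: "K \<ge> 0" using FK[of 0 0] H by auto
  show ?thesis
  proof (rule that[of \<psi>])
    show "test_fun {0<..<H} (\<psi> n)" for n by (rule \<psi>(1))
    show "(\<lambda>n. L2_norm_on {0<..<H} (\<lambda>y. \<psi> n y - u y)) \<longlonglongrightarrow> 0"
    proof (rule L2_norm_tendsto_0)
      show "continuous_on {0..H} (\<lambda>y. \<psi> n y - u y)" for n
        by (intro continuous_intros cu test_fun_continuous[OF \<psi>(1)])
      fix y assume y: "y \<in> {0<..<H}"
      then have y': "y \<in> {0..H}" by auto
      show "\<bar>\<psi> n y - u y\<bar> \<le> K * H + Bu" for n
      proof -
        have "norm (integral {0..y} (F n)) \<le> K * (y - 0)"
          by (rule integral_bound) (use y FK cF in auto)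
        also have "\<dots> \<le> K * H" using y K0 by (intro mult_left_mono) auto
        finally show ?thesis using Bu[OF y'] \<psi>I[OF y', of n] by simp
      qed
      have "(\<lambda>n. integral {0..y} (F n)) \<longlonglongrightarrow> integral {0..y} v"
        by (rule int_lim[OF y' cF FK Flim])
      then have "(\<lambda>n. \<psi> n y) \<longlonglongrightarrow> u y" using \<psi>I[OF y'] Iv[OF y'] by simp
      then show "(\<lambda>n. \<psi> n y - u y) \<longlonglongrightarrow> 0" by (simp add: LIM_zero_iff)
    qed
    show "(\<lambda>n. L2_norm_on {0<..<H} (\<lambda>y. partial 1 (\<psi> n) y - v y)) \<longlonglongrightarrow> 0"
      unfolding \<psi>(2)
    proof (rule L2_norm_tendsto_0)
      show "continuous_on {0..H} (\<lambda>y. F n y - v y)" for n by (intro continuous_intros cF v)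
      fix y assume y: "y \<in> {0<..<H}"
      then have y': "y \<in> {0..H}" by auto
      show "\<bar>F n y - v y\<bar> \<le> K + V" for n using FK[OF y', of n] V[OF y'] by linarith
      show "(\<lambda>n. F n y - v y) \<longlonglongrightarrow> 0" using Flim[OF y] by (simp add: LIM_zero_iff)
    qed
  qed
qed

text \<open>Convergence is required for every weak derivative of \<open>u\<close>; they all agree with \<open>v\<close> almost everywhere.\<close>

lemma sobolev_1_0_interval:
  assumes H: "H > 0" and du: "\<And>y. y \<in> {0..H} \<Longrightarrow> (u has_real_derivative v y) (at y within {0..H})"
    and v: "continuous_on {0..H} v" and bc: "u 0 = 0" "u H = 0"
  shows "u \<in> sobolev_1_0 {0<..<H}"
proof -
  let ?U = "{0<..<H}"
  have lu: "lip_primitive 0 H u v" by (rule lip_primitive_C1[OF du v])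
  have cu: "continuous_on {0..H} u" by (rule lip_primitive_continuous[OF lu])
  have wd: "weak_deriv ?U 1 u v"
    using weak_deriv_lip_primitive[OF H, of u "\<lambda>_. 1" v 1] lu v by simp
  have vL: "v \<in> L2_on ?U" by (rule L2_on_continuous[OF v])
  have "u \<in> sobolev 1 ?U"
    unfolding One_nat_def using wd vL L2_on_continuous[OF cu] by auto
  moreover obtain \<psi> where \<psi>: "\<And>n::nat. test_fun ?U (\<psi> n)" "(\<lambda>n. L2_norm_on ?U (\<lambda>y. \<psi> n y - u y)) \<longlonglongrightarrow> 0"
    "(\<lambda>n. L2_norm_on ?U (\<lambda>y. partial 1 (\<psi> n) y - v y)) \<longlonglongrightarrow> 0"
    by (rule test_fun_approximation[OF H du v bc]) blast+
  moreover have "(\<lambda>n. L2_norm_on ?U (\<lambda>y. partial 1 (\<psi> n) y - g y)) \<longlonglongrightarrow> 0"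
    if g: "g \<in> L2_on ?U" "weak_deriv ?U 1 u g" for g
  proof -
    have ae: "AE y in lborel. y \<in> ?U \<longrightarrow> g y = v y" by (rule weak_deriv_unique_AE[OF H g(2,1) wd vL])
    have meas: "(\<lambda>y. indicator ?U y *\<^sub>R (partial 1 (\<psi> n) y - h y)\<^sup>2) \<in> borel_measurable lborel"
      if h: "h \<in> L2_on ?U" for h n
    proof -
      have "(\<lambda>y. indicator ?U y *\<^sub>R h y) \<in> borel_measurable lborel"
        using h by (simp add: L2_on_def set_borel_measurable_def)
      moreover have "partial 1 (\<psi> n) \<in> borel_measurable borel"
        by (rule borel_measurable_continuous_onI[OF test_fun_continuous[OF test_fun_partial[OF \<psi>(1)]]]) simp
      ultimately have "(\<lambda>y. indicator ?U y * (partial 1 (\<psi> n) y - indicator ?U y *\<^sub>R h y)\<^sup>2) \<in> borel_measurable lborel"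
        by measurable
      then show ?thesis
        by (rule measurable_cong[THEN iffD1, rotated]) (auto simp: indicator_def)
    qed
    have "L2_norm_on ?U (\<lambda>y. partial 1 (\<psi> n) y - g y) = L2_norm_on ?U (\<lambda>y. partial 1 (\<psi> n) y - v y)" for n
    proof -
      have "(LINT y:?U|lborel. (partial 1 (\<psi> n) y - g y)\<^sup>2) = (LINT y:?U|lborel. (partial 1 (\<psi> n) y - v y)\<^sup>2)"
        unfolding set_lebesgue_integral_def
      proof (rule integral_cong_AE[OF meas[OF g(1)] meas[OF vL]])
        show "AE y in lborel. indicator ?U y *\<^sub>R (partial 1 (\<psi> n) y - g y)\<^sup>2
          = indicator ?U y *\<^sub>R (partial 1 (\<psi> n) y - v y)\<^sup>2"
          using ae by eventually_elim (auto simp: indicator_def)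
      qed
      then show ?thesis by (simp add: L2_norm_on_def)
    qed
    then show ?thesis using \<psi>(3) by simp
  qed
  ultimately show ?thesis unfolding sobolev_1_0_def by auto
qed

text \<open>The converse of the passage from weak to classical solutions; it turns the functions found by
shooting into eigenfunctions in the Sobolev sense.\<close>

lemma sturm_solution_eigenfunction:
  assumes H: "H > 0" and C: "C \<in> borel_measurable borel" "\<And>y. m \<le> C y" "m > 0"
    and Cc: "AE y in lborel. y \<in> {0<..<H} \<longrightarrow> C y = c y"
    and sol: "sturm_solution H (\<lambda>y. l / C y - q) u v" and bc: "u 0 = 0" "u H = 0" and nz: "v 0 \<noteq> 0"
  shows "eigenfunction c q {0<..<H} l u"
proof -
  let ?U = "{0<..<H}"
  define Q where "Q y = - (l / C y - q)" for y
  have Cpos: "C y > 0" for y using C(2)[of y] C(3) by linarith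
  have Qm: "Q \<in> borel_measurable borel" and Qb: "\<bar>Q y\<bar> \<le> \<bar>l\<bar> / m + \<bar>q\<bar>" for y
    using borel_measurable_uminus[OF potential_bounded(1)[OF C, of l q]] potential_bounded(2)[OF C, of l y q]
    unfolding Q_def[abs_def] by (simp_all only: abs_minus_cancel)
  have du: "\<And>y. y \<in> {0..H} \<Longrightarrow> (u has_real_derivative v y) (at y within {0..H})"
    using sol by (auto simp: sturm_solution_def)
  have cu: "continuous_on {0..H} u" and cv: "continuous_on {0..H} v"
    using sturm_solution_continuous[OF sol] by auto
  have lu: "lip_primitive 0 H u v" by (rule lip_primitive_C1[OF du cv])
  have lv: "lip_primitive 0 H v (\<lambda>y. Q y * u y)"
    using sol by (simp add: sturm_solution_def Q_def[abs_def] algebra_simps)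
  have w1: "weak_deriv ?U 1 u v"
    using weak_deriv_lip_primitive[OF H, of u "\<lambda>_. 1" v 1] lu cv by simp
  have w2: "weak_deriv ?U 1 v (\<lambda>y. Q y * u y)"
    by (rule weak_deriv_lip_primitive[OF H lv Qm Qb cu])
  have L: "u \<in> L2_on ?U" "v \<in> L2_on ?U" "(\<lambda>y. Q y * u y) \<in> L2_on ?U"
    by (rule L2_on_continuous[OF cu], rule L2_on_continuous[OF cv], rule L2_on_mult_continuous[OF Qm Qb cu])
  have "u \<in> sobolev 2 ?U"
    unfolding numeral_2_eq_2 using w1 w2 L by auto
  moreover have "u \<in> sobolev_1_0 ?U" by (rule sobolev_1_0_interval[OF H du cv bc])
  moreover have "\<not> (AE y\<in>?U in lborel. u y = 0)"
  proof
    assume "AE y\<in>?U in lborel. u y = 0"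
    then have u0: "u y = 0" if "y \<in> {0..H}" for y
      by (intro continuous_zero_if_AE_zero[OF cu H _ that]) auto
    have "(u has_vector_derivative v 0) (at 0 within {0..H})"
      using du[of 0] H by (simp add: has_real_derivative_iff_has_vector_derivative)
    then have "((\<lambda>_. 0) has_vector_derivative v 0) (at 0 within {0..H})"
      by (rule has_vector_derivative_transform[rotated 2]) (use u0 H in auto)
    then show False
      using vector_derivative_unique_within_closed_interval[of 0 H 0 "\<lambda>_. 0" "v 0" 0] H nz
      by (auto intro: derivative_eq_intros)
  qed
  moreover have "weak_laplacian ?U u (\<lambda>y. Q y * u y)"
    unfolding weak_laplacian_def
    by (intro exI[of _ "\<lambda>_. v"] exI[of _ "\<lambda>_ y. Q y * u y"]) (use w1 w2 L in auto)
  moreover have "AE y\<in>?U in lborel. c y * (q * u y - Q y * u y) = l * u y"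
    using Cc
  proof eventually_elim
    case (elim y)
    then show ?case using Cpos[of y] by (auto simp: Q_def field_simps)
  qed
  ultimately show ?thesis unfolding eigenfunction_def by blast
qed


section \<open>Eigenfunctions of the Dirichlet Laplacian\<close>

lemma set_integral_finite_sum:
  fixes f :: "'i \<Rightarrow> 'a \<Rightarrow> real"
  assumes "\<And>i. i \<in> I \<Longrightarrow> set_integrable M U (f i)"
  shows "set_integrable M U (\<lambda>x. \<Sum>i\<in>I. f i x)" "(LINT x:U|M. (\<Sum>i\<in>I. f i x)) = (\<Sum>i\<in>I. LINT x:U|M. f i x)"
  using assms unfolding set_integrable_def set_lebesgue_integral_def by (simp_all add: sum_distrib_left)

lemma eigenfunction_weak_helmholtz:
  fixes f :: "'a::euclidean_space \<Rightarrow> real"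
  assumes U: "open U" "bounded U" and f: "eigenfunction (\<lambda>_. 1) 0 U l f"
  shows "weak_helmholtz U l f"
proof -
  obtain h g g2 where g: "\<And>b. b \<in> Basis \<Longrightarrow> g b \<in> L2_on U \<and> weak_deriv U b f (g b) \<and> g2 b \<in> L2_on U \<and> weak_deriv U b (g b) (g2 b)"
    and h: "h = (\<lambda>x. \<Sum>b\<in>Basis. g2 b x)" "AE x in lborel. x \<in> U \<longrightarrow> - h x = l * f x"
    using f unfolding eigenfunction_def weak_laplacian_def by auto
  have fL: "f \<in> L2_on U" using f unfolding eigenfunction_def numeral_2_eq_2 by auto
  have fi: "set_integrable lborel U f" by (rule L2_on_set_integrable[OF U fL])
  have int: "set_integrable lborel U (\<lambda>x. k x * \<psi> x)" if k: "set_integrable lborel U k" and \<psi>: "continuous_on UNIV \<psi>"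
    for k \<psi> :: "'a \<Rightarrow> real"
  proof -
    have "integrable lborel (\<lambda>x. (indicator U x *\<^sub>R k x) * \<psi> x)"
    proof (rule integrable_mult_continuous[OF k[unfolded set_integrable_def] _ _ \<psi>])
      show "compact (closure U)" using U by simp
      show "indicator U x *\<^sub>R k x = 0" if "x \<notin> closure U" for x
        using that closure_subset[of U] by (auto simp: indicator_def)
    qed
    then show ?thesis by (simp add: set_integrable_def mult.assoc)
  qed
  have "(LINT x:U|lborel. f x * ((\<Sum>b\<in>Basis. partial b (partial b \<psi>) x) + l * \<psi> x)) = 0" if \<psi>: "test_fun U \<psi>" for \<psi>
  proof -
    have c\<psi>: "continuous_on UNIV \<psi>" using \<psi> smooth_on_continuous by (auto simp: test_fun_def)
    have c2: "continuous_on UNIV (partial b (partial b \<psi>))" if "b \<in> Basis" for b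
      using \<psi> that by (auto simp: test_fun_def intro!: smooth_on_continuous smooth_on_partial)
    have two: "(LINT x:U|lborel. f x * partial b (partial b \<psi>) x) = (LINT x:U|lborel. g2 b x * \<psi> x)" if b: "b \<in> Basis" for b
      using g[OF b] \<psi> test_fun_partial[OF \<psi> b] unfolding weak_deriv_def by (metis minus_equation_iff)
    have ig2: "set_integrable lborel U (\<lambda>x. g2 b x * \<psi> x)" if b: "b \<in> Basis" for b
      by (rule int[OF L2_on_set_integrable[OF U] c\<psi>]) (use g[OF b] in auto)
    have i1: "set_integrable lborel U (\<lambda>x. \<Sum>b\<in>Basis. f x * partial b (partial b \<psi>) x)"
      by (rule set_integral_finite_sum(1)) (auto intro: int[OF fi c2])
    have i2: "set_integrable lborel U (\<lambda>x. l * (f x * \<psi> x))" using int[OF fi c\<psi>] by simp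
    have "(LINT x:U|lborel. f x * ((\<Sum>b\<in>Basis. partial b (partial b \<psi>) x) + l * \<psi> x))
      = (LINT x:U|lborel. (\<Sum>b\<in>Basis. f x * partial b (partial b \<psi>) x) + l * (f x * \<psi> x))"
      by (simp add: distrib_left sum_distrib_left mult_ac)
    also have "\<dots> = (LINT x:U|lborel. (\<Sum>b\<in>Basis. f x * partial b (partial b \<psi>) x)) + (LINT x:U|lborel. l * (f x * \<psi> x))"
      by (rule set_integral_add(2)[OF i1 i2])
    also have "(LINT x:U|lborel. (\<Sum>b\<in>Basis. f x * partial b (partial b \<psi>) x)) = (\<Sum>b\<in>Basis. LINT x:U|lborel. f x * partial b (partial b \<psi>) x)"
      by (rule set_integral_finite_sum(2)) (auto intro: int[OF fi c2])
    also have "\<dots> = (\<Sum>b\<in>Basis. LINT x:U|lborel. g2 b x * \<psi> x)" using two by simp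
    also have "\<dots> = (LINT x:U|lborel. (\<Sum>b\<in>Basis. g2 b x * \<psi> x))"
      by (rule set_integral_finite_sum(2)[symmetric]) (auto intro: ig2)
    also have "\<dots> = (LINT x:U|lborel. - (l * (f x * \<psi> x)))"
      unfolding set_lebesgue_integral_def
    proof (rule integral_cong_AE)
      have "set_integrable lborel U (\<lambda>x. \<Sum>b\<in>Basis. g2 b x * \<psi> x)"
        by (rule set_integral_finite_sum(1)) (auto intro: ig2)
      then show "(\<lambda>x. indicator U x *\<^sub>R (\<Sum>b\<in>Basis. g2 b x * \<psi> x)) \<in> borel_measurable lborel"
        unfolding set_integrable_def by (rule borel_measurable_integrable)
      have "(\<lambda>x. indicator U x *\<^sub>R (l * (f x * \<psi> x))) \<in> borel_measurable lborel"
        using i2 unfolding set_integrable_def by (rule borel_measurable_integrable)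
      then show "(\<lambda>x. indicator U x *\<^sub>R - (l * (f x * \<psi> x))) \<in> borel_measurable lborel"
        using borel_measurable_uminus by fastforce
      show "AE x in lborel. indicator U x *\<^sub>R (\<Sum>b\<in>Basis. g2 b x * \<psi> x) = indicator U x *\<^sub>R - (l * (f x * \<psi> x))"
        using h(2)
      proof eventually_elim
        case (elim x)
        have "(\<Sum>b\<in>Basis. g2 b x * \<psi> x) = h x * \<psi> x" by (simp add: h(1) sum_distrib_right)
        moreover have "h x = - (l * f x)" if "x \<in> U" using elim that by linarith
        ultimately show ?case by (auto simp: indicator_def)
      qed
    qed
    also have "\<dots> = - (LINT x:U|lborel. l * (f x * \<psi> x))"
      unfolding set_lebesgue_integral_def scaleR_minus_right by (rule Bochner_Integration.integral_minus)
    finally show ?thesis by simp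
  qed
  then show ?thesis using fi by (simp add: weak_helmholtz_def)
qed

section \<open>Observability of separated modes\<close>

lemma integrable_lborel_product:
  fixes F :: "'a::euclidean_space \<Rightarrow> real" and G :: "'b::euclidean_space \<Rightarrow> real"
  assumes F: "integrable lborel F" and G: "integrable lborel G"
  shows "(LINT z|lborel. F (fst z) * G (snd z)) = (LINT x|lborel. F x) * (LINT y|lborel. G y)"
proof -
  have [measurable]: "F \<in> borel_measurable lborel" "G \<in> borel_measurable lborel"
    using F G by auto
  have i: "integrable (lborel \<Otimes>\<^sub>M lborel) (\<lambda>(x, y). F x * G y)"
  proof (rule lborel_pair.Fubini_integrable)
    show "(\<lambda>(x, y). F x * G y) \<in> borel_measurable (lborel \<Otimes>\<^sub>M lborel)" by measurable
    show "integrable lborel (\<lambda>x. LINT y|lborel. norm (case (x, y) of (x, y) \<Rightarrow> F x * G y))"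
      using F by (simp add: abs_mult)
    show "AE x in lborel. integrable lborel (\<lambda>y. case (x, y) of (x, y) \<Rightarrow> F x * G y)"
      using G by simp
  qed
  have "(LINT z|lborel. F (fst z) * G (snd z)) = (LINT z|(lborel \<Otimes>\<^sub>M lborel). (case z of (x, y) \<Rightarrow> F x * G y))"
    by (simp add: lborel_prod case_prod_beta)
  also have "\<dots> = (LINT x|lborel. LINT y|lborel. F x * G y)"
    using lborel_pair.integral_fst'[OF i] by simp
  also have "\<dots> = (LINT x|lborel. F x) * (LINT y|lborel. G y)" by simp
  finally show ?thesis .
qed

lemma L2_norm_separated_mode:
  fixes A :: "'a::euclidean_space set" and B :: "real set"
  assumes "set_integrable lborel A (\<lambda>x. (\<phi> k x)\<^sup>2)" "set_integrable lborel B (\<lambda>y. (u l k y)\<^sup>2)"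
  shows "L2_norm_on (A \<times> B) (separated_mode \<phi> u k l) = L2_norm_on A (\<phi> k) * L2_norm_on B (u l k)"
proof -
  have "(LINT z:A \<times> B|lborel. (separated_mode \<phi> u k l z)\<^sup>2)
    = (LINT z|lborel. (indicator A (fst z) *\<^sub>R (\<phi> k (fst z))\<^sup>2) * (indicator B (snd z) *\<^sub>R (u l k (snd z))\<^sup>2))"
    unfolding set_lebesgue_integral_def
    by (rule Bochner_Integration.integral_cong)
      (auto simp: separated_mode_def indicator_times power_mult_distrib case_prod_beta)
  also have "\<dots> = (LINT x:A|lborel. (\<phi> k x)\<^sup>2) * (LINT y:B|lborel. (u l k y)\<^sup>2)"
    using assms unfolding set_integrable_def set_lebesgue_integral_def by (rule integrable_lborel_product)
  finally show ?thesis by (simp add: L2_norm_on_def real_sqrt_mult)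
qed

lemma L2_norm_on_mono:
  assumes "A \<subseteq> B" "A \<in> sets lborel" "set_integrable lborel B (\<lambda>x. (f x)\<^sup>2)"
  shows "L2_norm_on A f \<le> L2_norm_on B f"
proof -
  have "set_integrable lborel A (\<lambda>x. (f x)\<^sup>2)" by (rule set_integrable_subset[OF assms(3,2,1)])
  then have "(LINT x:A|lborel. (f x)\<^sup>2) \<le> (LINT x:B|lborel. (f x)\<^sup>2)"
    unfolding set_lebesgue_integral_def set_integrable_def using assms
    by (intro integral_mono) (auto simp: set_integrable_def indicator_def)
  then show ?thesis by (simp add: L2_norm_on_def)
qed

lemma dirichlet_eigenpairs_normalized:
  assumes "dirichlet_eigenpairs U \<mu> \<phi>" "k \<ge> 1"
  shows "set_integrable lborel U (\<lambda>x. (\<phi> k x)\<^sup>2)" "L2_norm_on U (\<phi> k) = 1"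
proof -
  have "\<phi> k \<in> L2_on U"
    using assms unfolding dirichlet_eigenpairs_def eigenfunction_def numeral_2_eq_2 by auto
  then show "set_integrable lborel U (\<lambda>x. (\<phi> k x)\<^sup>2)" by (simp add: L2_on_def)
  have "(LINT x:U|lborel. \<phi> k x * \<phi> k x) = 1" using assms by (simp add: dirichlet_eigenpairs_def)
  then show "L2_norm_on U (\<phi> k) = 1" by (simp add: L2_norm_on_def power2_eq_square)
qed

text \<open>Non-concentration bounds the norms on \<open>W\<close> from below for large \<open>k\<close> only; the remaining finitely many
norms are positive by unique continuation.\<close>

lemma non_concentrating_lower_bound:
  fixes U W :: "'a::euclidean_space set"
  assumes U: "open U" "connected U" "bounded U" and W: "open W" "W \<noteq> {}" "W \<subseteq> U"
    and eig: "dirichlet_eigenpairs U \<mu> \<phi>" and nc: "W \<noteq> U \<Longrightarrow> non_concentrating U W \<phi>"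
  obtains \<delta> where "\<delta> > 0" "\<And>k. k \<ge> 1 \<Longrightarrow> \<delta> \<le> L2_norm_on W (\<phi> k)"
proof -
  have ef: "eigenfunction (\<lambda>_. 1) 0 U ((\<mu> k)\<^sup>2) (\<phi> k)" if "k \<ge> 1" for k
    using eig that by (simp add: dirichlet_eigenpairs_def)
  note iU = dirichlet_eigenpairs_normalized(1)[OF eig] and norm1 = dirichlet_eigenpairs_normalized(2)[OF eig]
  have iW: "set_integrable lborel W (\<lambda>x. (\<phi> k x)\<^sup>2)" if "k \<ge> 1" for k
    by (rule set_integrable_subset[OF iU[OF that]]) (use W in auto)
  have pos: "L2_norm_on W (\<phi> k) > 0" if k: "k \<ge> 1" for k
  proof (rule ccontr)
    assume "\<not> L2_norm_on W (\<phi> k) > 0"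
    moreover have nn: "0 \<le> (LINT x:W|lborel. (\<phi> k x)\<^sup>2)"
      unfolding set_lebesgue_integral_def by (rule Bochner_Integration.integral_nonneg) simp
    ultimately have "(LINT x:W|lborel. (\<phi> k x)\<^sup>2) = 0" by (simp add: L2_norm_on_def)
    then have "AE x in lborel. indicator W x *\<^sub>R (\<phi> k x)\<^sup>2 = 0"
      using iW[OF k] unfolding set_lebesgue_integral_def set_integrable_def
      by (subst (asm) integral_nonneg_eq_0_iff_AE) auto
    then have "AE x in lborel. x \<in> W \<longrightarrow> \<phi> k x = 0" by eventually_elim (auto simp: indicator_def)
    then have "AE x in lborel. x \<in> U \<longrightarrow> \<phi> k x = 0"
      by (rule weak_helmholtz_unique_continuation[OF eigenfunction_weak_helmholtz[OF U(1,3) ef[OF k]] U W])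
    then show False using ef[OF k] by (simp add: eigenfunction_def)
  qed
  show ?thesis
  proof (cases "W = U")
    case True
    then show ?thesis using that[of 1] norm1 by simp
  next
    case False
    then have nc': "non_concentrating U W \<phi>" by (rule nc)
    define n where "n k = L2_norm_on W (\<phi> k)" for k
    have "\<exists>\<delta>>0. \<forall>k\<ge>1. \<delta> \<le> n k"
    proof (rule ccontr)
      assume "\<not> ?thesis"
      then have small: "\<exists>k\<ge>1. n k < \<delta>" if "\<delta> > 0" for \<delta> using that by (meson linorder_not_le)
      have later: "\<exists>k>N. k \<ge> 1 \<and> n k < \<delta>" if "\<delta> > 0" for \<delta> and N :: nat
      proof -
        define m where "m = Min (insert \<delta> (n ` {1..N}))"
        have "m > 0" using \<open>\<delta> > 0\<close> pos by (auto simp: m_def n_def)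
        then obtain k where k: "k \<ge> 1" "n k < m" using small by blast
        have "n k < x" if "x \<in> insert \<delta> (n ` {1..N})" for x
          by (rule less_le_trans[OF k(2)]) (use that in \<open>simp only: m_def, intro Min_le, simp_all\<close>)
        note lt = this
        have "N < k"
        proof (rule ccontr)
          assume "\<not> N < k"
          then have "n k \<in> insert \<delta> (n ` {1..N})" using k(1) by auto
          then show False using lt by blast
        qed
        then show ?thesis using k(1) lt[of \<delta>] by blast
      qed
      have "\<exists>r. \<forall>j. (r j \<ge> 1 \<and> n (r j) < 1 / (real j + 1)) \<and> r j < r (Suc j)"
      proof (rule dependent_nat_choice)
        show "\<exists>k. k \<ge> 1 \<and> n k < 1 / (real 0 + 1)" using small[of 1] by auto
        show "\<exists>k'. (k' \<ge> 1 \<and> n k' < 1 / (real (Suc j) + 1)) \<and> k < k'" for k j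
          using later[of "1 / (real (Suc j) + 1)" k] by auto
      qed
      then obtain r where r: "\<And>j. r j \<ge> 1" "\<And>j. n (r j) < 1 / (real j + 1)" "\<And>j. r j < r (Suc j)" by blast
      have "(\<lambda>j. n (r j)) \<longlonglongrightarrow> 0"
      proof (rule tendsto_sandwich[OF _ _ tendsto_const LIMSEQ_inverse_real_of_nat])
        show "\<forall>\<^sub>F j in sequentially. 0 \<le> n (r j)" using pos[OF r(1)] by (simp add: n_def less_imp_le)
        show "\<forall>\<^sub>F j in sequentially. n (r j) \<le> inverse (real (Suc j))"
          using less_imp_le[OF r(2)] by (simp add: inverse_eq_divide add.commute)
      qed
      from tendsto_power[OF this, of 2]
      have "(\<lambda>j. (L2_norm_on W (\<phi> (r j)))\<^sup>2 / (L2_norm_on U (\<phi> (r j)))\<^sup>2) \<longlonglongrightarrow> 0"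
        using norm1[OF r(1)] by (simp add: n_def)
      moreover have "strict_mono r" using r(3) by (simp add: strict_mono_Suc_iff)
      ultimately show False using nc' r(1) unfolding non_concentrating_def by blast
    qed
    then show ?thesis using that unfolding n_def by blast
  qed
qed

text \<open>On the spectral set \<open>m = \<mu>\<^sub>k\<^sup>2\<close> is at most \<open>l / (M + \<epsilon>)\<close>. The margin \<open>\<epsilon>\<close> thus makes the potential
\<open>l / c - \<mu>\<^sub>k\<^sup>2\<close> comparable to \<open>l\<close>, uniformly in \<open>k\<close>.\<close>

lemma potential_lower_bound:
  fixes C M \<epsilon> m l :: real
  assumes "0 < C" "C \<le> M" "\<epsilon> > 0" and l: "(M + \<epsilon>) * m \<le> l" "0 \<le> l"
  shows "(1 / M - 1 / (M + \<epsilon>)) * l \<le> l / C - m"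
proof -
  have "m \<le> l / (M + \<epsilon>)" using assms by (simp add: pos_le_divide_eq mult.commute)
  moreover have "l / M \<le> l / C" using assms by (intro divide_left_mono) auto
  ultimately show ?thesis by (simp add: left_diff_distrib)
qed

text \<open>The infimum of the theorem is taken over a nonempty set; over the empty set of reals it would be
an unspecified number.\<close>

lemma large_eigenvalue_exists:
  fixes C c :: "real \<Rightarrow> real" and H m M \<epsilon> q :: real
  assumes H: "H > 0" and C: "C \<in> borel_measurable borel" "\<And>y. m \<le> C y" "\<And>y. C y \<le> M" "0 < m"
    and Cc: "AE y in lborel. y \<in> {0<..<H} \<longrightarrow> C y = c y" and \<epsilon>: "\<epsilon> > 0" and q: "q > 0"
  shows "\<exists>l\<ge>(M + \<epsilon>) * q. eigenvalue c q {0<..<H} l"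
proof -
  define p where "p y = 1 / C y" for y
  have C_pos: "0 < C y" for y using C(2)[of y] C(4) by linarith
  have M: "0 < M" using C(3) C_pos less_le_trans by blast
  have pm: "p \<in> borel_measurable borel" unfolding p_def[abs_def] using C(1) by measurable
  have pb: "0 \<le> p y \<and> p y \<le> 1 / m" for y
    unfolding p_def using divide_left_mono[OF C(2)[of y], of 1] C_pos[of y] C(4) by simp
  then have p_abs: "\<bar>p y\<bar> \<le> 1 / m" for y by simp
  have p_int: "p absolutely_integrable_on {0..H}"
  proof -
    have "set_integrable lborel {0<..<H} p"
      using set_integrable_mult_continuous[OF pm p_abs continuous_on_const[of "{0..H}" 1]] by simp
    then have "set_integrable lebesgue {0<..<H} p"
      unfolding set_integrable_def using borel_measurable_integrable integrable_completion by blast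
    then show ?thesis using absolutely_integrable_on_open_interval[where f = p and a = 0 and b = H] by simp
  qed
  define \<kappa> where "\<kappa> = 1 / M - 1 / (M + \<epsilon>)"
  have "1 / (M + \<epsilon>) < 1 / M" using M \<epsilon> by (intro divide_strict_left_mono) auto
  then have \<kappa>: "\<kappa> > 0" by (simp add: \<kappa>_def)
  have \<Lambda>: "(M + \<epsilon>) * q > 0" using M \<epsilon> q by (intro mult_pos_pos) auto
  have low: "\<kappa> * l \<le> l * p y - q" if "(M + \<epsilon>) * q \<le> l" for l y
    using potential_lower_bound[OF C_pos C(3) \<epsilon> that, of y] that \<Lambda> by (simp add: \<kappa>_def p_def)
  obtain l w v where sol: "l \<ge> (M + \<epsilon>) * q" "sturm_solution H (\<lambda>y. l * p y - q) w v" "w 0 = 0" "w H = 0" "v 0 \<noteq> 0"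
    by (rule dirichlet_sturm_solution_exists[OF H p_int pb \<kappa> \<Lambda> low]) blast+
  have "eigenfunction c q {0<..<H} l w"
  proof (rule sturm_solution_eigenfunction[OF H C(1,2,4) Cc])
    show "sturm_solution H (\<lambda>y. l / C y - q) w v" using sol(2) by (simp add: p_def)
  qed (rule sol)+
  then show ?thesis using sol(1) unfolding eigenvalue_def by blast
qed

lemma L2_norm_le_if_normalized:
  fixes C c w :: "real \<Rightarrow> real" and H m M :: real
  assumes C: "C \<in> borel_measurable borel" "\<And>y. m \<le> C y" "\<And>y. C y \<le> M" "0 < m"
    and Cc: "AE y in lborel. y \<in> {0<..<H} \<longrightarrow> C y = c y"
    and w: "continuous_on {0..H} w" "(LINT y:{0<..<H}|lborel. (w y)\<^sup>2 / c y) = 1"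
  shows "L2_norm_on {0<..<H} w \<le> sqrt M"
proof -
  have C_pos: "0 < C y" for y using C(2)[of y] C(4) by linarith
  have cw2: "continuous_on {0..H} (\<lambda>y. (w y)\<^sup>2)" by (intro continuous_intros w)
  have iC: "set_integrable lborel {0<..<H} (\<lambda>y. 1 / C y * (w y)\<^sup>2)"
    using set_integrable_mult_continuous[OF potential_bounded(1,2)[OF C(1,2,4), where l = 1 and q = 0] cw2] by simp
  have "set_integrable lborel {0<..<H} (\<lambda>y. (w y)\<^sup>2 / c y)"
  proof (rule ccontr)
    assume "\<not> ?thesis"
    then have "(LINT y:{0<..<H}|lborel. (w y)\<^sup>2 / c y) = 0"
      unfolding set_lebesgue_integral_def set_integrable_def by (rule not_integrable_integral_eq)
    then show False using w(2) by simp
  qed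
  then have "(\<lambda>y. indicator {0<..<H} y *\<^sub>R ((w y)\<^sup>2 / c y)) \<in> borel_measurable lborel"
    unfolding set_integrable_def by (rule borel_measurable_integrable)
  moreover have "(\<lambda>y. indicator {0<..<H} y *\<^sub>R (1 / C y * (w y)\<^sup>2)) \<in> borel_measurable lborel"
    using iC unfolding set_integrable_def by (rule borel_measurable_integrable)
  moreover have "AE y in lborel. indicator {0<..<H} y *\<^sub>R (1 / C y * (w y)\<^sup>2)
      = indicator {0<..<H} y *\<^sub>R ((w y)\<^sup>2 / c y)"
    using Cc by eventually_elim (auto simp: indicator_def)
  ultimately have "(LINT y:{0<..<H}|lborel. 1 / C y * (w y)\<^sup>2) = (LINT y:{0<..<H}|lborel. (w y)\<^sup>2 / c y)"
    unfolding set_lebesgue_integral_def by (intro integral_cong_AE)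
  then have "(LINT y:{0<..<H}|lborel. 1 / C y * (w y)\<^sup>2) = 1" using w(2) by (rule trans)
  moreover have "(LINT y:{0<..<H}|lborel. (w y)\<^sup>2) \<le> (LINT y:{0<..<H}|lborel. M * (1 / C y * (w y)\<^sup>2))"
  proof (rule set_integral_mono[OF LINT_eq_integral_continuous(2)[OF cw2]])
    show "set_integrable lborel {0<..<H} (\<lambda>y. M * (1 / C y * (w y)\<^sup>2))" using iC by (rule set_integrable_mult_right)
    fix y
    have "1 * (w y)\<^sup>2 \<le> (M / C y) * (w y)\<^sup>2"
      using C(3)[of y] C_pos[of y] by (intro mult_right_mono) auto
    then show "(w y)\<^sup>2 \<le> M * (1 / C y * (w y)\<^sup>2)" by simp
  qed
  moreover have "(LINT y:{0<..<H}|lborel. M * (1 / C y * (w y)\<^sup>2)) = M * (LINT y:{0<..<H}|lborel. 1 / C y * (w y)\<^sup>2)"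
    by (rule set_integral_mult_right)
  ultimately have "(LINT y:{0<..<H}|lborel. (w y)\<^sup>2) \<le> M" by (simp only: mult_1_right)
  then show ?thesis by (simp add: L2_norm_on_def)
qed

theorem theorem2p8:
  fixes \<Omega>' \<omega>' :: "'a::euclidean_space set"
    and H \<epsilon> a b :: real
    and c :: "real \<Rightarrow> real"
    and \<mu> :: "nat \<Rightarrow> real"
    and \<phi> :: "nat \<Rightarrow> 'a \<Rightarrow> real"
    and u :: "real \<Rightarrow> nat \<Rightarrow> real \<Rightarrow> real"
  assumes "smooth_bounded_domain \<Omega>'"
    and "H > 0"
    and "dirichlet_eigenpairs \<Omega>' \<mu> \<phi>"
    and "Linf_on {0<..<H} c"
    and "0 < ess_inf_on {0<..<H} c"
    and "ess_inf_on {0<..<H} c < ess_sup_on {0<..<H} c"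
    and "\<And>k l. k \<ge> 1 \<Longrightarrow> eigenvalue c ((\<mu> k)\<^sup>2) {0<..<H} l \<Longrightarrow>
           normalized_eigenfunction H c ((\<mu> k)\<^sup>2) l (u l k)"
    and "\<epsilon> > 0"
    and "minimal_amplitude_hypothesis H c \<mu> u \<epsilon>"
    and "\<omega>' \<times> {a<..<b} \<subseteq> \<Omega>' \<times> {0<..<H}"
    and "open (\<omega>' \<times> {a<..<b})"
    and "\<omega>' \<times> {a<..<b} \<noteq> {}"
    and "\<omega>' \<noteq> \<Omega>' \<Longrightarrow> non_concentrating \<Omega>' \<omega>' \<phi>"
  shows "\<exists>C. 0 < C \<and>
    C \<le> (INF (k, l) \<in> spectral_set H c \<mu> \<epsilon>.
            L2_norm_on (\<omega>' \<times> {a<..<b}) (separated_mode \<phi> u k l) /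
            L2_norm_on (\<Omega>' \<times> {0<..<H}) (separated_mode \<phi> u k l)) \<and>
    (INF (k, l) \<in> spectral_set H c \<mu> \<epsilon>.
            L2_norm_on (\<omega>' \<times> {a<..<b}) (separated_mode \<phi> u k l) /
            L2_norm_on (\<Omega>' \<times> {0<..<H}) (separated_mode \<phi> u k l)) \<le> 1"
proof -
  note H = assms(2) and eig = assms(3) and normal = assms(7) and \<epsilon> = assms(8)
  define cm where "cm = ess_inf_on {0<..<H} c"
  define cM where "cM = ess_sup_on {0<..<H} c"
  have cmM: "0 < cm" "cm < cM" using assms(5,6) by (auto simp: cm_def cM_def)
  obtain C where C: "C \<in> borel_measurable borel" "\<And>y. cm \<le> C y \<and> C y \<le> cM"
    "AE y in lborel. y \<in> {0<..<H} \<longrightarrow> C y = c y"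
    unfolding cm_def cM_def by (rule Linf_truncation[OF assms(4-6)]) blast+
  have C_low: "cm \<le> C y" and C_up: "C y \<le> cM" and C_pos: "0 < C y" for y using C(2)[of y] cmM by auto
  have \<Omega>: "open \<Omega>'" "connected \<Omega>'" "bounded \<Omega>'" using assms(1) by (auto simp: smooth_bounded_domain_def)
  have ne: "\<omega>' \<noteq> {}" "a < b" using assms(12) by auto
  have sub: "\<omega>' \<subseteq> \<Omega>'" "{a<..<b} \<subseteq> {0<..<H}" using assms(10) ne by (auto simp: times_subset_iff)
  have ab: "0 \<le> a" "a < b" "b \<le> H"
    using sub(2) ne(2) by (auto simp: greaterThanLessThan_subseteq_greaterThanLessThan)
  have \<omega>_open: "open \<omega>'" using open_image_fst[OF assms(11)] ne by (simp add: fst_image_times)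
  obtain \<delta> where \<delta>: "\<delta> > 0" "\<And>k. k \<ge> 1 \<Longrightarrow> \<delta> \<le> L2_norm_on \<omega>' (\<phi> k)"
    by (rule non_concentrating_lower_bound[OF \<Omega> \<omega>_open ne(1) sub(1) eig assms(13)]) blast+

  define \<kappa> where "\<kappa> = 1 / cM - 1 / (cM + \<epsilon>)"
  have "1 / (cM + \<epsilon>) < 1 / cM" using cmM \<epsilon> by (intro divide_strict_left_mono) auto
  then have \<kappa>: "\<kappa> > 0" by (simp add: \<kappa>_def)
  have \<mu>: "\<mu> k > 0" if "k \<ge> 1" for k using eig that by (simp add: dirichlet_eigenpairs_def)

  let ?S = "spectral_set H c \<mu> \<epsilon>"
  have S_iff: "(k, l) \<in> ?S \<longleftrightarrow> k \<ge> 1 \<and> eigenvalue c ((\<mu> k)\<^sup>2) {0<..<H} l \<and> (cM + \<epsilon>) * (\<mu> k)\<^sup>2 \<le> l" for k l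
    by (auto simp: spectral_set_def cM_def)
  have S_ne: "?S \<noteq> {}"
  proof -
    have "(\<mu> 1)\<^sup>2 > 0" using \<mu>[of 1] by simp
    then obtain l where "l \<ge> (cM + \<epsilon>) * (\<mu> 1)\<^sup>2" "eigenvalue c ((\<mu> 1)\<^sup>2) {0<..<H} l"
      using large_eigenvalue_exists[OF H C(1) C_low C_up cmM(1) C(3) \<epsilon>] by blast
    then have "(1, l) \<in> ?S" by (simp add: S_iff)
    then show ?thesis by blast
  qed

  \<comment> \<open>\<open>A\<close> is the square of the minimal amplitude.\<close>
  let ?amps = "{amplitude_sq H (u l k) y | y k l. y \<in> {0..H} \<and> (k, l) \<in> ?S}"
  define A where "A = Inf ?amps"
  have A: "A > 0" using assms(9) by (simp add: minimal_amplitude_hypothesis_def min_amplitude_def A_def)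
  have A_le: "A \<le> amplitude_sq H (u l k) y" if "y \<in> {0..H}" "(k, l) \<in> ?S" for y k l
    unfolding A_def
  proof (rule cInf_lower)
    show "bdd_below ?amps" by (rule bdd_belowI[of _ 0]) (auto simp: amplitude_sq_def)
  qed (use that in blast)
  have K: "1 / cm > 0" using cmM by simp
  obtain \<beta> where \<beta>: "\<beta> > 0" "\<And>l Q w v. l > 0 \<Longrightarrow> sturm_solution H Q w v \<Longrightarrow>
       (\<And>y. y \<in> {0..H} \<Longrightarrow> \<kappa> * l \<le> Q y \<and> Q y \<le> 1 / cm * l) \<Longrightarrow>
       (\<And>y. y \<in> {0..H} \<Longrightarrow> A \<le> (w y)\<^sup>2 + (v y)\<^sup>2) \<Longrightarrow> \<beta> \<le> integral {a..b} (\<lambda>y. (w y)\<^sup>2)"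
    using sturm_mass_uniform[OF ab \<kappa> K A] by metis

  define ratio where "ratio k l = L2_norm_on (\<omega>' \<times> {a<..<b}) (separated_mode \<phi> u k l) /
            L2_norm_on (\<Omega>' \<times> {0<..<H}) (separated_mode \<phi> u k l)" for k l
  have bounds: "\<delta> * sqrt \<beta> / sqrt cM \<le> ratio k l" "ratio k l \<le> 1" if kl: "(k, l) \<in> ?S" for k l
  proof -
    have k: "k \<ge> 1" and ev: "eigenvalue c ((\<mu> k)\<^sup>2) {0<..<H} l" and l: "(cM + \<epsilon>) * (\<mu> k)\<^sup>2 \<le> l"
      using kl by (auto simp: S_iff)
    have l0: "l > 0"
    proof -
      have "0 < (cM + \<epsilon>) * (\<mu> k)\<^sup>2" using cmM \<epsilon> \<mu>[OF k] by (intro mult_pos_pos) auto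
      then show ?thesis using l by linarith
    qed
    define w where "w = u l k"
    obtain v where w: "eigenfunction c ((\<mu> k)\<^sup>2) {0<..<H} l w" "(LINT y:{0<..<H}|lborel. (w y)\<^sup>2 / c y) = 1"
      and v: "continuous_on {0..H} v" "\<And>y. y \<in> {0..H} \<Longrightarrow> (w has_vector_derivative v y) (at y within {0..H})"
      using normal[OF k ev] unfolding normalized_eigenfunction_def w_def by blast
    have sol: "sturm_solution H (\<lambda>y. l / C y - (\<mu> k)\<^sup>2) w v"
      by (rule eigenfunction_sturm_solution[OF H C(1) C_low cmM(1) C(3) w(1) v])
    have cw: "continuous_on {0..H} w" by (rule sturm_solution_continuous(1)[OF sol])
    have cw2: "continuous_on {0..H} (\<lambda>y. (w y)\<^sup>2)" by (intro continuous_intros cw)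
    have "\<beta> \<le> integral {a..b} (\<lambda>y. (w y)\<^sup>2)"
    proof (rule \<beta>(2)[OF l0 sol])
      fix y assume y: "y \<in> {0..H}"
      have "l / C y \<le> l / cm"
        using l0 C_low[of y] C_pos[of y] cmM by (intro divide_left_mono) auto
      then have "l / C y - (\<mu> k)\<^sup>2 \<le> 1 / cm * l" using zero_le_power2[of "\<mu> k"] by (simp, linarith)
      moreover have "\<kappa> * l \<le> l / C y - (\<mu> k)\<^sup>2"
        unfolding \<kappa>_def using potential_lower_bound[OF C_pos C_up \<epsilon> l] l0 by simp
      ultimately show "\<kappa> * l \<le> l / C y - (\<mu> k)\<^sup>2 \<and> l / C y - (\<mu> k)\<^sup>2 \<le> 1 / cm * l" by simp
      have "vector_derivative w (at y within {0..H}) = v y"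
        by (rule vector_derivative_within_closed_interval[OF H y v(2)[OF y]])
      then show "A \<le> (w y)\<^sup>2 + (v y)\<^sup>2" using A_le[OF y kl] by (simp add: amplitude_sq_def w_def)
    qed
    moreover have "(LINT y:{a<..<b}|lborel. (w y)\<^sup>2) = integral {a..b} (\<lambda>y. (w y)\<^sup>2)"
    proof -
      have "set_integrable lborel {a<..<b} (\<lambda>y. (w y)\<^sup>2)"
        by (rule set_integrable_subset[OF LINT_eq_integral_continuous(2)[OF cw2] _ sub(2)]) simp
      from set_borel_integral_eq_integral(2)[OF this] show ?thesis
        by (simp add: integral_open_interval_real)
    qed
    ultimately have w_ab: "sqrt \<beta> \<le> L2_norm_on {a<..<b} w" by (simp add: L2_norm_on_def)
    have i0: "set_integrable lborel {0<..<H} (\<lambda>y. (w y)\<^sup>2)" by (rule LINT_eq_integral_continuous(2)[OF cw2])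
    have w_0H: "L2_norm_on {0<..<H} w \<le> sqrt cM"
      by (rule L2_norm_le_if_normalized[OF C(1) C_low C_up cmM(1) C(3) cw w(2)])
    have i_ab: "set_integrable lborel {a<..<b} (\<lambda>y. (w y)\<^sup>2)"
      by (rule set_integrable_subset[OF i0 _ sub(2)]) simp
    note i\<Omega> = dirichlet_eigenpairs_normalized(1)[OF eig k] and \<phi>1 = dirichlet_eigenpairs_normalized(2)[OF eig k]
    have i\<omega>: "set_integrable lborel \<omega>' (\<lambda>x. (\<phi> k x)\<^sup>2)"
      by (rule set_integrable_subset[OF i\<Omega> _ sub(1)]) (use \<omega>_open in simp)
    have ratio: "ratio k l = L2_norm_on \<omega>' (\<phi> k) * (L2_norm_on {a<..<b} w / L2_norm_on {0<..<H} w)"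
      unfolding ratio_def
      using L2_norm_separated_mode[where \<phi> = \<phi> and u = u and k = k and l = l, OF i\<omega> i_ab[unfolded w_def]]
        L2_norm_separated_mode[where \<phi> = \<phi> and u = u and k = k and l = l, OF i\<Omega> i0[unfolded w_def]] \<phi>1
      by (simp add: w_def)
    have le1: "L2_norm_on \<omega>' (\<phi> k) \<le> 1"
      using L2_norm_on_mono[OF sub(1) _ i\<Omega>] \<omega>_open \<phi>1 by simp
    have le2: "L2_norm_on {a<..<b} w \<le> L2_norm_on {0<..<H} w"
      by (rule L2_norm_on_mono[OF sub(2) _ i0]) simp
    have pos: "0 < L2_norm_on {0<..<H} w"
    proof -
      have "0 < sqrt \<beta>" using \<beta>(1) by simp
      then show ?thesis using w_ab le2 by linarith
    qed
    have quot: "sqrt \<beta> / sqrt cM \<le> L2_norm_on {a<..<b} w / L2_norm_on {0<..<H} w"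
      using w_ab w_0H pos order_trans[OF real_sqrt_ge_zero[OF less_imp_le[OF \<beta>(1)]] w_ab]
      by (intro frac_le) auto
    have "\<delta> * (sqrt \<beta> / sqrt cM) \<le> ratio k l"
      unfolding ratio using \<delta>(1) \<delta>(2)[OF k] quot \<beta>(1) cmM by (intro mult_mono) auto
    then show "\<delta> * sqrt \<beta> / sqrt cM \<le> ratio k l" by simp
    have "ratio k l \<le> 1 * 1"
      unfolding ratio
    proof (rule mult_mono)
      show "L2_norm_on {a<..<b} w / L2_norm_on {0<..<H} w \<le> 1" using le2 pos by simp
      have "0 \<le> sqrt \<beta> / sqrt cM" using \<beta>(1) cmM by simp
      then show "0 \<le> L2_norm_on {a<..<b} w / L2_norm_on {0<..<H} w" using quot by linarith
    qed (use le1 in auto)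
    then show "ratio k l \<le> 1" by simp
  qed
  define C0 where "C0 = \<delta> * sqrt \<beta> / sqrt cM"
  have "0 < C0" using \<delta> \<beta> cmM by (simp add: C0_def)
  moreover have "C0 \<le> (INF (k, l) \<in> ?S. ratio k l)"
    by (rule cINF_greatest[OF S_ne]) (use bounds(1) in \<open>auto simp: C0_def\<close>)
  moreover have "(INF (k, l) \<in> ?S. ratio k l) \<le> 1"
  proof -
    obtain k l where kl: "(k, l) \<in> ?S" using S_ne by auto
    have "bdd_below ((\<lambda>(k, l). ratio k l) ` ?S)"
      by (rule bdd_belowI2[of _ C0]) (use bounds(1) in \<open>auto simp: C0_def\<close>)
    then show ?thesis using cINF_lower2[OF _ kl, of "\<lambda>(k, l). ratio k l" 1] bounds(2)[OF kl] by simp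
  qed
  ultimately show ?thesis unfolding ratio_def by blast
qed

end
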